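(* The monoid $\mathbf{Br}_n^B$ is generated by $\tilde{s}_i$ and $\tilde{\mathtt{s}}_i$, $i=0,1,\dots,n-1$, subject to the following relations (a presentation of $\mathbf{Br}^B_n$), for all admissible indices in $\{0,1,\dots,n-1\}$: (1) $\tilde{s}_0\tilde{s}_1\tilde{s}_0\tilde{s}_1=\tilde{s}_1\tilde{s}_0\tilde{s}_1\tilde{s}_0$; $\tilde{s}_i\tilde{s}_j\tilde{s}_i=\tilde{s}_j\tilde{s}_i\tilde{s}_j$ for $i,j\ge1$, $|i-j|=1$; $\tilde{s}_i\tilde{s}_j=\tilde{s}_j\tilde{s}_i$ for $|i-j|>1$; (2) $\tilde{\mathtt{s}}_i\tilde{s}_j\tilde{s}_i=\tilde{s}_j\tilde{s}_i\tilde{\mathtt{s}}_j$ for $i,j\ge1$, $|i-j|=1$; (3) $\tilde{\mathtt{s}}_0\tilde{s}_1\tilde{s}_0\tilde{s}_1=\tilde{s}_1\tilde{s}_0\tilde{s}_1\tilde{\mathtt{s}}_0$; $\tilde{\mathtt{s}}_1\tilde{s}_0\tilde{s}_1\tilde{s}_0=\tilde{s}_0\tilde{s}_1\tilde{s}_0\tilde{\mathtt{s}}_1$; $\tilde{\mathtt{s}}_i\tilde{s}_j=\tilde{s}_j\tilde{\mathtt{s}}_i$ for $|i-j|>1$; (4) $\tilde{\mathtt{s}}_i\tilde{\mathtt{s}}_j=\tilde{\mathtt{s}}_j\tilde{\mathtt{s}}_i$ for $|i-j|>1$; (5) $\tilde{\mathtt{s}}_i\tilde{s}_i=\tilde{s}_i\tilde{\mathtt{s}}_i$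 for all $i$; (6) $\tilde{s}_i^2=e$ for all $i\geq 0$; (7) for indices greater than $0$: $\tilde{\mathtt{s}}_i^2=\tilde{\mathtt{s}}_i$; $\tilde{\mathtt{s}}_i\tilde{s}_i=\tilde{s}_i\tilde{\mathtt{s}}_i=\tilde{\mathtt{s}}_i$; $\tilde{\mathtt{s}}_i\tilde{\mathtt{s}}_{i\pm1}\tilde{s}_i=\tilde{\mathtt{s}}_i\tilde{s}_{i\pm1}$; $\tilde{s}_i\tilde{\mathtt{s}}_{i\pm1}\tilde{\mathtt{s}}_i=\tilde{s}_{i\pm1}\tilde{\mathtt{s}}_i$; (8) the additional relations $$\tilde{\mathtt{s}}_0^2=\tilde{\mathtt{s}}_0,\quad \tilde{\mathtt{s}}_1\tilde{\mathtt{s}}_0\tilde{\mathtt{s}}_1=\tilde{\mathtt{s}}_1,\quad \tilde{\mathtt{s}}_1\tilde{s}_0\tilde{\mathtt{s}}_1=\tilde{\mathtt{s}}_1,\quad \tilde{\mathtt{s}}_0\tilde{\mathtt{s}}_1\tilde{\mathtt{s}}_0=\tilde{\mathtt{s}}_0\tilde{s}_1\tilde{\mathtt{s}}_0,$$ $$\tilde{s}_1\tilde{\mathtt{s}}_0\tilde{s}_1\tilde{\mathtt{s}}_0=\tilde{\mathtt{s}}_0\tilde{s}_1\tilde{\mathtt{s}}_0\tilde{s}_1=\tilde{\mathtt{s}}_0\tilde{s}_1\tilde{\mathtt{s}}_0,\quad \tilde{\mathtt{s}}_1\tilde{\mathtt{s}}_0=\tilde{\mathtt{s}}_1\tilde{s}_1\tilde{\mathtt{s}}_0\tilde{s}_1,\quad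 \tilde{\mathtt{s}}_0\tilde{\mathtt{s}}_1=\tilde{s}_1\tilde{\mathtt{s}}_0\tilde{s}_1\tilde{\mathtt{s}}_1,\quad \tilde{\mathtt{s}}_0\tilde{s}_0=\tilde{s}_0\tilde{\mathtt{s}}_0=\tilde{\mathtt{s}}_0.$$
   Context: Write $\overline{x}=-x$ and $X=\{\overline n,\dots,\overline1,1,\dots,n\}$. A Brauer diagram on $X$ is a partition of $X\cup X'$ (where $X'=\{x':x\in X\}$ is a disjoint copy of $X$) into two-element subsets, drawn with $X$ in the top row and $X'$ in the bottom row. The product of two Brauer diagrams (in the Brauer monoid, i.e. with parameter $\delta=1$) is given by concatenation: identify the primed vertices of the first diagram with the corresponding unprimed vertices of the second; the connected components induce a partition of the remaining vertices into two-element subsets, and components supported only on the identified vertices are discarded. $\mathbf{Br}^B_n$, the type $B$ Brauer monoid, is the monoid of all Brauer diagrams on $X$ that are invariant under the swap $i\leftrightarrow\overline i$ (applied simultaneously to unprimed and primed vertices). The elements $\tilde s_i$ are the usual type $B$ generators of the group of signed permutations, viewed as Brauer diagrams: $\tilde s_0$ corresponds to the transposition $(1,\overline1)$, and $\tilde s_i$, $1\le i\le n-1$, to the simultaneous transposition of $i,i+1$ and of $\overline i,\overline{i+1}$. For $1\le i\le n-1$, $\tilde{\mathtt s}_i$ is the diagram with parts $\{i,i+1\}$, $\{i',(i+1)'\}$, $\{\overline i,\overline{i+1}\}$, $\{\overline i',\overline{i+1}'\}$ and $\{x,x'\}$ for all other $x\in X$; $\tilde{\mathtt s}_0$ is the diagram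 with parts $\{1,\overline1\}$, $\{1',\overline1'\}$ and $\{x,x'\}$ for all other $x\in X$. Relations involving indices outside $\{0,\dots,n-1\}$ are omitted. *)

theory Defs
  imports "HOL-Algebra.Group" "HOL-Library.Disjoint_Sets" "HOL-Combinatorics.Transposition"
begin

section \<open>Monoid presentations\<close>

inductive_set gen_congruence :: "'a set \<Rightarrow> ('a list \<times> 'a list) set \<Rightarrow> ('a list \<times> 'a list) set"
  for A R where
  base: "(u, v) \<in> R \<Longrightarrow> (u, v) \<in> gen_congruence A R"
| refl: "u \<in> lists A \<Longrightarrow> (u, u) \<in> gen_congruence A R"
| sym: "(u, v) \<in> gen_congruence A R \<Longrightarrow> (v, u) \<in> gen_congruence A R"
| trans: "(u, v) \<in> gen_congruence A R \<Longrightarrow> (v, w) \<in> gen_congruence A R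
    \<Longrightarrow> (u, w) \<in> gen_congruence A R"
| append: "(u, v) \<in> gen_congruence A R \<Longrightarrow> x \<in> lists A \<Longrightarrow> y \<in> lists A
    \<Longrightarrow> (x @ u @ y, x @ v @ y) \<in> gen_congruence A R"

definition presented_monoid :: "'a set \<Rightarrow> ('a list \<times> 'a list) set \<Rightarrow> 'a list set monoid" where
  "presented_monoid A R =
    \<lparr>carrier = lists A // gen_congruence A R,
     mult = (\<lambda>C D. \<Union>u\<in>C. \<Union>v\<in>D. gen_congruence A R `` {u @ v}),
     one = gen_congruence A R `` {[]}\<rparr>"

text \<open>The monoid \<open>M\<close> is presented by the generators \<open>f a\<close>, \<open>a \<in> A\<close>, subject to the
  relations \<open>R\<close>. The isomorphism is required to be the canonical one, which sends the class
  of the one-letter word \<open>a\<close> to \<open>f a\<close>.\<close>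

definition is_presentation ::
  "'a set \<Rightarrow> ('a list \<times> 'a list) set \<Rightarrow> ('m, 'r) monoid_scheme \<Rightarrow> ('a \<Rightarrow> 'm) \<Rightarrow> bool" where
  "is_presentation A R M f \<longleftrightarrow>
    monoid M \<and> R \<subseteq> lists A \<times> lists A \<and>
    (\<exists>h \<in> iso (presented_monoid A R) M. \<forall>a\<in>A. h (gen_congruence A R `` {[a]}) = f a)"

section \<open>Brauer diagrams\<close>

text \<open>In the disjoint union \<open>X <+> X\<close> the vertex \<open>x\<close> of the top row is \<open>Inl x\<close> and the
  primed vertex of the bottom row is \<open>Inr x\<close>.\<close>

type_synonym 'v diagram = "('v + 'v) set set"

definition brauer_diagrams :: "'v set \<Rightarrow> 'v diagram set" where
  "brauer_diagrams X = {d. partition_on (X <+> X) d \<and> (\<forall>B\<in>d. card B = 2)}"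

text \<open>Concatenation of \<open>d\<close> (above) and \<open>e\<close> (below): in \<open>'v + 'v + 'v\<close> the three
  summands are the top row, the identified middle row and the bottom row. Each connected
  component is restricted to the outer rows; components supported on the middle row restrict to
  the empty set and are discarded.\<close>

definition stacked_blocks :: "'v diagram \<Rightarrow> 'v diagram \<Rightarrow> ('v + 'v + 'v) set set" where
  "stacked_blocks d e = (\<lambda>B. map_sum id Inl ` B) ` d \<union> (\<lambda>B. Inr ` B) ` e"

definition stacked_components :: "'v diagram \<Rightarrow> 'v diagram \<Rightarrow> ('v + 'v + 'v) set set" where
  "stacked_components d e =
    \<Union> (stacked_blocks d e) // {(u, v). \<exists>B\<in>stacked_blocks d e. u \<in> B \<and> v \<in> B}\<^sup>+"

definition diagram_mult :: "'v diagram \<Rightarrow> 'v diagram \<Rightarrow> 'v diagram" where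
  "diagram_mult d e = {map_sum id Inr -` C | C. C \<in> stacked_components d e} - {{}}"

definition perm_diagram :: "'v set \<Rightarrow> ('v \<Rightarrow> 'v) \<Rightarrow> 'v diagram" where
  "perm_diagram X p = {{Inl x, Inr (p x)} | x. x \<in> X}"

definition brauer_monoid :: "'v set \<Rightarrow> 'v diagram monoid" where
  "brauer_monoid X =
    \<lparr>carrier = brauer_diagrams X, mult = diagram_mult, one = perm_diagram X id\<rparr>"

section \<open>The type B Brauer monoid\<close>

definition signed_points :: "nat \<Rightarrow> int set" where
  "signed_points n = {- int n..int n} - {0}"

definition swap_diagram :: "int diagram \<Rightarrow> int diagram" where
  "swap_diagram d = (\<lambda>B. map_sum uminus uminus ` B) ` d"

definition brauer_monoid_B :: "nat \<Rightarrow> int diagram monoid" where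
  "brauer_monoid_B n = (brauer_monoid (signed_points n))
    \<lparr>carrier := {d \<in> brauer_diagrams (signed_points n). swap_diagram d = d}\<rparr>"

definition s_perm :: "nat \<Rightarrow> int \<Rightarrow> int" where
  "s_perm i =
    (if i = 0 then transpose 1 (-1)
     else transpose (int i) (int i + 1) \<circ> transpose (- int i) (- (int i + 1)))"

definition s_diagram :: "nat \<Rightarrow> nat \<Rightarrow> int diagram" where
  "s_diagram n i = perm_diagram (signed_points n) (s_perm i)"

definition hook_parts :: "nat \<Rightarrow> int set set" where
  "hook_parts i =
    (if i = 0 then {{1, -1}} else {{int i, int i + 1}, {- int i, - (int i + 1)}})"

definition hook_diagram :: "nat \<Rightarrow> nat \<Rightarrow> int diagram" where
  "hook_diagram n i =
    (\<lambda>P. Inl ` P) ` hook_parts i \<union> (\<lambda>P. Inr ` P) ` hook_parts i \<union>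
    {{Inl x, Inr x} | x. x \<in> signed_points n - \<Union> (hook_parts i)}"

text \<open>The letters \<open>S i\<close> and \<open>H i\<close> (``hook'') stand for the group generator
  $\tilde s_i$ and the diagram $\tilde{\mathtt s}_i$, respectively.\<close>

datatype letter = S nat | H nat

definition letters :: "nat \<Rightarrow> letter set" where
  "letters n = S ` {..<n} \<union> H ` {..<n}"

fun letter_diagram :: "nat \<Rightarrow> letter \<Rightarrow> int diagram" where
  "letter_diagram n (S i) = s_diagram n i"
| "letter_diagram n (H i) = hook_diagram n i"

inductive_set brauer_relations_B :: "nat \<Rightarrow> (letter list \<times> letter list) set" for n where
  braid4: "1 < n \<Longrightarrow> ([S 0, S 1, S 0, S 1], [S 1, S 0, S 1, S 0]) \<in> brauer_relations_B n"
| braid3: "\<lbrakk>i < n; j < n; 1 \<le> i; 1 \<le> j; \<bar>int i - int j\<bar> = 1\<rbrakk>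
    \<Longrightarrow> ([S i, S j, S i], [S j, S i, S j]) \<in> brauer_relations_B n"
| SS_comm: "\<lbrakk>i < n; j < n; \<bar>int i - int j\<bar> > 1\<rbrakk>
    \<Longrightarrow> ([S i, S j], [S j, S i]) \<in> brauer_relations_B n"

| HSS: "\<lbrakk>i < n; j < n; 1 \<le> i; 1 \<le> j; \<bar>int i - int j\<bar> = 1\<rbrakk>
    \<Longrightarrow> ([H i, S j, S i], [S j, S i, H j]) \<in> brauer_relations_B n"

| H0_S1S0S1: "1 < n \<Longrightarrow> ([H 0, S 1, S 0, S 1], [S 1, S 0, S 1, H 0]) \<in> brauer_relations_B n"
| H1_S0S1S0: "1 < n \<Longrightarrow> ([H 1, S 0, S 1, S 0], [S 0, S 1, S 0, H 1]) \<in> brauer_relations_B n"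
| HS_comm: "\<lbrakk>i < n; j < n; \<bar>int i - int j\<bar> > 1\<rbrakk>
    \<Longrightarrow> ([H i, S j], [S j, H i]) \<in> brauer_relations_B n"

| HH_comm: "\<lbrakk>i < n; j < n; \<bar>int i - int j\<bar> > 1\<rbrakk>
    \<Longrightarrow> ([H i, H j], [H j, H i]) \<in> brauer_relations_B n"

| HS_same_comm: "i < n \<Longrightarrow> ([H i, S i], [S i, H i]) \<in> brauer_relations_B n"

| S_square: "i < n \<Longrightarrow> ([S i, S i], []) \<in> brauer_relations_B n"

| H_idem: "\<lbrakk>i < n; 1 \<le> i\<rbrakk> \<Longrightarrow> ([H i, H i], [H i]) \<in> brauer_relations_B n"
| HS_absorb: "\<lbrakk>i < n; 1 \<le> i\<rbrakk> \<Longrightarrow> ([H i, S i], [S i, H i]) \<in> brauer_relations_B n"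
| SH_absorb: "\<lbrakk>i < n; 1 \<le> i\<rbrakk> \<Longrightarrow> ([S i, H i], [H i]) \<in> brauer_relations_B n"
| HHS: "\<lbrakk>i < n; j < n; 1 \<le> i; 1 \<le> j; \<bar>int i - int j\<bar> = 1\<rbrakk>
    \<Longrightarrow> ([H i, H j, S i], [H i, S j]) \<in> brauer_relations_B n"
| SHH: "\<lbrakk>i < n; j < n; 1 \<le> i; 1 \<le> j; \<bar>int i - int j\<bar> = 1\<rbrakk>
    \<Longrightarrow> ([S i, H j, H i], [S j, H i]) \<in> brauer_relations_B n"

| H0_idem: "0 < n \<Longrightarrow> ([H 0, H 0], [H 0]) \<in> brauer_relations_B n"
| H1H0H1: "1 < n \<Longrightarrow> ([H 1, H 0, H 1], [H 1]) \<in> brauer_relations_B n"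
| H1S0H1: "1 < n \<Longrightarrow> ([H 1, S 0, H 1], [H 1]) \<in> brauer_relations_B n"
| H0H1H0: "1 < n \<Longrightarrow> ([H 0, H 1, H 0], [H 0, S 1, H 0]) \<in> brauer_relations_B n"
| S1H0S1H0: "1 < n \<Longrightarrow> ([S 1, H 0, S 1, H 0], [H 0, S 1, H 0, S 1]) \<in> brauer_relations_B n"
| H0S1H0S1: "1 < n \<Longrightarrow> ([H 0, S 1, H 0, S 1], [H 0, S 1, H 0]) \<in> brauer_relations_B n"
| H1H0: "1 < n \<Longrightarrow> ([H 1, H 0], [H 1, S 1, H 0, S 1]) \<in> brauer_relations_B n"
| H0H1: "1 < n \<Longrightarrow> ([H 0, H 1], [S 1, H 0, S 1, H 1]) \<in> brauer_relations_B n"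
| H0S0: "0 < n \<Longrightarrow> ([H 0, S 0], [S 0, H 0]) \<in> brauer_relations_B n"
| S0H0: "0 < n \<Longrightarrow> ([S 0, H 0], [H 0]) \<in> brauer_relations_B n"

end

theory Submission
  imports Defs
begin

text \<open>Folding a symmetric diagram along the swap of \<open>x\<close> and \<open>- x\<close> leaves a partial matching of the orbits
  of both rows whose edges carry a sign; an orbit without a partner is one whose two points
  are joined to each other. The proof follows this picture. For points \<open>x\<close> and \<open>y\<close> of different orbits,
  \<open>hook x y\<close> is the symmetric diagram that joins \<open>x\<close> to \<open>y\<close> and \<open>- x\<close> to \<open>- y\<close> in both rows, and
  \<open>hook x (- x)\<close> (a \<^emph>\<open>single\<close>) joins \<open>x\<close> to \<open>- x\<close> in both rows; all other strands are vertical.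

  That the relations hold for diagrams is checked in a larger monoid \<open>partn\<close>, whose elements are all
  equivalence relations on two copies of the points. There every product exists, associativity is a
  statement about reachability in a stack of rows, and multiplication of a matching by a hook or by a
  permutation has an explicit description (\<open>matching_rejoin_mult\<close>, \<open>matching_relabel_mult\<close>).
  The comparison with the concatenation of diagrams is \<open>diagram_mult_diagram_of\<close>.

  The substance is completeness: two words with the same diagram must be equal in \<^emph>\<open>every\<close> monoid in which
  the relations hold (locale \<open>brauer_B_relations\<close>). Such a monoid receives a homomorphism \<open>rep\<close> from
  the signed permutations, because the listed relations contain the Coxeter relations of type B, and
  these present the group (\<open>rep_word_perm\<close>, \<open>rep_mult\<close>). Hooks between arbitrary points are the
  conjugates of the generators \<open>H 0\<close> and \<open>H 1\<close> under this group. They are well defined because \<open>H 0\<close>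
  commutes with the stabiliser of the point 1 and \<open>H 1\<close> with that of 1 and 2 (\<open>eta0_centraliser\<close>,
  \<open>eta1_centraliser\<close>), and since any four orbits can be moved to 1, 2, 3, 4, each listed relation
  becomes a relation between hooks at arbitrary points. In particular hooks on disjoint orbits are
  commuting idempotents, so the product of the hooks along a pairing depends on the pairing alone.

  A diagram \<open>f\<close> now has the normal form \<open>E * rep g * P * F\<close>. Here \<open>E\<close> is the product of the hooks along the
  pairs of the top row, \<open>F\<close> that along the pairs of the bottom row, \<open>P\<close> is the product of the singles at
  all points of the pairs of the bottom row, and \<open>g\<close> is any signed permutation that extends the through
  strands of \<open>f\<close>. Different choices of \<open>g\<close> differ by a permutation of the points at which \<open>P\<close> has
  a single, and \<open>P\<close> absorbs it; hence the normal form is determined by \<open>f\<close> (\<open>normal_form_unique\<close>).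
  Multiplying it by a generator gives the normal form of the product diagram: a permutation moves
  through, and for a hook the cases are that both, one or none of its ends lie on through strands
  (\<open>normal_form_hook\<close>). By induction every word equals the normal form of its diagram, so words with equal
  diagrams are equal (\<open>equal_words\<close>).

  This is used for two monoids. The operators on classes of words that append a letter satisfy the
  relations and separate the classes (\<open>append_letter_faithful\<close>), which gives completeness. In \<open>partn\<close>,
  the normal form of a given symmetric matching is a product of generators whose blocks can be read off
  and are those of the matching (\<open>matching_is_word\<close>), which gives generation.\<close>

section \<open>Operators as a monoid\<close>

text \<open>A copy of the function type whose multiplication composes in the order of writing: in
  \<open>f * g\<close> the operator \<open>f\<close> acts first. With this convention the first
  letter of a word is the first to act.\<close>
typedef 'a endo = "UNIV :: ('a \<Rightarrow> 'a) set" morphisms apply_endo Endo by simp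

instantiation endo :: (type) monoid_mult
begin
definition "1 = Endo id"
definition "f * g = Endo (apply_endo g \<circ> apply_endo f)"
instance by standard (simp_all add: one_endo_def times_endo_def Endo_inverse apply_endo_inverse comp_assoc)
end

lemma apply_endo_one [simp]: "apply_endo 1 = id"
  by (simp add: one_endo_def Endo_inverse)

lemma apply_endo_mult [simp]: "apply_endo (f * g) = apply_endo g \<circ> apply_endo f"
  by (simp add: times_endo_def Endo_inverse)

lemma apply_endo_Endo [simp]: "apply_endo (Endo f) = f"
  by (simp add: Endo_inverse)

lemma Endo_eq_iff [simp]: "Endo f = Endo g \<longleftrightarrow> f = g"
  by (simp add: Endo_inject)

lemma Endo_mult: "Endo f * Endo g = Endo (g \<circ> f)"
  by (simp add: times_endo_def)

section \<open>Signed permutations\<close>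

text \<open>Signed permutations are functions on all integers that fix everything outside \<open>-
  n, ..., n\<close>. Thereby the groups for smaller \<open>n\<close> are contained in the larger
  ones, which the induction along this chain of groups uses.\<close>
definition signed_perm :: "nat \<Rightarrow> (int \<Rightarrow> int) \<Rightarrow> bool" where
  "signed_perm n p \<longleftrightarrow> bij p \<and> (\<forall>x. p (- x) = - p x) \<and> (\<forall>x. \<bar>x\<bar> > int n \<longrightarrow> p x = x)"

lemma signed_perm_uminus: "signed_perm n p \<Longrightarrow> p (- x) = - p x"
  by (simp add: signed_perm_def)

lemma signed_perm_outside: "signed_perm n p \<Longrightarrow> \<bar>x\<bar> > int n \<Longrightarrow> p x = x"
  by (simp add: signed_perm_def)

lemma signed_perm_bij: "signed_perm n p \<Longrightarrow> bij p"
  by (simp add: signed_perm_def)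

lemma signed_perm_inj: "signed_perm n p \<Longrightarrow> p x = p y \<longleftrightarrow> x = y"
  by (metis signed_perm_bij bij_def inj_eq)

lemma signed_perm_zero [simp]: "signed_perm n p \<Longrightarrow> p 0 = 0"
  using signed_perm_uminus[of n p 0] by simp

lemma signed_perm_eq_zero [simp]: "signed_perm n p \<Longrightarrow> p x = 0 \<longleftrightarrow> x = 0"
  using signed_perm_inj[of n p x 0] by simp

lemma signed_perm_abs_le [simp]: "signed_perm n p \<Longrightarrow> \<bar>p x\<bar> \<le> int n \<longleftrightarrow> \<bar>x\<bar> \<le> int n"
  by (metis linorder_not_less signed_perm_inj signed_perm_outside)

lemma signed_perm_id [simp]: "signed_perm n id" "signed_perm n (\<lambda>x. x)"
  by (simp_all add: signed_perm_def flip: id_def)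

lemma signed_perm_comp: "signed_perm n p \<Longrightarrow> signed_perm n q \<Longrightarrow> signed_perm n (q \<circ> p)"
  by (simp add: signed_perm_def bij_comp)

abbreviation inverse_fun :: "('a \<Rightarrow> 'b) \<Rightarrow> 'b \<Rightarrow> 'a" where
  "inverse_fun p \<equiv> inv_into UNIV p"

lemma signed_perm_inverse: assumes "signed_perm n p" shows "signed_perm n (inverse_fun p)"
  unfolding signed_perm_def
proof (intro conjI allI impI)
  have b: "bij p" using assms by (rule signed_perm_bij)
  then show "bij (inverse_fun p)" by (rule bij_imp_bij_inv)
  fix x
  have surj: "surj p" and inj: "inj p" using b by (auto simp: bij_def)
  show "inverse_fun p (- x) = - inverse_fun p x"
    by (metis assms b bij_inv_eq_iff signed_perm_uminus)
  assume "\<bar>x\<bar> > int n"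
  then show "inverse_fun p x = x" by (metis assms b bij_inv_eq_iff signed_perm_outside)
qed

lemma signed_perm_inverse_simps [simp]:
  assumes "signed_perm n p" shows "p (inverse_fun p x) = x" "inverse_fun p (p x) = x"
  using signed_perm_bij[OF assms] by (auto simp: bij_def surj_f_inv_f)

lemma signed_perm_Suc_fixing:
  assumes "signed_perm (Suc k) p" "p (int (Suc k)) = int (Suc k)"
  shows "signed_perm k p"
  unfolding signed_perm_def
proof (intro conjI allI impI)
  fix x assume "\<bar>x\<bar> > int k"
  then consider "\<bar>x\<bar> > int (Suc k)" | "x = int (Suc k)" | "x = - int (Suc k)" by linarith
  then show "p x = x"
    using assms signed_perm_uminus[OF assms(1), of "int (Suc k)"]
    by cases (simp_all add: signed_perm_outside)
qed (use assms in \<open>auto simp: signed_perm_def\<close>)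

lemma signed_perm_0: "signed_perm 0 p \<Longrightarrow> p = id"
  by (rule ext) (metis id_apply signed_perm_outside signed_perm_zero abs_of_nat int_ops(1) zero_less_abs_iff)

text \<open>The signed permutation that exchanges \<open>x\<close> with \<open>y\<close> and hence
  \<open>- x\<close> with \<open>- y\<close>. For \<open>y = - x\<close> the two exchanges are the
  same one and would cancel, therefore the case distinction.\<close>
definition signed_transp :: "int \<Rightarrow> int \<Rightarrow> int \<Rightarrow> int" where
  "signed_transp x y =
    (if y = - x then transpose x y else transpose x y \<circ> transpose (- x) (- y))"

lemma signed_transp_perm:
  assumes "\<bar>x\<bar> \<le> int n" "\<bar>y\<bar> \<le> int n" "x \<noteq> 0" "y \<noteq> 0"
  shows "signed_perm n (signed_transp x y)"
  using assms unfolding signed_perm_def signed_transp_def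
  by (auto simp: bij_comp transpose_def)

lemma s_perm_eq_signed_transp:
  "s_perm 0 = signed_transp 1 (- 1)" "0 < i \<Longrightarrow> s_perm i = signed_transp (int i) (int i + 1)"
  by (simp_all add: s_perm_def signed_transp_def)

lemma s_perm_signed: "i < n \<Longrightarrow> signed_perm n (s_perm i)"
  by (cases "i = 0") (auto simp: s_perm_eq_signed_transp intro!: signed_transp_perm)

lemma s_perm_apply: "s_perm i x =
  (if i = 0 then (if \<bar>x\<bar> = 1 then - x else x)
   else if x = int i then int i + 1 else if x = int i + 1 then int i
   else if x = - int i then - int i - 1 else if x = - int i - 1 then - int i else x)"
  by (auto simp: s_perm_def transpose_def)

abbreviation word_perm :: "nat list \<Rightarrow> int \<Rightarrow> int" where "word_perm w \<equiv> fold s_perm w"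

lemma word_perm_signed: "set w \<subseteq> {..<n} \<Longrightarrow> signed_perm n (word_perm w)"
  by (induction w) (auto simp: id_def[symmetric] intro!: signed_perm_comp s_perm_signed)

lemma apply_endo_word: "apply_endo (prod_list (map (\<lambda>i. Endo (s_perm i)) w)) = word_perm w"
  by (induction w) (simp_all add: id_def)

section \<open>Words in Coxeter generators of type B\<close>

text \<open>The generators may lie in any monoid. In \<open>tail_step\<close>, one and the same
  identity is needed both for abstract generators and for the permutations \<open>s_perm i\<close>,
  which form an instance.\<close>
locale coxeter_B =
  fixes n :: nat and \<sigma> :: "nat \<Rightarrow> 'm::monoid_mult"
  assumes square: "i < n \<Longrightarrow> \<sigma> i * \<sigma> i = 1"
    and braid4: "1 < n \<Longrightarrow> \<sigma> 0 * \<sigma> 1 * \<sigma> 0 * \<sigma> 1 = \<sigma> 1 * \<sigma> 0 * \<sigma> 1 * \<sigma> 0"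
    and braid3: "0 < i \<Longrightarrow> Suc i < n \<Longrightarrow> \<sigma> i * \<sigma> (Suc i) * \<sigma> i = \<sigma> (Suc i) * \<sigma> i * \<sigma> (Suc i)"
    and far_commute: "Suc i < j \<Longrightarrow> j < n \<Longrightarrow> \<sigma> i * \<sigma> j = \<sigma> j * \<sigma> i"
begin

abbreviation ev :: "nat list \<Rightarrow> 'm" where "ev w \<equiv> prod_list (map \<sigma> w)"

lemma square_left: "i < n \<Longrightarrow> \<sigma> i * (\<sigma> i * x) = x"
  by (metis square mult.assoc mult_1)

lemma far: "\<lbrakk>Suc i < j \<or> Suc j < i; i < n; j < n\<rbrakk> \<Longrightarrow> \<sigma> i * \<sigma> j = \<sigma> j * \<sigma> i"
  using far_commute[of i j] far_commute[of j i] by auto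

end

lemma upt_split: "i \<le> j \<Longrightarrow> j \<le> k \<Longrightarrow> [i..<k] = [i..<j] @ [j..<k]"
  by (metis le_add_diff_inverse upt_add_eq_append)

lemma prod_list_commute:
  fixes a :: "'m::monoid_mult"
  shows "\<forall>b\<in>set bs. b * a = a * b \<Longrightarrow> prod_list bs * a = a * prod_list bs"
  by (induction bs) (simp_all add: mult.assoc, metis mult.assoc)

text \<open>Coset representatives of the group on \<open>k\<close> points in the group on \<open>k +
  1\<close> points. The word carries the point \<open>k + 1\<close> to \<open>m\<close>: down to
  \<open>m\<close> if \<open>m\<close> is positive; otherwise down to 1, across to \<open>-
  1\<close> by the letter 0, and up again to \<open>- m\<close> in absolute value.\<close>
definition tail_word :: "nat \<Rightarrow> int \<Rightarrow> nat list" where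
  "tail_word k m =
    (if 0 < m then rev [nat m..<Suc k] else rev [0..<Suc k] @ [1..<nat (- m)])"

text \<open>A generator behind a tail either turns it into the tail of the moved target or, if it
  fixes the target \<open>m\<close>, passes through the tail and appears in front of it. Below the
  absolute value of \<open>m\<close> it keeps its index; above it the tail has shifted the points by
  one and the index drops.\<close>
definition tail_correction :: "nat \<Rightarrow> int \<Rightarrow> nat list" where
  "tail_correction j m = (if s_perm j m \<noteq> m then [] else [if int j < \<bar>m\<bar> then j else j - 1])"

context coxeter_B
begin

lemma down_commute_below:
  assumes "Suc j < i" "k < n"
  shows "ev (rev [i..<Suc k]) * \<sigma> j = \<sigma> j * ev (rev [i..<Suc k])"
  using assms by (intro prod_list_commute) (auto intro!: far)

text \<open>This is the braid relation applied at the place where \<open>j\<close> and \<open>j -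
  1\<close> follow one another in the descending run; the other letters of the run commute with the
  one that passes.\<close>
lemma down_slide:
  assumes "i < j" "2 \<le> j" "j \<le> k" "k < n"
  shows "ev (rev [i..<Suc k]) * \<sigma> j = \<sigma> (j - 1) * ev (rev [i..<Suc k])"
proof -
  obtain l where l: "j = Suc l" "0 < l" using assms by (cases j) auto
  have il: "i \<le> l" and "l \<le> k" "Suc l \<le> Suc k" using assms l by auto
  have "[i..<Suc k] = [i..<l] @ [l, Suc l] @ [Suc (Suc l)..<Suc k]"
    using il assms(3) unfolding l by (subst upt_split[of i l]) (simp_all add: upt_conv_Cons del: upt_Suc)
  then have split: "rev [i..<Suc k] = rev [Suc (Suc l)..<Suc k] @ [Suc l, l] @ rev [i..<l]"
    by simp
  let ?A = "ev (rev [Suc (Suc l)..<Suc k])" and ?B = "ev (rev [i..<l])"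
  have A: "?A * \<sigma> l = \<sigma> l * ?A"
    using assms(4) by (intro prod_list_commute) (auto intro!: far)
  have B: "?B * \<sigma> (Suc l) = \<sigma> (Suc l) * ?B"
    using assms l by (intro prod_list_commute) (auto intro!: far)
  have "ev (rev [i..<Suc k]) * \<sigma> j = ?A * (\<sigma> (Suc l) * \<sigma> l * \<sigma> (Suc l)) * ?B"
    unfolding split l using B by (simp add: mult.assoc)
  also have "\<dots> = ?A * \<sigma> l * (\<sigma> (Suc l) * \<sigma> l) * ?B"
    using braid3[of l] assms l by (simp add: mult.assoc)
  also have "\<dots> = \<sigma> l * ev (rev [i..<Suc k])"
    unfolding A split by (simp add: mult.assoc)
  finally show ?thesis using l by simp
qed

text \<open>The mirror image of \<open>down_slide\<close>: an ascending run shifts points the other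
  way, so the index rises.\<close>
lemma up_slide:
  assumes "0 < j" "Suc j < a" "a \<le> Suc k" "k < n"
  shows "ev [1..<a] * \<sigma> j = \<sigma> (Suc j) * ev [1..<a]"
proof -
  have split: "[1..<a] = [1..<j] @ [j, Suc j] @ [Suc (Suc j)..<a]"
    using assms by (subst upt_split[of 1 j]) (simp_all add: upt_conv_Cons del: upt_Suc)
  let ?A = "ev [1..<j]" and ?B = "ev [Suc (Suc j)..<a]"
  have A: "?A * \<sigma> (Suc j) = \<sigma> (Suc j) * ?A"
    using assms by (intro prod_list_commute) (auto intro!: far)
  have B: "?B * \<sigma> j = \<sigma> j * ?B"
    using assms by (intro prod_list_commute) (auto intro!: far)
  have "ev [1..<a] * \<sigma> j = ?A * (\<sigma> j * \<sigma> (Suc j) * \<sigma> j) * ?B"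
    unfolding split using B by (simp add: mult.assoc)
  also have "\<dots> = ?A * \<sigma> (Suc j) * (\<sigma> j * \<sigma> (Suc j)) * ?B"
    using braid3[of j] assms by (simp add: mult.assoc)
  also have "\<dots> = \<sigma> (Suc j) * ev [1..<a]"
    unfolding A split by (simp add: mult.assoc)
  finally show ?thesis .
qed

text \<open>The relation of length four is used here and nowhere else in the theory of the group:
  the run \<open>1 0 1\<close> around the sign change commutes with the letter 0.\<close>
lemma down_up_zero:
  assumes "2 \<le> a" "a \<le> Suc k" "k < n"
  shows "ev (rev [0..<Suc k] @ [1..<a]) * \<sigma> 0 = \<sigma> 0 * ev (rev [0..<Suc k] @ [1..<a])"
proof -
  have split: "[0..<Suc k] = [0, 1] @ [2..<Suc k]" "[1..<a] = [1] @ [2..<a]"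
    using assms by (simp_all add: upt_conv_Cons numeral_2_eq_2 del: upt_Suc)
  let ?A = "ev (rev [2..<Suc k])" and ?B = "ev [2..<a]"
  have A: "?A * \<sigma> 0 = \<sigma> 0 * ?A"
    using assms by (intro prod_list_commute) (auto intro!: far)
  have B: "?B * \<sigma> 0 = \<sigma> 0 * ?B"
    using assms by (intro prod_list_commute) (auto intro!: far)
  have "ev (rev [0..<Suc k] @ [1..<a]) * \<sigma> 0 = ?A * (\<sigma> 1 * \<sigma> 0 * \<sigma> 1 * \<sigma> 0) * ?B"
    unfolding split using B by (simp add: mult.assoc)
  also have "\<dots> = ?A * \<sigma> 0 * (\<sigma> 1 * \<sigma> 0 * \<sigma> 1) * ?B"
    using braid4 assms by (simp add: mult.assoc)
  also have "\<dots> = \<sigma> 0 * ev (rev [0..<Suc k] @ [1..<a])"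
    unfolding A split by (simp add: mult.assoc)
  finally show ?thesis .
qed

text \<open>One step of rewriting to normal form. Read for abstract generators, it is a consequence
  of the relations; read for permutations, it identifies the coset to which the product belongs.
  Both readings enter \<open>ev_perm_word_step\<close>.\<close>
lemma tail_step:
  assumes "k < n" "j \<le> k" "m \<noteq> 0" "\<bar>m\<bar> \<le> int (Suc k)"
  shows "ev (tail_word k m) * \<sigma> j = ev (tail_correction j m) * ev (tail_word k (s_perm j m))"
proof (cases "0 < m")
  case True
  then obtain a where a: "m = int a" "0 < a" "a \<le> Suc k"
    using assms by (metis abs_of_nat of_nat_le_iff zero_less_imp_eq_int)
  consider "j = a" | "Suc j = a" "0 < j" | "j = 0" "a = 1" | "Suc j < a" | "a < j" by linarith
  then show ?thesis
  proof cases
    case 1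
    then have "rev [a..<Suc k] = rev [Suc a..<Suc k] @ [a]"
      using assms by (simp add: upt_conv_Cons)
    then show ?thesis
      using 1 a assms by (simp add: tail_word_def tail_correction_def s_perm_apply square mult.assoc nat_add_distrib)
  next
    case 2
    then have "rev [j..<Suc k] = rev [a..<Suc k] @ [j]"
      using assms by (simp add: upt_conv_Cons)
    then show ?thesis
      using 2 a assms by (auto simp: tail_word_def tail_correction_def s_perm_apply)
  next
    case 3
    then have "rev [0..<Suc k] = rev [1..<Suc k] @ [0]"
      by (simp add: upt_conv_Cons del: upt_Suc)
    then show ?thesis
      using 3 a assms by (simp add: tail_word_def tail_correction_def s_perm_apply)
  next
    case 4
    then show ?thesis
      using a assms down_commute_below[of j a k]
      by (auto simp: tail_word_def tail_correction_def s_perm_apply)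
  next
    case 5
    then show ?thesis
      using a assms down_slide[of a j k]
      by (auto simp: tail_word_def tail_correction_def s_perm_apply)
  qed
next
  case False
  then obtain a where a: "m = - int a" "0 < a" "a \<le> Suc k"
    using assms by (metis abs_minus_cancel abs_of_nat linorder_neqE_linordered_idom neg_0_less_iff_less minus_minus of_nat_le_iff zero_less_imp_eq_int)
  consider "j = a" | "Suc j = a" "0 < j" | "j = 0" "a = 1" | "Suc j < a" "0 < j" | "j = 0" "2 \<le> a" | "a < j"
    by linarith
  then show ?thesis
  proof cases
    case 1
    then show ?thesis
      using a assms by (auto simp: tail_word_def tail_correction_def s_perm_apply nat_add_distrib mult.assoc)
  next
    case 2
    then have "[1..<a] = [1..<j] @ [j]" by auto
    then show ?thesis
      using 2 a assms
      by (auto simp: tail_word_def tail_correction_def s_perm_apply square mult.assoc)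
  next
    case 3
    then have "rev [0..<Suc k] = rev [1..<Suc k] @ [0]"
      by (simp add: upt_conv_Cons del: upt_Suc)
    then show ?thesis
      using 3 a assms by (simp add: tail_word_def tail_correction_def s_perm_apply square mult.assoc)
  next
    case 4
    then have "ev (rev [0..<Suc k] @ [1..<a]) * \<sigma> j = ev (rev [0..<Suc k]) * \<sigma> (Suc j) * ev [1..<a]"
      using a assms up_slide[of j a k] by (simp add: mult.assoc)
    also have "\<dots> = \<sigma> j * ev (rev [0..<Suc k] @ [1..<a])"
      using 4 a assms down_slide[of 0 "Suc j" k] by (simp add: mult.assoc)
    finally show ?thesis
      using 4 a assms by (auto simp: tail_word_def tail_correction_def s_perm_apply simp del: upt_Suc)
  next
    case 5
    then show ?thesis
      using a assms down_up_zero[of a k]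
      by (auto simp: tail_word_def tail_correction_def s_perm_apply simp del: upt_Suc)
  next
    case 6
    have "ev [1..<a] * \<sigma> j = \<sigma> j * ev [1..<a]"
      using 6 a assms by (intro prod_list_commute) (auto intro!: far)
    then have "ev (rev [0..<Suc k] @ [1..<a]) * \<sigma> j = ev (rev [0..<Suc k]) * \<sigma> j * ev [1..<a]"
      by (simp add: mult.assoc)
    also have "\<dots> = \<sigma> (j - 1) * ev (rev [0..<Suc k] @ [1..<a])"
      using 6 a assms down_slide[of 0 j k] by (simp add: mult.assoc)
    finally show ?thesis
      using 6 a assms by (auto simp: tail_word_def tail_correction_def s_perm_apply simp del: upt_Suc)
  qed
qed

end

section \<open>Normal form words of signed permutations\<close>

lemma s_perm_far: "\<bar>x\<bar> \<noteq> int i \<Longrightarrow> \<bar>x\<bar> \<noteq> int i + 1 \<Longrightarrow> s_perm i x = x"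
  by (auto simp: s_perm_apply)

lemma s_perm_simps [simp]:
  "0 < i \<Longrightarrow> s_perm i (int i) = int i + 1"
  "0 < i \<Longrightarrow> s_perm i (1 + int i) = int i"
  "0 < i \<Longrightarrow> s_perm i (- int i) = - int i - 1"
  "0 < i \<Longrightarrow> s_perm i (- int i - 1) = - int i"
  "s_perm 0 1 = - 1" "s_perm 0 (- 1) = 1"
  by (simp_all add: s_perm_apply)

lemma s_perm_involution: "s_perm i (s_perm i x) = x"
proof -
  consider "\<bar>x\<bar> \<noteq> int i" "\<bar>x\<bar> \<noteq> int i + 1" | "x = int i" | "x = - int i" | "x = int i + 1" | "x = - int i - 1"
    by linarith
  then show ?thesis by cases (cases "i = 0"; simp add: s_perm_apply)+
qed

lemma s_perm_commute: assumes "Suc i < j" shows "s_perm i (s_perm j x) = s_perm j (s_perm i x)"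
proof -
  consider "\<bar>x\<bar> \<noteq> int i \<and> \<bar>x\<bar> \<noteq> int i + 1" | "\<bar>x\<bar> \<noteq> int j \<and> \<bar>x\<bar> \<noteq> int j + 1"
    using assms by linarith
  then show ?thesis
  proof cases
    case 1
    then have "\<bar>s_perm j x\<bar> \<noteq> int i \<and> \<bar>s_perm j x\<bar> \<noteq> int i + 1"
      using assms by (auto simp: s_perm_apply)
    with 1 show ?thesis by (simp add: s_perm_far)
  next
    case 2
    then have "\<bar>s_perm i x\<bar> \<noteq> int j \<and> \<bar>s_perm i x\<bar> \<noteq> int j + 1"
      using assms by (auto simp: s_perm_apply)
    with 2 show ?thesis by (simp add: s_perm_far)
  qed
qed

lemma s_perm_braid3:
  assumes "0 < i"
  shows "s_perm i (s_perm (Suc i) (s_perm i x)) = s_perm (Suc i) (s_perm i (s_perm (Suc i) x))"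
proof -
  define a b c where "a = int i" and "b = int i + 1" and "c = int i + 2"
  have i: "s_perm i a = b" "s_perm i b = a" "s_perm i c = c"
    "s_perm i (- a) = - b" "s_perm i (- b) = - a" "s_perm i (- c) = - c"
    and Suc_i: "s_perm (Suc i) a = a" "s_perm (Suc i) b = c" "s_perm (Suc i) c = b"
    "s_perm (Suc i) (- a) = - a" "s_perm (Suc i) (- b) = - c" "s_perm (Suc i) (- c) = - b"
    using assms by (simp_all add: a_def b_def c_def s_perm_apply)
  consider "\<bar>x\<bar> \<noteq> int i" "\<bar>x\<bar> \<noteq> int i + 1" "\<bar>x\<bar> \<noteq> int i + 2"
    | "x = a" | "x = b" | "x = c" | "x = - a" | "x = - b" | "x = - c"
    unfolding a_def b_def c_def by linarith
  then show ?thesis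
  proof cases
    case 1
    then have "s_perm i x = x" "s_perm (Suc i) x = x" by (auto intro!: s_perm_far)
    then show ?thesis by simp
  qed (simp_all only: i Suc_i)
qed

lemma s_perm_braid4: "s_perm 1 (s_perm 0 (s_perm 1 (s_perm 0 x))) = s_perm 0 (s_perm 1 (s_perm 0 (s_perm 1 x)))"
proof -
  consider "\<bar>x\<bar> \<noteq> 1" "\<bar>x\<bar> \<noteq> 2" | "x = 1" | "x = - 1" | "x = 2" | "x = - 2"
    by linarith
  then show ?thesis by cases (auto simp: s_perm_apply)
qed

lemma coxeter_B_s_perm: "coxeter_B n (\<lambda>i. Endo (s_perm i))"
  by standard
    (simp_all add: Endo_mult one_endo_def fun_eq_iff s_perm_involution s_perm_commute[symmetric] s_perm_braid3 s_perm_braid4[simplified])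

text \<open>The tail that moves the largest point to its image is split off; what remains fixes the
  largest point and is treated recursively.\<close>
fun perm_word :: "nat \<Rightarrow> (int \<Rightarrow> int) \<Rightarrow> nat list" where
  "perm_word 0 p = []"
| "perm_word (Suc k) p =
    (let t = tail_word k (p (int (Suc k)))
     in perm_word k (inverse_fun (word_perm t) \<circ> p) @ t)"

lemma tail_word_letters: "\<bar>m\<bar> \<le> int (Suc k) \<Longrightarrow> set (tail_word k m) \<subseteq> {..<Suc k}"
  by (auto simp: tail_word_def)

lemma tail_correction_letters:
  "j \<le> k \<Longrightarrow> m \<noteq> 0 \<Longrightarrow> \<bar>m\<bar> \<le> int (Suc k) \<Longrightarrow> set (tail_correction j m) \<subseteq> {..<k}"
  by (auto simp: tail_correction_def s_perm_apply split: if_splits)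

lemma word_perm_down: "0 < a \<Longrightarrow> a \<le> Suc k \<Longrightarrow> word_perm (rev [a..<Suc k]) (int (Suc k)) = int a"
proof (induction k)
  case 0
  then show ?case by (simp add: le_Suc_eq)
next
  case (Suc k)
  show ?case
  proof (cases "a = Suc (Suc k)")
    case False
    with Suc have "rev [a..<Suc (Suc k)] = Suc k # rev [a..<Suc k]" by simp
    moreover have "s_perm (Suc k) (int (Suc (Suc k))) = int (Suc k)" by (simp add: s_perm_apply)
    ultimately show ?thesis using Suc False by simp
  qed simp
qed

lemma word_perm_up: "0 < a \<Longrightarrow> word_perm [1..<a] (- 1) = - int a"
proof (induction a)
  case (Suc a)
  show ?case
  proof (cases "a = 0")
    case False
    with Suc show ?thesis by simp
  qed simp
qed simp

lemma tail_word_perm: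
  assumes "m \<noteq> 0" "\<bar>m\<bar> \<le> int (Suc k)"
  shows "word_perm (tail_word k m) (int (Suc k)) = m"
proof (cases "0 < m")
  case True
  then show ?thesis using assms word_perm_down[of "nat m" k] by (simp add: tail_word_def)
next
  case False
  have "rev [0..<Suc k] = rev [1..<Suc k] @ [0]" by (simp add: upt_conv_Cons del: upt_Suc)
  then have "word_perm (rev [0..<Suc k]) (int (Suc k)) = - 1"
    using word_perm_down[of 1 k] by (simp del: upt_Suc)
  then show ?thesis using False assms word_perm_up[of "nat (- m)"] by (simp add: tail_word_def del: upt_Suc)
qed

lemma tail_word_top [simp]: "tail_word k (int (Suc k)) = []" "tail_word k (1 + int k) = []"
  by (simp_all add: tail_word_def nat_add_distrib)

lemma tail_quotient_perm:
  assumes "signed_perm (Suc k) p"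
  defines "t \<equiv> tail_word k (p (int (Suc k)))"
  shows "signed_perm k (inverse_fun (word_perm t) \<circ> p)"
    and "word_perm t \<circ> (inverse_fun (word_perm t) \<circ> p) = p"
proof -
  have m: "p (int (Suc k)) \<noteq> 0" "\<bar>p (int (Suc k))\<bar> \<le> int (Suc k)"
    using assms(1) signed_perm_abs_le[OF assms(1), of "int (Suc k)"] by simp_all
  have t: "signed_perm (Suc k) (word_perm t)"
    unfolding t_def by (rule word_perm_signed) (rule tail_word_letters[OF m(2)])
  have "word_perm t (int (Suc k)) = p (int (Suc k))"
    unfolding t_def by (rule tail_word_perm[OF m])
  then have "(inverse_fun (word_perm t) \<circ> p) (int (Suc k)) = int (Suc k)"
    using signed_perm_inverse_simps(2)[OF t, of "int (Suc k)"] by simp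
  then show "signed_perm k (inverse_fun (word_perm t) \<circ> p)"
    by (rule signed_perm_Suc_fixing[OF signed_perm_comp[OF assms(1) signed_perm_inverse[OF t]]])
  show "word_perm t \<circ> (inverse_fun (word_perm t) \<circ> p) = p"
    using t by (simp add: fun_eq_iff)
qed

lemma perm_word_letters: "signed_perm k p \<Longrightarrow> set (perm_word k p) \<subseteq> {..<k}"
proof (induction k arbitrary: p)
  case (Suc k)
  have "\<bar>p (int (Suc k))\<bar> \<le> int (Suc k)" using Suc.prems by (simp del: of_nat_Suc)
  then show ?case
    using Suc.IH[OF tail_quotient_perm(1)[OF Suc.prems]] tail_word_letters[of "p (int (Suc k))" k]
    by (auto simp: Let_def comp_def simp del: of_nat_Suc)
qed simp

lemma word_perm_perm_word: "signed_perm k p \<Longrightarrow> word_perm (perm_word k p) = p"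
proof (induction k arbitrary: p)
  case 0
  then show ?case using signed_perm_0 by (simp add: id_def)
next
  case (Suc k)
  show ?case
    using Suc.IH[OF tail_quotient_perm(1)[OF Suc.prems]] tail_quotient_perm(2)[OF Suc.prems]
    by (simp add: Let_def comp_def del: of_nat_Suc)
qed

lemma perm_word_Suc_fixing: "p (int (Suc k)) = int (Suc k) \<Longrightarrow> perm_word (Suc k) p = perm_word k p"
proof -
  have "inverse_fun (\<lambda>x::int. x) = (\<lambda>x. x)" using inv_id by (simp add: id_def)
  then show "p (int (Suc k)) = int (Suc k) \<Longrightarrow> perm_word (Suc k) p = perm_word k p"
    by (simp add: comp_def del: of_nat_Suc)
qed

lemma perm_word_id: "perm_word k id = []"
proof (induction k)
  case (Suc k)
  then show ?case by (simp only: perm_word_Suc_fixing id_apply)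
qed simp

context coxeter_B
begin

text \<open>The generator meets the last tail first. By \<open>tail_step\<close> it leaves at most
  one generator of the smaller group in front of the new tail, and the induction hypothesis absorbs
  it into the word of the remaining permutation.\<close>
lemma ev_perm_word_step:
  assumes "k \<le> n" "signed_perm k p" "j < k"
  shows "ev (perm_word k p) * \<sigma> j = ev (perm_word k (s_perm j \<circ> p))"
  using assms
proof (induction k arbitrary: p j)
  case (Suc k)
  let ?N = "int (Suc k)"
  define m where "m = p ?N"
  define m' where "m' = s_perm j m"
  define c where "c = tail_correction j m"
  define q where "q = inverse_fun (word_perm (tail_word k m)) \<circ> p"
  have m: "m \<noteq> 0" "\<bar>m\<bar> \<le> ?N"
    using Suc.prems by (simp_all add: m_def del: of_nat_Suc)
  have c: "set c \<subseteq> {..<k}"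
    unfolding c_def by (rule tail_correction_letters) (use Suc.prems m in auto)
  have q: "signed_perm k q" and pq: "word_perm (tail_word k m) \<circ> q = p"
    using tail_quotient_perm[OF Suc.prems(2)] by (simp_all add: q_def m_def)
  have sp: "signed_perm (Suc k) (s_perm j \<circ> p)"
    using Suc.prems by (intro signed_perm_comp s_perm_signed)
  have m': "(s_perm j \<circ> p) ?N = m'" by (simp add: m'_def m_def)
  have m'_le: "\<bar>m'\<bar> \<le> ?N"
    using signed_perm_abs_le[OF sp, of ?N] m' by simp
  have "ev (perm_word k q) * ev c = ev (perm_word k (word_perm c \<circ> q))"
    if "set c \<subseteq> {..<k}" for c
    using that q
  proof (induction c arbitrary: q)
    case (Cons i c)
    then have "ev (perm_word k q) * ev (i # c) = ev (perm_word k (s_perm i \<circ> q)) * ev c"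
      using Suc.IH[of q i] Suc.prems by (simp add: comp_def flip: mult.assoc)
    also have "\<dots> = ev (perm_word k (word_perm c \<circ> (s_perm i \<circ> q)))"
      using Cons.prems by (intro Cons.IH signed_perm_comp s_perm_signed) auto
    finally show ?case by (simp add: comp_def)
  qed (simp add: comp_def)
  note push = this[OF c]
  have "s_perm j \<circ> word_perm (tail_word k m) = word_perm (tail_word k m') \<circ> word_perm c"
    using arg_cong[OF coxeter_B.tail_step[OF coxeter_B_s_perm[of "Suc k"], of k j m], of apply_endo] Suc.prems m
    by (simp add: apply_endo_word c_def m'_def)
  then have "s_perm j \<circ> p = word_perm (tail_word k m') \<circ> (word_perm c \<circ> q)"
    using pq by (metis comp_assoc)
  moreover have t': "signed_perm (Suc k) (word_perm (tail_word k m'))"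
    by (rule word_perm_signed) (rule tail_word_letters[OF m'_le])
  ultimately have q': "inverse_fun (word_perm (tail_word k m')) \<circ> (s_perm j \<circ> p) = word_perm c \<circ> q"
    by (simp add: fun_eq_iff)
  have "ev (perm_word (Suc k) p) * \<sigma> j = ev (perm_word k q) * (ev (tail_word k m) * \<sigma> j)"
    by (simp add: Let_def q_def m_def mult.assoc del: of_nat_Suc)
  also have "ev (tail_word k m) * \<sigma> j = ev c * ev (tail_word k m')"
    using tail_step[of k j m] Suc.prems m by (simp add: c_def m'_def)
  also have "ev (perm_word k q) * \<dots> = ev (perm_word k (word_perm c \<circ> q)) * ev (tail_word k m')"
    by (simp only: push flip: mult.assoc)
  also have "\<dots> = ev (perm_word (Suc k) (s_perm j \<circ> p))"
    using q' m' by (simp add: Let_def del: of_nat_Suc)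
  finally show ?case .
qed simp

definition rep :: "(int \<Rightarrow> int) \<Rightarrow> 'm" where "rep p = ev (perm_word n p)"

lemma rep_id [simp]: "rep id = 1"
  by (simp add: rep_def perm_word_id)

lemma rep_times_ev:
  "signed_perm n p \<Longrightarrow> set w \<subseteq> {..<n} \<Longrightarrow> rep p * ev w = rep (word_perm w \<circ> p)"
proof (induction w arbitrary: p)
  case (Cons i w)
  then have "rep p * ev (i # w) = rep (s_perm i \<circ> p) * ev w"
    using ev_perm_word_step[of n p i] by (simp add: rep_def flip: mult.assoc)
  also have "\<dots> = rep (word_perm w \<circ> (s_perm i \<circ> p))"
    using Cons.prems by (intro Cons.IH signed_perm_comp s_perm_signed) auto
  finally show ?case by (simp add: comp_def)
qed (simp add: comp_def)

theorem rep_word_perm: "set w \<subseteq> {..<n} \<Longrightarrow> rep (word_perm w) = ev w"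
  using rep_times_ev[of id w] by simp

theorem rep_mult: "signed_perm n p \<Longrightarrow> signed_perm n q \<Longrightarrow> rep p * rep q = rep (q \<circ> p)"
  using rep_times_ev[of p "perm_word n q"] perm_word_letters[of n q] word_perm_perm_word[of n q]
  by (simp add: rep_def)

lemma rep_s_perm: "i < n \<Longrightarrow> rep (s_perm i) = \<sigma> i"
  using rep_word_perm[of "[i]"] by simp

end

section \<open>Moving points by signed permutations\<close>

lemma signed_points_iff: "x \<in> signed_points n \<longleftrightarrow> x \<noteq> 0 \<and> \<bar>x\<bar> \<le> int n"
  by (auto simp: signed_points_def)

lemma signed_perm_points [simp]: "signed_perm n p \<Longrightarrow> p x \<in> signed_points n \<longleftrightarrow> x \<in> signed_points n"
  by (simp add: signed_points_iff)

lemma uminus_points [simp]: "- x \<in> signed_points n \<longleftrightarrow> x \<in> signed_points n"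
  by (simp add: signed_points_iff)

lemma signed_transp_points:
  "x \<in> signed_points n \<Longrightarrow> y \<in> signed_points n \<Longrightarrow> signed_perm n (signed_transp x y)"
  by (simp add: signed_points_iff signed_transp_perm)

lemma signed_transp_apply:
  assumes "x \<noteq> 0" "y \<noteq> 0"
  shows "signed_transp x y x = y" "signed_transp x y y = x"
    "z \<noteq> x \<Longrightarrow> z \<noteq> - x \<Longrightarrow> z \<noteq> y \<Longrightarrow> z \<noteq> - y \<Longrightarrow> signed_transp x y z = z"
  using assms by (auto simp: signed_transp_def transpose_def)

lemma signed_transp_conj:
  assumes "signed_perm n g"
  shows "g \<circ> signed_transp x y = signed_transp (g x) (g y) \<circ> g"
  using assms
  by (auto simp: signed_transp_def transpose_def fun_eq_iff signed_perm_inj[OF assms]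
      simp flip: signed_perm_uminus[OF assms])

lemma signed_transp_outside:
  "\<bar>z\<bar> \<noteq> \<bar>x\<bar> \<Longrightarrow> \<bar>z\<bar> \<noteq> \<bar>y\<bar> \<Longrightarrow> signed_transp x y z = z"
  by (auto simp: signed_transp_def transpose_def)

lemma extend_to_signed_perm1:
  assumes "x \<in> signed_points n"
  obtains g where "signed_perm n g" "g 1 = x"
proof
  have "1 \<in> signed_points n" using assms by (auto simp: signed_points_iff)
  then show "signed_perm n (signed_transp 1 x)" by (intro signed_transp_points assms)
  show "signed_transp 1 x 1 = x" using assms by (simp add: signed_transp_apply signed_points_iff)
qed

text \<open>Composing \<open>g\<close> with the exchange of \<open>g a\<close> and \<open>z\<close>
  sends \<open>a\<close> to \<open>z\<close> and moves no image except those in the orbits of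
  \<open>g a\<close> and \<open>z\<close>. Repeating the step prescribes a signed permutation on
  several orbits, one after the other.\<close>
lemma extend_to_signed_perm_step:
  assumes g: "signed_perm n g" and a: "a \<in> signed_points n" and z: "z \<in> signed_points n"
  obtains g' where "signed_perm n g'" "g' a = z"
    "\<And>b. b \<noteq> 0 \<Longrightarrow> \<bar>b\<bar> \<noteq> \<bar>a\<bar> \<Longrightarrow> \<bar>g b\<bar> \<noteq> \<bar>z\<bar> \<Longrightarrow> g' b = g b"
proof
  let ?t = "signed_transp (g a) z"
  have ga: "g a \<in> signed_points n" using g a by simp
  show "signed_perm n (?t \<circ> g)" by (intro signed_perm_comp g signed_transp_points ga z)
  show "(?t \<circ> g) a = z" using ga z by (simp add: signed_transp_apply signed_points_iff)
  fix b assume b: "b \<noteq> 0" "\<bar>b\<bar> \<noteq> \<bar>a\<bar>" "\<bar>g b\<bar> \<noteq> \<bar>z\<bar>"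
  have "\<bar>g b\<bar> \<noteq> \<bar>g a\<bar>"
    using b(2) signed_perm_inj[OF g, of b a] signed_perm_inj[OF g, of b "- a"] signed_perm_uminus[OF g, of a]
    by (auto simp: abs_eq_iff)
  then show "(?t \<circ> g) b = g b" using b by (simp add: signed_transp_outside)
qed

lemma extend_to_signed_perm2:
  assumes "x \<in> signed_points n" "y \<in> signed_points n" "\<bar>x\<bar> \<noteq> \<bar>y\<bar>"
  obtains g where "signed_perm n g" "g 1 = x" "g 2 = y"
proof -
  obtain g where g: "signed_perm n g" "g 1 = x" using extend_to_signed_perm1[OF assms(1)] .
  have "2 \<in> signed_points n" using assms by (auto simp: signed_points_iff)
  then obtain g' where "signed_perm n g'" "g' 2 = y"
    "\<And>b. b \<noteq> 0 \<Longrightarrow> \<bar>b\<bar> \<noteq> \<bar>2\<bar> \<Longrightarrow> \<bar>g b\<bar> \<noteq> \<bar>y\<bar> \<Longrightarrow> g' b = g b"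
    using extend_to_signed_perm_step[OF g(1) _ assms(2)] by metis
  then show ?thesis using that g assms by simp
qed

lemma extend_to_signed_perm3:
  assumes "x \<in> signed_points n" "y \<in> signed_points n" "z \<in> signed_points n"
    and "\<bar>x\<bar> \<noteq> \<bar>y\<bar>" "\<bar>x\<bar> \<noteq> \<bar>z\<bar>" "\<bar>y\<bar> \<noteq> \<bar>z\<bar>"
  obtains g where "signed_perm n g" "g 1 = x" "g 2 = y" "g 3 = z"
proof -
  obtain g where g: "signed_perm n g" "g 1 = x" "g 2 = y"
    using extend_to_signed_perm2[OF assms(1,2,4)] .
  have "3 \<in> signed_points n" using assms by (auto simp: signed_points_iff)
  then obtain g' where "signed_perm n g'" "g' 3 = z"
    "\<And>b. b \<noteq> 0 \<Longrightarrow> \<bar>b\<bar> \<noteq> \<bar>3\<bar> \<Longrightarrow> \<bar>g b\<bar> \<noteq> \<bar>z\<bar> \<Longrightarrow> g' b = g b"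
    using extend_to_signed_perm_step[OF g(1) _ assms(3)] by metis
  then show ?thesis using that g assms by simp
qed

lemma extend_to_signed_perm4:
  assumes "x \<in> signed_points n" "y \<in> signed_points n" "z \<in> signed_points n" "w \<in> signed_points n"
    and "\<bar>x\<bar> \<noteq> \<bar>y\<bar>" "\<bar>x\<bar> \<noteq> \<bar>z\<bar>" "\<bar>y\<bar> \<noteq> \<bar>z\<bar>" "\<bar>x\<bar> \<noteq> \<bar>w\<bar>" "\<bar>y\<bar> \<noteq> \<bar>w\<bar>" "\<bar>z\<bar> \<noteq> \<bar>w\<bar>"
  obtains g where "signed_perm n g" "g 1 = x" "g 2 = y" "g 3 = z" "g 4 = w"
proof -
  obtain g where g: "signed_perm n g" "g 1 = x" "g 2 = y" "g 3 = z"
    using extend_to_signed_perm3[OF assms(1-3,5-7)] .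
  have "card {\<bar>x\<bar>, \<bar>y\<bar>, \<bar>z\<bar>, \<bar>w\<bar>} \<le> card {1..int n}"
    using assms(1-4) by (intro card_mono) (auto simp: signed_points_iff)
  then have "4 \<in> signed_points n" using assms(5-10) by (simp add: signed_points_iff)
  then obtain g' where "signed_perm n g'" "g' 4 = w"
    "\<And>b. b \<noteq> 0 \<Longrightarrow> \<bar>b\<bar> \<noteq> \<bar>4\<bar> \<Longrightarrow> \<bar>g b\<bar> \<noteq> \<bar>w\<bar> \<Longrightarrow> g' b = g b"
    using extend_to_signed_perm_step[OF g(1) _ assms(4)] by metis
  then show ?thesis using that g assms by simp
qed

section \<open>Monoids in which the relations hold\<close>

text \<open>Normal forms are developed in an arbitrary monoid with elements satisfying the
  relations, because they are needed twice: for operators on word classes, where they give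
  completeness, and for diagrams, where they give generation.\<close>
locale brauer_B_relations =
  fixes n :: nat and val :: "letter \<Rightarrow> 'm::monoid_mult"
  assumes relations: "(u, v) \<in> brauer_relations_B n \<Longrightarrow> prod_list (map val u) = prod_list (map val v)"
begin

abbreviation \<sigma> :: "nat \<Rightarrow> 'm" where "\<sigma> i \<equiv> val (S i)"
abbreviation \<eta> :: "nat \<Rightarrow> 'm" where "\<eta> i \<equiv> val (H i)"

end

sublocale brauer_B_relations \<subseteq> coxeter_B n \<sigma>
proof
  fix i j
  show "i < n \<Longrightarrow> \<sigma> i * \<sigma> i = 1"
    using relations[OF S_square] by simp
  show "1 < n \<Longrightarrow> \<sigma> 0 * \<sigma> 1 * \<sigma> 0 * \<sigma> 1 = \<sigma> 1 * \<sigma> 0 * \<sigma> 1 * \<sigma> 0"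
    using relations[OF braid4] by (simp add: mult.assoc)
  show "0 < i \<Longrightarrow> Suc i < n \<Longrightarrow> \<sigma> i * \<sigma> (Suc i) * \<sigma> i = \<sigma> (Suc i) * \<sigma> i * \<sigma> (Suc i)"
    using relations[OF braid3[of i n "Suc i"]] by (simp add: mult.assoc)
  show "Suc i < j \<Longrightarrow> j < n \<Longrightarrow> \<sigma> i * \<sigma> j = \<sigma> j * \<sigma> i"
    using relations[OF SS_comm[of i n j]] by simp
qed

context coxeter_B
begin

definition conj_by :: "(int \<Rightarrow> int) \<Rightarrow> 'm \<Rightarrow> 'm" where
  "conj_by g a = rep (inverse_fun g) * a * rep g"

lemma inverse_comp:
  assumes "signed_perm n g" shows "g \<circ> inverse_fun g = id" "inverse_fun g \<circ> g = id"
  using assms by (auto simp: fun_eq_iff)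

lemma rep_inverse:
  assumes "signed_perm n g"
  shows "rep g * rep (inverse_fun g) = 1" "rep (inverse_fun g) * rep g = 1"
  using assms by (simp_all add: rep_mult signed_perm_inverse inverse_comp)

lemma rep_inverse_left:
  assumes "signed_perm n g"
  shows "rep g * (rep (inverse_fun g) * a) = a" "rep (inverse_fun g) * (rep g * a) = a"
  using rep_inverse[OF assms] by (simp_all flip: mult.assoc)

lemma rep_cancel: "signed_perm n g \<Longrightarrow> a * rep g = b * rep g \<longleftrightarrow> a = b"
  by (metis mult.assoc mult_1_right rep_inverse(1))

lemma conj_by_id [simp]: "conj_by id a = a"
  using rep_inverse(1)[of id] by (simp add: conj_by_def)

lemma conj_by_mult: "signed_perm n g \<Longrightarrow> conj_by g (a * b) = conj_by g a * conj_by g b"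
  by (simp add: conj_by_def mult.assoc rep_inverse_left)

lemma conj_by_one [simp]: "signed_perm n g \<Longrightarrow> conj_by g 1 = 1"
  by (simp add: conj_by_def rep_inverse)

lemma conj_by_comp:
  assumes "signed_perm n p" "signed_perm n q"
  shows "conj_by q (conj_by p a) = conj_by (q \<circ> p) a"
proof -
  have "inverse_fun (q \<circ> p) = inverse_fun p \<circ> inverse_fun q"
    using assms by (intro o_inv_distrib signed_perm_bij)
  then show ?thesis
    using assms by (simp add: conj_by_def mult.assoc signed_perm_inverse flip: rep_mult)
qed

lemma conj_by_rep:
  assumes "signed_perm n g" "signed_perm n p" "signed_perm n q" "g \<circ> p = q \<circ> g"
  shows "conj_by g (rep p) = rep q"
proof -
  have "rep p * rep g = rep g * rep q" using assms by (simp add: rep_mult)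
  then show ?thesis using assms by (simp add: conj_by_def mult.assoc rep_inverse_left)
qed

lemma conj_by_transp:
  assumes "signed_perm n g" "x \<in> signed_points n" "y \<in> signed_points n"
  shows "conj_by g (rep (signed_transp x y)) = rep (signed_transp (g x) (g y))"
  using assms by (intro conj_by_rep signed_transp_points signed_transp_conj) auto

lemma conj_by_rule: "signed_perm n g \<Longrightarrow> a * rep g = rep g * conj_by g a"
  by (simp add: conj_by_def mult.assoc rep_inverse_left)

text \<open>If the pointwise stabiliser of \<open>A\<close> commutes with \<open>a\<close>, a
  conjugate of \<open>a\<close> depends only on where \<open>A\<close> is sent. This makes the
  choice in the definition of hooks harmless.\<close>
lemma conj_by_stabiliser:
  assumes "\<And>h. signed_perm n h \<Longrightarrow> \<forall>x\<in>A. h x = x \<Longrightarrow> a * rep h = rep h * a"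
    and g: "signed_perm n g" and g': "signed_perm n g'" and "\<forall>x\<in>A. g x = g' x"
  shows "conj_by g a = conj_by g' a"
proof -
  define h where "h = inverse_fun g' \<circ> g"
  have h: "signed_perm n h" unfolding h_def by (intro signed_perm_comp g signed_perm_inverse g')
  have "\<forall>x\<in>A. h x = x" using assms(4) g' by (simp add: h_def)
  then have "a * rep h = rep h * a" using h by (rule assms(1)[rotated])
  then have "conj_by h a = a" using h by (simp add: conj_by_def mult.assoc rep_inverse_left)
  moreover have "g = g' \<circ> h" using g' by (simp add: h_def fun_eq_iff)
  ultimately show ?thesis using conj_by_comp[OF h g', of a] by simp
qed

lemma rep_as_smaller_word:
  assumes "signed_perm m h" "m \<le> n"
  obtains w where "set w \<subseteq> {..<m}" "rep h = ev w"
proof -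
  have "perm_word k h = perm_word m h" if "m \<le> k" for k
    using that
  proof (induction k rule: dec_induct)
    case (step k)
    then have "h (int (Suc k)) = int (Suc k)" using assms(1) by (intro signed_perm_outside) auto
    then show ?case using step by (simp only: perm_word_Suc_fixing)
  qed simp
  from this[OF assms(2)] have "rep h = ev (perm_word m h)" by (simp only: rep_def)
  then show ?thesis using perm_word_letters[OF assms(1)] that by blast
qed

end

lemma word_perm_up': "0 < a \<Longrightarrow> word_perm [1..<a] 1 = int a"
proof (induction a)
  case (Suc a)
  then show ?case by (cases "a = 0") auto
qed simp

text \<open>A word that carries the points 1, 2 to \<open>m, m + 1\<close>, moving the pair up by
  one with each block of two letters. Relation (2) says exactly that such a block turns
  \<open>\<eta> i\<close> into \<open>\<eta> (i + 1)\<close>.\<close>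
definition double_up :: "nat \<Rightarrow> nat list" where
  "double_up m = concat (map (\<lambda>i. [Suc i, i]) [1..<m])"

lemma double_up_Suc: "0 < m \<Longrightarrow> double_up (Suc m) = double_up m @ [Suc m, m]"
  by (simp add: double_up_def)

lemma double_up_letters: "set (double_up m) \<subseteq> {..<Suc m}"
  by (auto simp: double_up_def)

lemma word_perm_double_up:
  "0 < m \<Longrightarrow> word_perm (double_up m) 1 = int m \<and> word_perm (double_up m) 2 = int (Suc m)"
proof (induction m)
  case (Suc m)
  show ?case
  proof (cases "m = 0")
    case False
    with Suc show ?thesis by (auto simp: double_up_Suc s_perm_apply)
  qed (simp add: double_up_def)
qed simp

context brauer_B_relations
begin

lemma eta_sigma_far: "\<lbrakk>Suc i < j \<or> Suc j < i; i < n; j < n\<rbrakk> \<Longrightarrow> \<eta> i * \<sigma> j = \<sigma> j * \<eta> i"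
  using relations[OF HS_comm[of i n j]] by auto

lemma eta_eta_far: "\<lbrakk>Suc i < j \<or> Suc j < i; i < n; j < n\<rbrakk> \<Longrightarrow> \<eta> i * \<eta> j = \<eta> j * \<eta> i"
  using relations[OF HH_comm[of i n j]] by auto

lemma eta_double: "\<lbrakk>0 < i; Suc i < n\<rbrakk> \<Longrightarrow> \<eta> i * (\<sigma> (Suc i) * \<sigma> i) = \<sigma> (Suc i) * \<sigma> i * \<eta> (Suc i)"
  using relations[OF HSS[of i n "Suc i"]] by (simp add: mult.assoc)

text \<open>The word \<open>1, ..., n - 1\<close> carries 1 to \<open>n\<close>. Conjugation with it
  turns the stabiliser of 1 into that of \<open>n\<close>, which is the group on \<open>n -
  1\<close> points and generated by the letters below \<open>n - 1\<close>. Moved back, these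
  generators are \<open>\<sigma> j\<close> for \<open>j \<ge> 2\<close> and \<open>\<sigma> 1 *
  \<sigma> 0 * \<sigma> 1\<close>, and the relations make each of them commute with \<open>\<eta>
  0\<close>.\<close>
lemma eta0_centraliser:
  assumes n: "0 < n" and h: "signed_perm n h" "h 1 = 1"
  shows "\<eta> 0 * rep h = rep h * \<eta> 0"
proof -
  let ?w = "[1..<n]"
  let ?C = "ev ?w" and ?c = "word_perm ?w"
  have c: "signed_perm n ?c" by (rule word_perm_signed) auto
  have repc: "rep ?c = ?C" by (rule rep_word_perm) auto
  \<comment> \<open>the conjugate of \<open>h\<close> that fixes the largest point\<close>
  define h' where "h' = ?c \<circ> h \<circ> inverse_fun ?c"
  have h'n: "signed_perm n h'"
    unfolding h'_def by (intro signed_perm_comp signed_perm_inverse c h)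
  have c1: "?c 1 = int n" using n by (rule word_perm_up')
  then have "inverse_fun ?c (int n) = 1" using signed_perm_inverse_simps(2)[OF c, of 1] by simp
  then have "h' (int n) = int n" using h c1 by (simp add: h'_def)
  then have "signed_perm (n - 1) h'" using h'n n signed_perm_Suc_fixing[of "n - 1" h'] by simp
  then obtain w where w: "set w \<subseteq> {..<n - 1}" "rep h' = ev w"
    by (rule rep_as_smaller_word) simp
  have push: "\<exists>d. ?C * \<sigma> j = d * ?C \<and> \<eta> 0 * d = d * \<eta> 0" if j: "j < n - 1" for j
  proof (cases "j = 0")
    case False
    then have "?C * \<sigma> j = \<sigma> (Suc j) * ?C" using up_slide[of j n "n - 1"] j by simp
    moreover have "\<eta> 0 * \<sigma> (Suc j) = \<sigma> (Suc j) * \<eta> 0" using j False by (intro eta_sigma_far) auto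
    ultimately show ?thesis by blast
  next
    case True
    with j have n2: "1 < n" by simp
    have split: "?w = 1 # [2..<n]" using n2 by (simp add: upt_conv_Cons numeral_2_eq_2)
    have far0: "ev [2..<n] * \<sigma> 0 = \<sigma> 0 * ev [2..<n]"
      by (intro prod_list_commute) (auto intro!: far)
    have "?C * \<sigma> 0 = \<sigma> 1 * \<sigma> 0 * ev [2..<n]"
      unfolding split using far0 by (simp add: mult.assoc)
    also have "ev [2..<n] = \<sigma> 1 * ?C"
      unfolding split using square_left[of 1] n2 by simp
    finally have "?C * \<sigma> 0 = (\<sigma> 1 * \<sigma> 0 * \<sigma> 1) * ?C" by (simp add: mult.assoc)
    moreover have "\<eta> 0 * (\<sigma> 1 * \<sigma> 0 * \<sigma> 1) = (\<sigma> 1 * \<sigma> 0 * \<sigma> 1) * \<eta> 0"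
      using relations[OF H0_S1S0S1] n2 by (simp add: mult.assoc)
    ultimately show ?thesis using True by blast
  qed
  from w(1) have "\<exists>d. ?C * ev w = d * ?C \<and> \<eta> 0 * d = d * \<eta> 0"
  proof (induction w)
    case Nil
    then show ?case by (intro exI[of _ 1]) simp
  next
    case (Cons j w)
    then obtain e where e: "?C * ev w = e * ?C" "\<eta> 0 * e = e * \<eta> 0" by auto
    obtain d where d: "?C * \<sigma> j = d * ?C" "\<eta> 0 * d = d * \<eta> 0"
      using push[of j] Cons.prems by auto
    have "?C * ev (j # w) = (?C * \<sigma> j) * ev w" by (simp add: mult.assoc)
    also have "\<dots> = d * (?C * ev w)" by (simp only: d mult.assoc)
    also have "\<dots> = d * e * ?C" by (simp only: e mult.assoc)
    finally have "?C * ev (j # w) = d * e * ?C" .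
    moreover have "\<eta> 0 * (d * e) = d * e * \<eta> 0"
      using d(2) e(2) by (metis mult.assoc)
    ultimately show ?case by blast
  qed
  then obtain d where d: "?C * ev w = d * ?C" "\<eta> 0 * d = d * \<eta> 0" by blast
  have "?c \<circ> h = h' \<circ> ?c" using c by (simp add: h'_def fun_eq_iff)
  then have "rep h * rep ?c = rep ?c * rep h'" using c h h'n by (simp add: rep_mult)
  then have "rep h * rep ?c = d * rep ?c" using d w repc by simp
  then have "rep h = d" using c by (simp add: rep_cancel)
  then show ?thesis using d by simp
qed

lemma eta1_double_up:
  "0 < m \<Longrightarrow> m < n \<Longrightarrow> \<eta> 1 * ev (double_up m) = ev (double_up m) * \<eta> m"
proof (induction m)
  case (Suc m)
  show ?case
  proof (cases "m = 0")
    case False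
    then have "\<eta> 1 * ev (double_up (Suc m)) = ev (double_up m) * (\<eta> m * (\<sigma> (Suc m) * \<sigma> m))"
      using Suc by (simp add: double_up_Suc flip: mult.assoc)
    also have "\<dots> = ev (double_up (Suc m)) * \<eta> (Suc m)"
      using False Suc.prems by (simp add: eta_double double_up_Suc mult.assoc)
    finally show ?thesis .
  qed (simp add: double_up_def)
qed simp

text \<open>Here \<open>double_up\<close> carries 1, 2 to \<open>n - 1, n\<close>, and the
  stabiliser becomes the group on \<open>n - 2\<close> points. Its generators commute with the last
  hook \<open>\<eta> (n - 1)\<close> because the indices are far apart.\<close>
lemma eta1_centraliser:
  assumes n: "1 < n" and h: "signed_perm n h" "h 1 = 1" "h 2 = 2"
  shows "\<eta> 1 * rep h = rep h * \<eta> 1"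
proof -
  obtain m where m: "n = Suc m" "0 < m" using n by (cases n) auto
  let ?w = "double_up m"
  let ?C = "ev ?w" and ?c = "word_perm ?w"
  have c: "signed_perm n ?c" unfolding m(1) by (rule word_perm_signed) (rule double_up_letters)
  have repc: "rep ?c = ?C" by (rule rep_word_perm) (use double_up_letters m in simp)
  define h' where "h' = ?c \<circ> h \<circ> inverse_fun ?c"
  have h'n: "signed_perm n h'"
    unfolding h'_def by (intro signed_perm_comp signed_perm_inverse c h)
  have c1: "?c 1 = int m" "?c 2 = int n" using word_perm_double_up[OF m(2)] m(1) by auto
  then have "inverse_fun ?c (int m) = 1" "inverse_fun ?c (int n) = 2"
    using signed_perm_inverse_simps(2)[OF c, of 1] signed_perm_inverse_simps(2)[OF c, of 2] by simp_all
  then have h'_fix: "h' (int n) = int n" "h' (int m) = int m" using h c1 by (simp_all add: h'_def)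
  have "signed_perm m h'" using h'n h'_fix m signed_perm_Suc_fixing[of m h'] by simp
  then have "signed_perm (m - 1) h'" using h'_fix m signed_perm_Suc_fixing[of "m - 1" h'] by simp
  then obtain w where w: "set w \<subseteq> {..<m - 1}" "rep h' = ev w"
    by (rule rep_as_smaller_word) (use m in simp)
  have "ev w * \<eta> m = \<eta> m * ev w"
    using w m by (intro prod_list_commute) (auto intro!: eta_sigma_far[symmetric])
  have "?c \<circ> h = h' \<circ> ?c" using c by (simp add: h'_def fun_eq_iff)
  then have comm: "rep h * ?C = ?C * ev w" using c h h'n w repc by (simp add: rep_mult flip: repc w(2))
  have e: "\<eta> 1 * ?C = ?C * \<eta> m" using m by (intro eta1_double_up) auto
  have "\<eta> 1 * rep h * ?C = \<eta> 1 * ?C * ev w" by (simp add: mult.assoc comm)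
  also have "\<dots> = ?C * ev w * \<eta> m" by (simp only: e mult.assoc \<open>ev w * \<eta> m = \<eta> m * ev w\<close>)
  also have "\<dots> = rep h * ?C * \<eta> m" by (simp only: comm)
  also have "\<dots> = rep h * \<eta> 1 * ?C" by (simp only: e mult.assoc)
  finally show ?thesis using c rep_cancel[OF c] repc by simp
qed

end

section \<open>Hooks between arbitrary points\<close>

context brauer_B_relations
begin

text \<open>The choice is free: permutations with the same values at 1 (and at 2) differ by an
  element of the centraliser of \<open>\<eta> 0\<close> (of \<open>\<eta> 1\<close>). The condition
  on \<open>g 2\<close> is dropped for \<open>y = - x\<close>, where it could not be met.\<close>
definition hook :: "int \<Rightarrow> int \<Rightarrow> 'm" where
  "hook x y =
    conj_by (SOME g. signed_perm n g \<and> g 1 = x \<and> (y \<noteq> - x \<longrightarrow> g 2 = y)) (if y = - x then \<eta> 0 else \<eta> 1)"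

lemma hook_single:
  assumes "0 < n" "signed_perm n g" shows "hook (g 1) (- g 1) = conj_by g (\<eta> 0)"
proof -
  let ?h = "SOME h. signed_perm n h \<and> h 1 = g 1"
  have h: "signed_perm n ?h \<and> ?h 1 = g 1" by (rule someI[of _ g]) (use assms in simp)
  have "conj_by ?h (\<eta> 0) = conj_by g (\<eta> 0)"
    using h assms(2) by (intro conj_by_stabiliser[where A = "{1}"]) (simp_all add: eta0_centraliser[OF assms(1)])
  then show ?thesis by (simp add: hook_def)
qed

lemma hook_pair:
  assumes "1 < n" "signed_perm n g" shows "hook (g 1) (g 2) = conj_by g (\<eta> 1)"
proof -
  let ?h = "SOME h. signed_perm n h \<and> h 1 = g 1 \<and> h 2 = g 2"
  have h: "signed_perm n ?h \<and> ?h 1 = g 1 \<and> ?h 2 = g 2" by (rule someI[of _ g]) (use assms in simp)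
  have "conj_by ?h (\<eta> 1) = conj_by g (\<eta> 1)"
    using h assms(2)
    by (intro conj_by_stabiliser[where A = "{1, 2}"])
      (simp_all add: eta1_centraliser[OF assms(1), unfolded One_nat_def])
  moreover have "g 2 \<noteq> - g 1"
    using signed_perm_inj[OF assms(2), of 2 "- 1"] signed_perm_uminus[OF assms(2), of 1] by simp
  ultimately show ?thesis by (simp add: hook_def)
qed

lemma hook_one:
  "0 < n \<Longrightarrow> hook 1 (- 1) = \<eta> 0" "1 < n \<Longrightarrow> hook 1 2 = \<eta> 1"
  using hook_single[of id] hook_pair[of id] by simp_all

lemma hook_conj:
  assumes x: "x \<in> signed_points n" and y: "y \<in> signed_points n" and "x \<noteq> y" and g: "signed_perm n g"
  shows "conj_by g (hook x y) = hook (g x) (g y)"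
proof (cases "y = - x")
  case True
  have n: "0 < n" using x by (auto simp: signed_points_iff)
  obtain h where h: "signed_perm n h" "h 1 = x" using extend_to_signed_perm1[OF x] .
  have "conj_by g (hook x y) = conj_by (g \<circ> h) (\<eta> 0)"
    using hook_single[OF n h(1)] h True conj_by_comp[OF h(1) g] by simp
  also have "\<dots> = hook (g x) (- g x)"
    using hook_single[OF n signed_perm_comp[OF h(1) g]] h by simp
  finally show ?thesis using True signed_perm_uminus[OF g] by simp
next
  case False
  then have xy: "\<bar>x\<bar> \<noteq> \<bar>y\<bar>" using assms by (auto simp: abs_eq_iff)
  then have n: "1 < n" using x y by (auto simp: signed_points_iff)
  obtain h where h: "signed_perm n h" "h 1 = x" "h 2 = y" using extend_to_signed_perm2[OF x y xy] .
  have "conj_by g (hook x y) = conj_by (g \<circ> h) (\<eta> 1)"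
    using hook_pair[OF n h(1)] h conj_by_comp[OF h(1) g] by simp
  also have "\<dots> = hook (g x) (g y)"
    using hook_pair[OF n signed_perm_comp[OF h(1) g]] h by simp
  finally show ?thesis .
qed

lemma hook_move:
  assumes "x \<in> signed_points n" "y \<in> signed_points n" "x \<noteq> y" "signed_perm n g"
  shows "hook x y * rep g = rep g * hook (g x) (g y)"
  using conj_by_rule[OF assms(4), of "hook x y"] hook_conj[OF assms] by simp

lemma conj_s_perm:
  assumes "i < n" shows "conj_by (s_perm i) a = \<sigma> i * a * \<sigma> i"
proof -
  have "inverse_fun (s_perm i) = s_perm i"
    by (rule inv_unique_comp) (simp_all add: fun_eq_iff s_perm_involution)
  then show ?thesis using assms by (simp add: conj_by_def rep_s_perm)
qed

lemma hook_eta: "0 < i \<Longrightarrow> i < n \<Longrightarrow> hook (int i) (int i + 1) = \<eta> i"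
proof (induction i)
  case (Suc i)
  show ?case
  proof (cases "i = 0")
    case False
    let ?g = "s_perm i \<circ> s_perm (Suc i)"
    have g: "signed_perm n ?g" using Suc.prems by (intro signed_perm_comp s_perm_signed) auto
    have g_i: "?g (int i) = int (Suc i)" "?g (int i + 1) = int (Suc i) + 1"
      using False by (simp_all add: s_perm_apply)
    have "\<eta> i * rep ?g = rep ?g * \<eta> (Suc i)"
      using eta_double[of i] False Suc.prems
      by (simp add: rep_s_perm s_perm_signed flip: rep_mult)
    then have "conj_by ?g (\<eta> i) = \<eta> (Suc i)"
      using g by (simp add: conj_by_def mult.assoc rep_inverse_left)
    moreover have "hook (int i) (int i + 1) = \<eta> i" using Suc False by simp
    moreover have "conj_by ?g (hook (int i) (int i + 1)) = hook (?g (int i)) (?g (int i + 1))"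
      using False Suc.prems by (intro hook_conj g) (auto simp: signed_points_iff)
    ultimately show ?thesis unfolding g_i by simp
  qed (use Suc hook_one in simp)
qed simp

lemma rep_transp_small:
  "0 < n \<Longrightarrow> rep (signed_transp 1 (- 1)) = \<sigma> 0"
  "1 < n \<Longrightarrow> rep (signed_transp 1 2) = \<sigma> 1"
  using rep_s_perm[of 0] rep_s_perm[of 1] s_perm_eq_signed_transp(1) s_perm_eq_signed_transp(2)[of 1]
  by (simp_all)

lemma rep_transp_13:
  assumes "2 < n" shows "rep (signed_transp 1 3) = \<sigma> 1 * \<sigma> 2 * \<sigma> 1"
proof -
  have "signed_transp 1 3 = word_perm [1, 2, 1]"
    unfolding fun_eq_iff
  proof
    fix x :: int
    consider "x = 1" | "x = - 1" | "x = 2" | "x = - 2" | "x = 3" | "x = - 3" | "\<bar>x\<bar> \<noteq> 1" "\<bar>x\<bar> \<noteq> 2" "\<bar>x\<bar> \<noteq> 3"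
      by linarith
    then show "signed_transp 1 3 x = word_perm [1, 2, 1] x"
      by cases (simp_all add: s_perm_apply signed_transp_def transpose_def s_perm_far signed_transp_outside)
  qed
  then show ?thesis using rep_word_perm[of "[1, 2, 1]"] assms by (simp add: mult.assoc)
qed

end

section \<open>Relations between hooks on few orbits\<close>

context brauer_B_relations
begin

lemma conj_by_commuting: "signed_perm n g \<Longrightarrow> a * rep g = rep g * a \<Longrightarrow> conj_by g a = a"
  by (simp add: conj_by_def mult.assoc rep_inverse_left)

text \<open>All elements on two orbits are conjugate, by one common permutation, to elements on the
  orbits of 1 and 2. An identity between them follows by conjugation from its instance there, which
  is one of the listed relations or a short consequence.\<close>
lemma two_orbits_standard:
  assumes "x \<in> signed_points n" "y \<in> signed_points n" "\<bar>x\<bar> \<noteq> \<bar>y\<bar>"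
  obtains g where "signed_perm n g" "1 < n" "g 1 = x" "g 2 = y"
    "hook x y = conj_by g (\<eta> 1)" "hook x (- x) = conj_by g (\<eta> 0)"
    "hook y (- y) = conj_by g (\<sigma> 1 * \<eta> 0 * \<sigma> 1)"
    "rep (signed_transp x y) = conj_by g (\<sigma> 1)" "rep (signed_transp x (- x)) = conj_by g (\<sigma> 0)"
proof -
  have n: "1 < n" using assms by (auto simp: signed_points_iff)
  then have n0: "0 < n" by simp
  obtain g where g: "signed_perm n g" "g 1 = x" "g 2 = y" using extend_to_signed_perm2[OF assms] .
  note minus = signed_perm_uminus[OF g(1)]
  have p12: "1 \<in> signed_points n" "2 \<in> signed_points n" using n by (auto simp: signed_points_iff)
  have "conj_by (s_perm 1) (hook 1 (- 1)) = hook (s_perm 1 1) (s_perm 1 (- 1))"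
    using n p12 by (intro hook_conj s_perm_signed) auto
  then have "hook 2 (- 2) = \<sigma> 1 * \<eta> 0 * \<sigma> 1"
    using n by (simp add: conj_s_perm hook_one s_perm_apply)
  moreover have "conj_by g (hook 2 (- 2)) = hook y (- y)"
    using hook_conj[of 2 "- 2", OF _ _ _ g(1)] p12 minus g by simp
  ultimately have "hook y (- y) = conj_by g (\<sigma> 1 * \<eta> 0 * \<sigma> 1)" by simp
  moreover have "rep (signed_transp x y) = conj_by g (\<sigma> 1)" "rep (signed_transp x (- x)) = conj_by g (\<sigma> 0)"
    using conj_by_transp[OF g(1), of 1 2] conj_by_transp[OF g(1), of 1 "- 1"] n p12 rep_transp_small g minus
    by simp_all
  ultimately show ?thesis
    using that hook_pair[OF n g(1)] hook_single[OF n0 g(1)] g n by simp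
qed

lemma eta1_absorb: "1 < n \<Longrightarrow> \<sigma> 1 * \<eta> 1 = \<eta> 1" "1 < n \<Longrightarrow> \<eta> 1 * \<sigma> 1 = \<eta> 1"
  using relations[OF HS_absorb[of 1]] relations[OF SH_absorb[of 1]] by simp_all

lemma eta0_absorb: "0 < n \<Longrightarrow> \<sigma> 0 * \<eta> 0 = \<eta> 0" "0 < n \<Longrightarrow> \<eta> 0 * \<sigma> 0 = \<eta> 0"
  using relations[OF H0S0] relations[OF S0H0] by simp_all

lemma hook_sym:
  assumes "x \<in> signed_points n" "y \<in> signed_points n" "x \<noteq> y"
  shows "hook y x = hook x y"
proof (cases "y = - x")
  case True
  have n: "0 < n" using assms by (auto simp: signed_points_iff)
  obtain g where g: "signed_perm n g" "g 1 = x" using extend_to_signed_perm1[OF assms(1)] .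
  have p1: "1 \<in> signed_points n" using n by (simp add: signed_points_iff)
  have "hook (- 1) 1 = conj_by (s_perm 0) (hook 1 (- 1))"
    using hook_conj[of 1 "- 1" "s_perm 0"] n p1 by (simp add: s_perm_signed)
  also have "\<dots> = \<eta> 0"
    using n by (simp add: conj_s_perm hook_one eta0_absorb)
  finally show ?thesis
    using hook_conj[of "- 1" 1, OF _ _ _ g(1)] hook_single[OF n g(1)] p1 g True signed_perm_uminus[OF g(1)] by simp
next
  case False
  then have xy: "\<bar>x\<bar> \<noteq> \<bar>y\<bar>" using assms by (auto simp: abs_eq_iff)
  obtain g where g: "signed_perm n g" "1 < n" "g 1 = x" "g 2 = y" "hook x y = conj_by g (\<eta> 1)"
    using two_orbits_standard[OF assms(1,2) xy] by metis
  have p12: "1 \<in> signed_points n" "2 \<in> signed_points n" using g(2) by (auto simp: signed_points_iff)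
  have "hook 2 1 = conj_by (s_perm 1) (hook 1 2)"
    using hook_conj[of 1 2 "s_perm 1"] g(2) p12 by (simp add: s_perm_apply s_perm_signed)
  also have "\<dots> = \<eta> 1"
    using g(2) eta1_absorb by (simp add: conj_s_perm hook_one mult.assoc)
  finally show ?thesis using hook_conj[of 2 1, OF _ _ _ g(1)] p12 g by simp
qed

lemma hook_uminus:
  assumes "x \<in> signed_points n" "y \<in> signed_points n" "x \<noteq> y"
  shows "hook (- x) (- y) = hook x y"
proof (cases "y = - x")
  case True
  then show ?thesis using hook_sym[OF assms] by simp
next
  case False
  then have xy: "\<bar>x\<bar> \<noteq> \<bar>y\<bar>" using assms by (auto simp: abs_eq_iff)
  obtain g where g: "signed_perm n g" "1 < n" "g 1 = x" "g 2 = y" "hook x y = conj_by g (\<eta> 1)"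
    using two_orbits_standard[OF assms(1,2) xy] by metis
  have p12: "1 \<in> signed_points n" "2 \<in> signed_points n" using g(2) by (auto simp: signed_points_iff)
  let ?k = "word_perm [1, 0, 1, 0]"
  have k: "signed_perm n ?k" using g(2) by (intro word_perm_signed) auto
  let ?t = "\<sigma> 0 * \<sigma> 1 * \<sigma> 0"
  have rk: "rep ?k = \<sigma> 1 * ?t"
    using rep_word_perm[of "[1, 0, 1, 0]"] g(2) by (simp add: mult.assoc)
  have t: "\<eta> 1 * ?t = ?t * \<eta> 1"
    using relations[OF H1_S0S1S0] g(2) by (simp add: mult.assoc)
  have "\<eta> 1 * rep ?k = \<eta> 1 * \<sigma> 1 * ?t" by (simp only: rk mult.assoc)
  also have "\<dots> = \<sigma> 1 * (\<eta> 1 * ?t)" by (simp only: eta1_absorb[OF g(2)] flip: mult.assoc)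
  also have "\<dots> = rep ?k * \<eta> 1" by (subst t) (simp only: rk mult.assoc)
  finally have "\<eta> 1 * rep ?k = rep ?k * \<eta> 1" .
  then have "conj_by ?k (\<eta> 1) = \<eta> 1" by (rule conj_by_commuting[OF k])
  moreover have "?k 1 = - 1" "?k 2 = - 2" by (simp_all add: s_perm_apply)
  ultimately have "hook (- 1) (- 2) = \<eta> 1"
    using hook_conj[of 1 2 ?k, OF _ _ _ k] p12 hook_one(2)[OF g(2)] by simp
  then show ?thesis
    using hook_conj[of "- 1" "- 2", OF _ _ _ g(1)] p12 g signed_perm_uminus[OF g(1)] by simp
qed

lemma single_idem: 
  assumes "x \<in> signed_points n"
  shows "hook x (- x) * hook x (- x) = hook x (- x)"
    and "hook x (- x) * rep (signed_transp x (- x)) = hook x (- x)"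
proof -
  have n: "0 < n" using assms by (auto simp: signed_points_iff)
  have p1: "1 \<in> signed_points n" using n by (simp add: signed_points_iff)
  obtain g where g: "signed_perm n g" "g 1 = x" using extend_to_signed_perm1[OF assms(1)] .
  have H: "hook x (- x) = conj_by g (\<eta> 0)" using hook_single[OF n g(1)] g by simp
  have T: "rep (signed_transp x (- x)) = conj_by g (\<sigma> 0)"
    using conj_by_transp[OF g(1), of 1 "- 1"] n p1 rep_transp_small g signed_perm_uminus[OF g(1)] by simp
  show "hook x (- x) * hook x (- x) = hook x (- x)" "hook x (- x) * rep (signed_transp x (- x)) = hook x (- x)"
    unfolding H T using relations[OF H0_idem] eta0_absorb n by (simp_all flip: conj_by_mult[OF g(1)])
qed

context
  fixes x y
  assumes xy: "x \<in> signed_points n" "y \<in> signed_points n" "\<bar>x\<bar> \<noteq> \<bar>y\<bar>"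
begin

lemma hook_idem: "hook x y * hook x y = hook x y"
proof -
  obtain g where g: "signed_perm n g" "1 < n" "hook x y = conj_by g (\<eta> 1)"
    using two_orbits_standard[OF xy] by metis
  show ?thesis unfolding g using relations[OF H_idem[of 1]] g(2)
    by (simp flip: conj_by_mult[OF g(1)])
qed

lemma hook_sign_hook: "hook x y * rep (signed_transp x (- x)) * hook x y = hook x y"
proof -
  obtain g where g: "signed_perm n g" "1 < n" "hook x y = conj_by g (\<eta> 1)" "rep (signed_transp x (- x)) = conj_by g (\<sigma> 0)"
    using two_orbits_standard[OF xy] by metis
  show ?thesis unfolding g using relations[OF H1S0H1] g(2)
    by (simp add: mult.assoc flip: conj_by_mult[OF g(1)])
qed

lemma singles_commute: "hook x (- x) * hook y (- y) = hook y (- y) * hook x (- x)"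
  and singles_transp: "hook x (- x) * hook y (- y) * rep (signed_transp x y) = hook x (- x) * hook y (- y)"
  and single_hook: "hook x (- x) * hook x y = hook y (- y) * hook x y"
  and hook_single_sym: "hook x y * hook x (- x) = hook x y * hook y (- y)"
  and hook_single_hook: "hook x y * hook x (- x) * hook x y = hook x y"
  and single_hook_single: "hook x (- x) * hook x y * hook x (- x) = hook x (- x) * hook y (- y)"
proof -
  obtain g where g: "signed_perm n g" "1 < n" and std: "hook x y = conj_by g (\<eta> 1)"
    "hook x (- x) = conj_by g (\<eta> 0)" "hook y (- y) = conj_by g (\<sigma> 1 * \<eta> 0 * \<sigma> 1)"
    "rep (signed_transp x y) = conj_by g (\<sigma> 1)"
    using two_orbits_standard[OF xy] by metis
  note cm = conj_by_mult[OF g(1), symmetric]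
  have comm: "\<sigma> 1 * \<eta> 0 * \<sigma> 1 * \<eta> 0 = \<eta> 0 * \<sigma> 1 * \<eta> 0 * \<sigma> 1"
    and full: "\<eta> 0 * \<sigma> 1 * \<eta> 0 * \<sigma> 1 = \<eta> 0 * \<sigma> 1 * \<eta> 0"
    using relations[OF S1H0S1H0] relations[OF H0S1H0S1] g(2) by (simp_all add: mult.assoc)
  have "\<eta> 0 * (\<sigma> 1 * \<eta> 0 * \<sigma> 1) = \<sigma> 1 * \<eta> 0 * \<sigma> 1 * \<eta> 0"
    unfolding comm by (simp add: mult.assoc)
  then show "hook x (- x) * hook y (- y) = hook y (- y) * hook x (- x)"
    unfolding std cm by (rule arg_cong)
  have "\<eta> 0 * (\<sigma> 1 * \<eta> 0 * \<sigma> 1) * \<sigma> 1 = \<eta> 0 * (\<sigma> 1 * \<eta> 0 * \<sigma> 1)"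
    using full square[OF g(2)] by (simp add: mult.assoc)
  then show "hook x (- x) * hook y (- y) * rep (signed_transp x y) = hook x (- x) * hook y (- y)"
    unfolding std cm by (rule arg_cong)
  have "\<eta> 0 * \<eta> 1 = \<sigma> 1 * \<eta> 0 * \<sigma> 1 * \<eta> 1"
    using relations[OF H0H1] g(2) by (simp add: mult.assoc)
  then show "hook x (- x) * hook x y = hook y (- y) * hook x y"
    unfolding std cm by (rule arg_cong)
  have "\<eta> 1 * \<eta> 0 = \<eta> 1 * (\<sigma> 1 * \<eta> 0 * \<sigma> 1)"
    using relations[OF H1H0] g(2) by (simp add: mult.assoc)
  then show "hook x y * hook x (- x) = hook x y * hook y (- y)"
    unfolding std cm by (rule arg_cong)
  have "\<eta> 1 * \<eta> 0 * \<eta> 1 = \<eta> 1"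
    using relations[OF H1H0H1] g(2) by (simp add: mult.assoc)
  then show "hook x y * hook x (- x) * hook x y = hook x y"
    unfolding std cm by (rule arg_cong)
  have "\<eta> 0 * \<eta> 1 * \<eta> 0 = \<eta> 0 * (\<sigma> 1 * \<eta> 0 * \<sigma> 1)"
    using relations[OF H0H1H0] full g(2) by (simp add: mult.assoc)
  then show "hook x (- x) * hook x y * hook x (- x) = hook x (- x) * hook y (- y)"
    unfolding std cm by (rule arg_cong)
qed

end

lemma hook_idem': "x \<in> signed_points n \<Longrightarrow> y \<in> signed_points n \<Longrightarrow> x \<noteq> y \<Longrightarrow> hook x y * hook x y = hook x y"
  using hook_idem[of x y] single_idem(1)[of x] by (cases "y = - x") (auto simp: abs_eq_iff)

context
  fixes x y z
  assumes xyz: "x \<in> signed_points n" "y \<in> signed_points n" "z \<in> signed_points n"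
    "\<bar>x\<bar> \<noteq> \<bar>y\<bar>" "\<bar>x\<bar> \<noteq> \<bar>z\<bar>" "\<bar>y\<bar> \<noteq> \<bar>z\<bar>"
begin

lemma hook_hook_adjacent: "hook x y * hook y z = hook x y * rep (signed_transp x z)"
  and single_hook_commute: "hook x (- x) * hook y z = hook y z * hook x (- x)"
proof -
  have "card {\<bar>x\<bar>, \<bar>y\<bar>, \<bar>z\<bar>} \<le> card {1..int n}"
    using xyz(1-3) by (intro card_mono) (auto simp: signed_points_iff)
  then have n: "2 < n" using xyz(4-6) by simp
  then have n1: "1 < n" and n0: "0 < n" by simp_all
  obtain g where g: "signed_perm n g" "g 1 = x" "g 2 = y" "g 3 = z" using extend_to_signed_perm3[OF xyz] .
  have p: "1 \<in> signed_points n" "2 \<in> signed_points n" "3 \<in> signed_points n"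
    using n by (auto simp: signed_points_iff)
  have "hook 2 3 = \<eta> 2" using hook_eta[of 2] n by simp
  then have std: "hook x y = conj_by g (\<eta> 1)" "hook y z = conj_by g (\<eta> 2)" "hook x (- x) = conj_by g (\<eta> 0)"
    "rep (signed_transp x z) = conj_by g (\<sigma> 1 * \<sigma> 2 * \<sigma> 1)"
    using hook_pair[OF n1 g(1)] hook_single[OF n0 g(1)] hook_conj[of 2 3, OF _ _ _ g(1)] p g
      rep_transp_13[OF n] conj_by_transp[OF g(1), of 1 3] by simp_all
  note cm = conj_by_mult[OF g(1), symmetric]
  have "\<eta> 1 * \<eta> 2 = \<eta> 1 * \<eta> 2 * \<sigma> 1 * \<sigma> 1"
    using square[OF n1] by (simp add: mult.assoc)
  also have "\<eta> 1 * \<eta> 2 * \<sigma> 1 = \<eta> 1 * \<sigma> 2"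
    using relations[OF HHS[of 1 n 2]] n by (simp add: mult.assoc)
  also have "\<eta> 1 * \<sigma> 2 * \<sigma> 1 = \<eta> 1 * \<sigma> 1 * \<sigma> 2 * \<sigma> 1"
    using eta1_absorb[OF n1] by simp
  finally have "\<eta> 1 * \<eta> 2 = \<eta> 1 * (\<sigma> 1 * \<sigma> 2 * \<sigma> 1)" by (simp add: mult.assoc)
  then show "hook x y * hook y z = hook x y * rep (signed_transp x z)"
    unfolding std cm by (rule arg_cong)
  have "\<eta> 0 * \<eta> 2 = \<eta> 2 * \<eta> 0" using n by (intro eta_eta_far) auto
  then show "hook x (- x) * hook y z = hook y z * hook x (- x)"
    unfolding std cm by (rule arg_cong)
qed

end

text \<open>Moved to the points 1, 2 and 3, 4 this is the commutation of \<open>H 1\<close> and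
  \<open>H 3\<close>.\<close>
lemma pairs_commute:
  assumes "x \<in> signed_points n" "y \<in> signed_points n" "z \<in> signed_points n" "w \<in> signed_points n"
    and "\<bar>x\<bar> \<noteq> \<bar>y\<bar>" "\<bar>x\<bar> \<noteq> \<bar>z\<bar>" "\<bar>y\<bar> \<noteq> \<bar>z\<bar>" "\<bar>x\<bar> \<noteq> \<bar>w\<bar>" "\<bar>y\<bar> \<noteq> \<bar>w\<bar>" "\<bar>z\<bar> \<noteq> \<bar>w\<bar>"
  shows "hook x y * hook z w = hook z w * hook x y"
proof -
  have "card {\<bar>x\<bar>, \<bar>y\<bar>, \<bar>z\<bar>, \<bar>w\<bar>} \<le> card {1..int n}"
    using assms(1-4) by (intro card_mono) (auto simp: signed_points_iff)
  then have n: "3 < n" using assms(5-10) by simp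
  then have n1: "1 < n" by simp
  obtain g where g: "signed_perm n g" "g 1 = x" "g 2 = y" "g 3 = z" "g 4 = w"
    using extend_to_signed_perm4[OF assms] .
  have p: "3 \<in> signed_points n" "4 \<in> signed_points n" using n by (auto simp: signed_points_iff)
  have "hook 3 4 = \<eta> 3" using hook_eta[of 3] n by simp
  then have std: "hook x y = conj_by g (\<eta> 1)" "hook z w = conj_by g (\<eta> 3)"
    using hook_pair[OF n1 g(1)] hook_conj[of 3 4, OF _ _ _ g(1)] p g by simp_all
  have "\<eta> 1 * \<eta> 3 = \<eta> 3 * \<eta> 1" using n by (intro eta_eta_far) auto
  then show ?thesis
    unfolding std conj_by_mult[OF g(1), symmetric] by (rule arg_cong)
qed

lemma hook_disjoint_commute:
  assumes "x \<in> signed_points n" "y \<in> signed_points n" "z \<in> signed_points n" "w \<in> signed_points n"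
    and "x \<noteq> y" "z \<noteq> w" and "\<bar>x\<bar> \<noteq> \<bar>z\<bar>" "\<bar>y\<bar> \<noteq> \<bar>z\<bar>" "\<bar>x\<bar> \<noteq> \<bar>w\<bar>" "\<bar>y\<bar> \<noteq> \<bar>w\<bar>"
  shows "hook x y * hook z w = hook z w * hook x y"
proof (cases "y = - x")
  case True
  then show ?thesis
    using assms singles_commute[of x z] single_hook_commute[of x z w]
    by (cases "w = - z") (auto simp: abs_eq_iff)
next
  case False
  then have "\<bar>x\<bar> \<noteq> \<bar>y\<bar>" using assms by (auto simp: abs_eq_iff)
  then show ?thesis
    using assms single_hook_commute[of z x y] pairs_commute[of x y z w]
    by (cases "w = - z") (auto simp: abs_eq_iff)
qed

end

section \<open>Products of commuting idempotents\<close>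

definition commuting_idempotents :: "'m::monoid_mult set \<Rightarrow> bool" where
  "commuting_idempotents A \<longleftrightarrow> finite A \<and> (\<forall>a\<in>A. a * a = a) \<and> (\<forall>a\<in>A. \<forall>b\<in>A. a * b = b * a)"

text \<open>Any enumeration serves, with or without repetitions: by
  \<open>prod_list_absorb_list\<close> the products of two enumerations absorb each other from both
  sides and are therefore equal.\<close>
definition idem_prod :: "'m::monoid_mult set \<Rightarrow> 'm" where
  "idem_prod A = prod_list (SOME xs. set xs = A)"

lemma commuting_idempotents_subset:
  "commuting_idempotents A \<Longrightarrow> B \<subseteq> A \<Longrightarrow> commuting_idempotents B"
  unfolding commuting_idempotents_def by (blast intro: finite_subset)

lemma commuting_idempotents_list:
  assumes "commuting_idempotents A"
  obtains xs where "A = set xs"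
  using assms finite_list[of A] unfolding commuting_idempotents_def by auto

lemma prod_list_absorb:
  fixes xs :: "'m::monoid_mult list"
  assumes "commuting_idempotents (set xs)" "a \<in> set xs"
  shows "a * prod_list xs = prod_list xs" "prod_list xs * a = prod_list xs"
proof -
  have "a * prod_list xs = prod_list xs"
    using assms
  proof (induction xs)
    case (Cons b xs)
    have xs: "commuting_idempotents (set xs)"
      using Cons.prems(1) by (rule commuting_idempotents_subset) auto
    show ?case
    proof (cases "a = b")
      case True
      then have "a * b = b" using Cons.prems unfolding commuting_idempotents_def by auto
      then show ?thesis by (simp flip: mult.assoc)
    next
      case False
      then have "a \<in> set xs" using Cons.prems by simp
      then have IH: "a * prod_list xs = prod_list xs" by (rule Cons.IH[OF xs])
      have "a * b = b * a" using Cons.prems unfolding commuting_idempotents_def by auto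
      then have "a * prod_list (b # xs) = b * (a * prod_list xs)" by (simp flip: mult.assoc)
      then show ?thesis by (simp add: IH)
    qed
  qed simp
  moreover have "prod_list xs * a = a * prod_list xs"
    using assms unfolding commuting_idempotents_def by (intro prod_list_commute) auto
  ultimately show "a * prod_list xs = prod_list xs" "prod_list xs * a = prod_list xs" by simp_all
qed

lemma prod_list_absorb_list:
  fixes xs :: "'m::monoid_mult list"
  assumes "commuting_idempotents (set xs)" "set ys \<subseteq> set xs"
  shows "prod_list ys * prod_list xs = prod_list xs" "prod_list xs * prod_list ys = prod_list xs"
  using assms(2)
  by (induction ys) (simp_all add: prod_list_absorb[OF assms(1)] mult.assoc, simp add: prod_list_absorb[OF assms(1)] flip: mult.assoc)

lemma idem_prod_set:
  assumes "commuting_idempotents (set xs)"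
  shows "idem_prod (set xs) = prod_list xs"
proof -
  let ?ys = "SOME ys. set ys = set xs"
  have ys: "set ?ys = set xs" by (rule someI[of _ xs]) simp
  have "prod_list ?ys = prod_list ?ys * prod_list xs"
    using assms ys prod_list_absorb_list(2)[of ?ys xs] by simp
  also have "\<dots> = prod_list xs" using assms ys by (intro prod_list_absorb_list) auto
  finally show ?thesis by (simp add: idem_prod_def)
qed

lemma idem_prod_empty [simp]: "idem_prod {} = 1"
  using idem_prod_set[of "[]"] by (simp add: commuting_idempotents_def)

lemma idem_prod_insert:
  assumes "commuting_idempotents (insert a A)"
  shows "idem_prod (insert a A) = a * idem_prod A"
proof -
  have A: "commuting_idempotents A" using assms by (rule commuting_idempotents_subset) auto
  then obtain xs where xs: "A = set xs" by (rule commuting_idempotents_list)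
  show ?thesis using idem_prod_set[of "a # xs"] idem_prod_set[of xs] assms A by (simp add: xs)
qed

lemma idem_prod_commute:
  assumes "commuting_idempotents A" "\<forall>a\<in>A. a * b = b * a"
  shows "idem_prod A * b = b * idem_prod A"
proof -
  obtain xs where xs: "A = set xs" using assms(1) by (rule commuting_idempotents_list)
  show ?thesis using prod_list_commute[of xs b] assms idem_prod_set[of xs] by (simp add: xs)
qed

lemma idem_prod_transport:
  assumes "commuting_idempotents A" "commuting_idempotents (c ` A)" "\<forall>a\<in>A. a * b = b * c a"
  shows "idem_prod A * b = b * idem_prod (c ` A)"
proof -
  obtain xs where xs: "A = set xs" using assms(1) by (rule commuting_idempotents_list)
  have "prod_list xs * b = b * prod_list (map c xs)"
    using assms(3) unfolding xs
    by (induction xs) (simp_all add: mult.assoc, metis mult.assoc)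
  then show ?thesis using assms idem_prod_set[of xs] idem_prod_set[of "map c xs"] by (simp add: xs)
qed

section \<open>Products of hooks\<close>

text \<open>The pairs of one row of a symmetric diagram: a fixed-point free involution of
  \<open>A\<close> that commutes with the sign. The involution \<open>uminus\<close> describes the
  product of singles at all points of \<open>A\<close>.\<close>
definition signed_pairing :: "nat \<Rightarrow> int set \<Rightarrow> (int \<Rightarrow> int) \<Rightarrow> bool" where
  "signed_pairing n A \<beta> \<longleftrightarrow> A \<subseteq> signed_points n \<and>
    (\<forall>x\<in>A. - x \<in> A \<and> \<beta> x \<in> A \<and> \<beta> (- x) = - \<beta> x \<and> \<beta> (\<beta> x) = x \<and> \<beta> x \<noteq> x)"

lemma signed_pairingD:
  assumes "signed_pairing n A \<beta>" "x \<in> A"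
  shows "x \<in> signed_points n" "- x \<in> A" "\<beta> x \<in> A" "\<beta> (- x) = - \<beta> x" "\<beta> (\<beta> x) = x" "\<beta> x \<noteq> x"
    "x \<noteq> - x" "\<beta> x \<in> signed_points n"
  using assms by (auto simp: signed_pairing_def signed_points_iff)

lemma signed_pairing_uminus:
  "A \<subseteq> signed_points n \<Longrightarrow> (\<And>x. x \<in> A \<Longrightarrow> - x \<in> A) \<Longrightarrow> signed_pairing n A uminus"
  by (auto simp: signed_pairing_def signed_points_iff)

lemma signed_pairing_singles: "signed_pairing n A \<beta> \<Longrightarrow> signed_pairing n A uminus"
  by (rule signed_pairing_uminus) (auto simp: signed_pairing_def)

lemma signed_pairing_remove:
  assumes "signed_pairing n A \<beta>" "x \<in> A"
  shows "signed_pairing n (A - {x, - x, \<beta> x, - \<beta> x}) \<beta>"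
  unfolding signed_pairing_def
proof (intro conjI ballI)
  note D = signed_pairingD[OF assms(1)]
  show "A - {x, - x, \<beta> x, - \<beta> x} \<subseteq> signed_points n" using D(1) by auto
  fix z assume z: "z \<in> A - {x, - x, \<beta> x, - \<beta> x}"
  then show "- z \<in> A - {x, - x, \<beta> x, - \<beta> x}" using D(2)[of z] by (auto simp: minus_equation_iff[of z])
  have "\<beta> z \<noteq> w" if "w \<in> {x, - x, \<beta> x, - \<beta> x}" for w
  proof
    assume "\<beta> z = w"
    then have "z = \<beta> w" using D(5)[of z] z by auto
    then show False using that z D(4,5)[OF assms(2)] D(4)[OF D(3)[OF assms(2)]] by auto
  qed
  then show "\<beta> z \<in> A - {x, - x, \<beta> x, - \<beta> x}" using D(3)[of z] z by blast
  show "\<beta> (- z) = - \<beta> z" "\<beta> (\<beta> z) = z" "\<beta> z \<noteq> z" using D z by auto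
qed

lemma signed_pairing_image:
  assumes "signed_pairing n A \<beta>" "signed_perm n g"
  shows "signed_pairing n (g ` A) (g \<circ> \<beta> \<circ> inverse_fun g)"
  using assms
  by (auto simp: signed_pairing_def signed_perm_inj[OF assms(2)] simp flip: signed_perm_uminus[OF assms(2)])

context brauer_B_relations
begin

abbreviation single :: "int \<Rightarrow> 'm" where "single x \<equiv> hook x (- x)"

text \<open>The up to four points \<open>x, - x, \<beta> x, - \<beta> x\<close> of a pair of orbits
  give the same hook. Taking the product over the set of hooks, not over points or orbits, removes
  the repetitions without choosing representatives.\<close>
definition hook_prod :: "int set \<Rightarrow> (int \<Rightarrow> int) \<Rightarrow> 'm" where
  "hook_prod A \<beta> = idem_prod ((\<lambda>x. hook x (\<beta> x)) ` A)"

lemma hook_prod_cong: "(\<And>x. x \<in> A \<Longrightarrow> \<beta> x = \<beta>' x) \<Longrightarrow> hook_prod A \<beta> = hook_prod A \<beta>'"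
  by (simp add: hook_prod_def cong: image_cong)

lemma hook_prod_empty [simp]: "hook_prod {} \<beta> = 1"
  by (simp add: hook_prod_def)

lemma same_orbit_hook:
  assumes A: "signed_pairing n A \<beta>" and x: "x \<in> A" and z: "z \<in> {x, - x, \<beta> x, - \<beta> x}"
  shows "hook z (\<beta> z) = hook x (\<beta> x)"
proof -
  note D = signed_pairingD[OF A]
  have "\<beta> (- \<beta> x) = - x" using D(4)[OF D(3)[OF x]] D(5)[OF x] by simp
  then have "z = x \<and> \<beta> z = \<beta> x \<or> z = - x \<and> \<beta> z = - \<beta> x \<or> z = \<beta> x \<and> \<beta> z = x \<or> z = - \<beta> x \<and> \<beta> z = - x"
    using z D(4,5)[OF x] by auto
  then show ?thesis
    using hook_sym[of x "\<beta> x"] hook_uminus[of x "\<beta> x"] hook_sym[of "- x" "- \<beta> x"] D(1,6,8)[OF x] by auto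
qed

lemma disjoint_orbits:
  assumes A: "signed_pairing n A \<beta>" and x: "x \<in> A" and z: "z \<in> A" "z \<notin> {x, - x, \<beta> x, - \<beta> x}"
  shows "\<bar>x\<bar> \<noteq> \<bar>z\<bar>" "\<bar>\<beta> x\<bar> \<noteq> \<bar>z\<bar>" "\<bar>x\<bar> \<noteq> \<bar>\<beta> z\<bar>" "\<bar>\<beta> x\<bar> \<noteq> \<bar>\<beta> z\<bar>"
proof -
  have "\<beta> z \<in> A - {x, - x, \<beta> x, - \<beta> x}"
    using signed_pairingD(3)[OF signed_pairing_remove[OF A x], of z] z by blast
  then show "\<bar>x\<bar> \<noteq> \<bar>z\<bar>" "\<bar>\<beta> x\<bar> \<noteq> \<bar>z\<bar>" "\<bar>x\<bar> \<noteq> \<bar>\<beta> z\<bar>" "\<bar>\<beta> x\<bar> \<noteq> \<bar>\<beta> z\<bar>"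
    using z by (auto simp: abs_eq_iff)
qed

lemma commuting_hooks:
  assumes A: "signed_pairing n A \<beta>"
  shows "commuting_idempotents ((\<lambda>x. hook x (\<beta> x)) ` A)"
  unfolding commuting_idempotents_def ball_simps
proof (intro conjI ballI)
  note D = signed_pairingD[OF A]
  have "finite (signed_points n)" by (simp add: signed_points_def)
  then show "finite ((\<lambda>x. hook x (\<beta> x)) ` A)"
    using A finite_subset unfolding signed_pairing_def by blast
  fix x assume x: "x \<in> A"
  then show "hook x (\<beta> x) * hook x (\<beta> x) = hook x (\<beta> x)" using D[OF x] by (intro hook_idem') auto
  fix z assume z: "z \<in> A"
  show "hook x (\<beta> x) * hook z (\<beta> z) = hook z (\<beta> z) * hook x (\<beta> x)"
  proof (cases "z \<in> {x, - x, \<beta> x, - \<beta> x}")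
    case True
    show ?thesis by (simp only: same_orbit_hook[OF A x True])
  next
    case False
    show ?thesis
      by (rule hook_disjoint_commute[OF D(1,8)[OF x] D(1,8)[OF z] D(6)[OF x, symmetric] D(6)[OF z, symmetric]
            disjoint_orbits[OF A x z False]])
  qed
qed

text \<open>The two orbits of \<open>x\<close> and \<open>y\<close> are split off at once. Splitting
  off pair by pair reduces identities between products of hooks to identities on few orbits.\<close>
lemma hook_prod_remove:
  assumes A: "signed_pairing n A \<beta>" and x: "x \<in> A" "\<beta> x = y"
  shows "hook_prod A \<beta> = hook_prod (A - {x, - x, y, - y}) \<beta> * hook x y"
    and "hook_prod (A - {x, - x, y, - y}) \<beta> * hook x y = hook x y * hook_prod (A - {x, - x, y, - y}) \<beta>"
proof -
  let ?A0 = "A - {x, - x, y, - y}" and ?h = "\<lambda>x. hook x (\<beta> x)"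
  note D = signed_pairingD[OF A x(1), unfolded x(2)]
  have "y \<in> A" "- y \<in> A" using D signed_pairingD(2)[OF A D(3)] by auto
  then have A_eq: "A = {x, - x, y, - y} \<union> ?A0" using D x by auto
  have orbit: "?h ` {x, - x, y, - y} = {hook x y}"
    using same_orbit_hook[OF A x(1)] x(2) by (auto intro!: image_eqI[of _ _ x])
  have "?h ` A = ?h ` ({x, - x, y, - y} \<union> ?A0)" by (rule arg_cong[OF A_eq])
  also have "\<dots> = insert (hook x y) (?h ` ?A0)"
    by (simp only: image_Un orbit insert_is_Un[symmetric])
  finally have im: "?h ` A = insert (hook x y) (?h ` ?A0)" .
  have c: "commuting_idempotents (insert (hook x y) (?h ` ?A0))"
    using commuting_hooks[OF A] im by simp
  show comm: "hook_prod ?A0 \<beta> * hook x y = hook x y * hook_prod ?A0 \<beta>"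
    unfolding hook_prod_def
  proof (rule idem_prod_commute[OF commuting_idempotents_subset[OF c subset_insertI]], rule ballI)
    fix a assume "a \<in> ?h ` ?A0"
    then show "a * hook x y = hook x y * a"
      using c unfolding commuting_idempotents_def by blast
  qed
  show "hook_prod A \<beta> = hook_prod ?A0 \<beta> * hook x y"
    unfolding comm unfolding hook_prod_def im by (rule idem_prod_insert[OF c])
qed

lemma hook_prod_commute:
  assumes A: "signed_pairing n A \<beta>" and "z \<in> signed_points n" "w \<in> signed_points n" "z \<noteq> w" "z \<notin> A" "w \<notin> A"
  shows "hook_prod A \<beta> * hook z w = hook z w * hook_prod A \<beta>"
  unfolding hook_prod_def
proof (rule idem_prod_commute[OF commuting_hooks[OF A]], rule ballI, clarify)
  fix x assume x: "x \<in> A"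
  note D = signed_pairingD[OF A x]
  have "- \<beta> x \<in> A" using signed_pairingD(2)[OF A D(3)] .
  then show "hook x (\<beta> x) * hook z w = hook z w * hook x (\<beta> x)"
    using x D(1,2,3,6,8) assms(2-6) by (intro hook_disjoint_commute) (auto simp: abs_eq_iff)
qed

lemma hook_prod_move:
  assumes A: "signed_pairing n A \<beta>" and g: "signed_perm n g"
  shows "hook_prod A \<beta> * rep g = rep g * hook_prod (g ` A) (g \<circ> \<beta> \<circ> inverse_fun g)"
proof -
  note D = signed_pairingD[OF A]
  have move: "hook x (\<beta> x) * rep g = rep g * conj_by g (hook x (\<beta> x))" for x
    by (rule conj_by_rule[OF g])
  have "conj_by g (hook x (\<beta> x)) = hook (g x) (g (\<beta> x))" if "x \<in> A" for x
    using D[OF that] g by (intro hook_conj) auto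
  then have im: "conj_by g ` (\<lambda>x. hook x (\<beta> x)) ` A = (\<lambda>x. hook x ((g \<circ> \<beta> \<circ> inverse_fun g) x)) ` g ` A"
    using g by (auto simp: image_comp cong: image_cong_simp)
  show ?thesis
    unfolding hook_prod_def im[symmetric]
    by (rule idem_prod_transport[OF commuting_hooks[OF A]])
      (use commuting_hooks[OF signed_pairing_image[OF A g]] move in \<open>auto simp: im\<close>)
qed

lemma hook_prod_commute_rep:
  assumes A: "signed_pairing n A \<beta>" and g: "signed_perm n g" and fix_A: "\<And>x. x \<in> A \<Longrightarrow> g x = x"
  shows "hook_prod A \<beta> * rep g = rep g * hook_prod A \<beta>"
proof -
  have "g ` A = A" using fix_A by force
  moreover have "(g \<circ> \<beta> \<circ> inverse_fun g) x = \<beta> x" if "x \<in> A" for x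
  proof -
    have "inverse_fun g x = x" using fix_A[OF that] signed_perm_inverse_simps(2)[OF g, of x] by simp
    then show ?thesis using fix_A signed_pairingD(3)[OF A that] by simp
  qed
  ultimately show ?thesis using hook_prod_move[OF A g] hook_prod_cong[of A "g \<circ> \<beta> \<circ> inverse_fun g" \<beta>] by simp
qed

lemma singles_absorb:
  assumes "signed_pairing n A uminus" "x \<in> A"
  shows "single x * hook_prod A uminus = hook_prod A uminus"
proof -
  have "hook_prod A uminus = single x * hook_prod (A - {x, - x, - x, - (- x)}) uminus"
    using hook_prod_remove[OF assms HOL.refl] by simp
  then show ?thesis using single_idem(1)[OF signed_pairingD(1)[OF assms]] by (simp flip: mult.assoc)
qed

lemma transp_single:
  assumes "x \<in> signed_points n"
  shows "rep (signed_transp x (- x)) * single x = single x"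
proof -
  have t: "signed_perm n (signed_transp x (- x))" using assms by (intro signed_transp_points) auto
  have x0: "x \<noteq> 0" "x \<noteq> - x" using assms by (auto simp: signed_points_iff)
  have "single x * rep (signed_transp x (- x)) = rep (signed_transp x (- x)) * hook (- x) x"
    using hook_move[of x "- x", OF _ _ _ t] assms x0 by (simp add: signed_transp_apply)
  then show ?thesis using single_idem(2)[OF assms] hook_sym[of x "- x"] assms x0 by simp
qed

lemma transp_singles:
  assumes "x \<in> signed_points n" "y \<in> signed_points n" "\<bar>x\<bar> \<noteq> \<bar>y\<bar>"
  shows "rep (signed_transp x y) * (single x * single y) = single x * single y"
proof -
  let ?t = "signed_transp x y"
  have t: "signed_perm n ?t" using assms by (intro signed_transp_points) auto
  have nz: "x \<noteq> 0" "y \<noteq> 0" "x \<noteq> - x" "y \<noteq> - y" using assms by (auto simp: signed_points_iff)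
  have move: "single x * rep ?t = rep ?t * single y" "single y * rep ?t = rep ?t * single x"
    using hook_move[of x "- x", OF _ _ _ t] hook_move[of y "- y", OF _ _ _ t] assms nz signed_perm_uminus[OF t]
    by (simp_all add: signed_transp_apply)
  have "single x * single y = single x * (single y * rep ?t)"
    using singles_transp[OF assms] by (simp add: mult.assoc)
  also have "\<dots> = rep ?t * (single y * single x)"
    by (simp add: move) (simp add: move flip: mult.assoc)
  finally show ?thesis using singles_commute[OF assms] by simp
qed

text \<open>By induction on \<open>A\<close>: a permutation that moves only points of
  \<open>A\<close> is a product of exchanges inside \<open>A\<close>, and each is absorbed by the
  singles at the exchanged points.\<close>
lemma singles_absorb_rep:
  assumes "signed_pairing n A uminus" "signed_perm n g" "\<And>x. x \<in> signed_points n \<Longrightarrow> x \<notin> A \<Longrightarrow> g x = x"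
  shows "rep g * hook_prod A uminus = hook_prod A uminus"
proof -
  have "finite A" using assms(1) finite_subset[of A "signed_points n"]
    by (auto simp: signed_pairing_def signed_points_def)
  then show ?thesis using assms
  proof (induction A arbitrary: g rule: finite_psubset_induct)
    case (psubset A)
    note A = psubset.prems(1) and g = psubset.prems(2)
    note D = signed_pairingD[OF A]
    show ?case
    proof (cases "A = {}")
      case True
      then have "g x = x" for x
        using psubset.prems(3)[of x] signed_perm_outside[OF g, of x] signed_perm_zero[OF g]
        by (cases "x \<in> signed_points n") (auto simp: signed_points_iff not_le)
      then have "g = id" by auto
      then show ?thesis by (simp only: rep_id mult_1)
    next
      case False
      then obtain x where x: "x \<in> A" by blast
      have gx_pts: "g x \<in> signed_points n" using D(1)[OF x] g by simp
      have gxA: "g x \<in> A"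
      proof (rule ccontr)
        assume "g x \<notin> A"
        then have "g (g x) = g x" using psubset.prems(3) gx_pts by blast
        then show False using \<open>g x \<notin> A\<close> x signed_perm_inj[OF g] by simp
      qed
      \<comment> \<open>write g as a permutation fixing x followed by the transposition of x and g x\<close>
      let ?t = "signed_transp x (g x)"
      let ?h = "?t \<circ> g"
      have t: "signed_perm n ?t" by (intro signed_transp_points D(1)[OF x] gx_pts)
      have h: "signed_perm n ?h" by (intro signed_perm_comp g t)
      have x0: "x \<noteq> 0" "g x \<noteq> 0" using D(1)[OF x] gx_pts by (auto simp: signed_points_iff)
      have tt: "?t \<circ> ?t = id"
        using x0 by (auto simp: fun_eq_iff signed_transp_def transpose_def)
      have hx: "?h x = x" using x0 by (simp add: signed_transp_apply)
      define A0 where "A0 = A - {x, - x, - x, - (- x)}"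
      have A0: "signed_pairing n A0 uminus" unfolding A0_def by (rule signed_pairing_remove[OF A x])
      have h_fix: "?h z = z" if z: "z \<in> signed_points n" "z \<notin> A0" for z
      proof (cases "z \<in> A")
        case True
        then have "z = x \<or> z = - x" using z by (auto simp: A0_def)
        then show ?thesis using hx signed_perm_uminus[OF h, of x] by auto
      next
        case False
        then have "g z = z" using psubset.prems(3) z by blast
        moreover have "\<bar>z\<bar> \<noteq> \<bar>x\<bar>" "\<bar>z\<bar> \<noteq> \<bar>g x\<bar>"
          using False x gxA D(2)[OF x] D(2)[OF gxA] by (auto simp: abs_eq_iff)
        ultimately show ?thesis by (simp add: signed_transp_outside)
      qed
      have split: "hook_prod A uminus = hook_prod A0 uminus * single x"
        "hook_prod A0 uminus * single x = single x * hook_prod A0 uminus"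
        using hook_prod_remove[OF A x HOL.refl] by (simp_all add: A0_def)
      have "rep ?h * hook_prod A0 uminus = hook_prod A0 uminus"
        using x by (intro psubset.IH A0 h h_fix) (auto simp: A0_def)
      then have absorb_h: "rep ?h * hook_prod A uminus = hook_prod A uminus"
        by (simp add: split(1) flip: mult.assoc)
      have absorb_t: "rep ?t * hook_prod A uminus = hook_prod A uminus"
      proof -
        have "rep ?t * (single x * (single (g x) * hook_prod A uminus)) = single x * (single (g x) * hook_prod A uminus)"
        proof -
          consider "g x = x" | "g x = - x" | "\<bar>x\<bar> \<noteq> \<bar>g x\<bar>" by linarith
          then show ?thesis
          proof cases
            case 1
            then have "?t = id" by (simp add: signed_transp_def transpose_def fun_eq_iff)
            then show ?thesis by (simp only: rep_id mult_1)
          next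
            case 2
            then show ?thesis using transp_single[OF D(1)[OF x]] by (simp flip: mult.assoc)
          next
            case 3
            then show ?thesis using transp_singles[OF D(1)[OF x] gx_pts] by (simp flip: mult.assoc)
          qed
        qed
        then show ?thesis by (simp add: singles_absorb[OF A] x gxA)
      qed
      have "g = ?t \<circ> ?h" using tt by (simp flip: comp_assoc)
      then have "rep g = rep ?h * rep ?t" using rep_mult[OF h t] by simp
      then show ?thesis using absorb_h absorb_t by (simp add: mult.assoc)
    qed
  qed
qed

end

section \<open>Cutting and joining the bottom points\<close>

lemma commute_mult:
  fixes a :: "'m::monoid_mult"
  assumes "a * c = c * a" "b * c = c * b"
  shows "a * b * c = c * (a * b)"
proof -
  have "a * b * c = a * c * b" using assms(2) by (simp add: mult.assoc)
  then show ?thesis using assms(1) by (simp flip: mult.assoc)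
qed

context brauer_B_relations
begin

text \<open>The factors of \<open>bottom_half\<close> that belong to one pair.\<close>
definition blk :: "int \<Rightarrow> int \<Rightarrow> 'm" where
  "blk x y = single x * single y * hook x y"

text \<open>The singles in front cut all strands that arrive at the points of \<open>A\<close>, so
  that the permutation to the left does not matter there; the hooks then join the points as
  required.\<close>
definition bottom_half :: "int set \<Rightarrow> (int \<Rightarrow> int) \<Rightarrow> 'm" where
  "bottom_half A \<beta> = hook_prod A uminus * hook_prod A \<beta>"

lemma bottom_half_cong: "(\<And>x. x \<in> A \<Longrightarrow> \<beta> x = \<beta>' x) \<Longrightarrow> bottom_half A \<beta> = bottom_half A \<beta>'"
  using hook_prod_cong[of A \<beta> \<beta>'] by (simp add: bottom_half_def)

lemma single_uminus: "x \<in> signed_points n \<Longrightarrow> hook (- x) x = single x"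
  using hook_sym[of x "- x"] by (auto simp: signed_points_iff)

lemma blk_single: "x \<in> signed_points n \<Longrightarrow> blk x (- x) = single x"
  by (simp add: blk_def single_uminus single_idem)

lemma blk_sym:
  assumes "x \<in> signed_points n" "y \<in> signed_points n" "x \<noteq> y"
  shows "blk y x = blk x y"
proof (cases "y = - x")
  case True
  then show ?thesis using assms by (simp add: blk_def single_uminus)
next
  case False
  then show ?thesis using hook_sym[OF assms] singles_commute[of x y] assms by (auto simp: blk_def abs_eq_iff)
qed

lemma bottom_half_commute:
  assumes A: "signed_pairing n A \<beta>" and "z \<in> signed_points n" "w \<in> signed_points n" "z \<noteq> w" "z \<notin> A" "w \<notin> A"
  shows "bottom_half A \<beta> * hook z w = hook z w * bottom_half A \<beta>"
  using hook_prod_commute[OF A assms(2-)] hook_prod_commute[OF signed_pairing_singles[OF A] assms(2-)]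
  unfolding bottom_half_def by (intro commute_mult)

lemma bottom_half_commute_rep:
  assumes A: "signed_pairing n A \<beta>" and g: "signed_perm n g" and "\<And>x. x \<in> A \<Longrightarrow> g x = x"
  shows "bottom_half A \<beta> * rep g = rep g * bottom_half A \<beta>"
proof -
  have "hook_prod A \<beta> * rep g = rep g * hook_prod A \<beta>" "hook_prod A uminus * rep g = rep g * hook_prod A uminus"
    using assms by (auto intro!: hook_prod_commute_rep signed_pairing_singles[OF A])
  then show ?thesis unfolding bottom_half_def by (intro commute_mult)
qed

lemma bottom_half_remove:
  assumes A: "signed_pairing n A \<beta>" and x: "x \<in> A" "\<beta> x = y"
  shows "bottom_half A \<beta> = bottom_half (A - {x, - x, y, - y}) \<beta> * blk x y"
proof -
  let ?A0 = "A - {x, - x, y, - y}"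
  note D = signed_pairingD[OF A x(1), unfolded x(2)]
  have A0: "signed_pairing n ?A0 \<beta>" using signed_pairing_remove[OF A x(1)] x(2) by simp
  note Am = signed_pairing_singles[OF A]
  have P: "hook_prod A uminus = hook_prod ?A0 uminus * (single x * single y)"
  proof (cases "y = - x")
    case True
    have "A - {x, - x, - x, - (- x)} = ?A0" using True by auto
    then show ?thesis
      using hook_prod_remove(1)[OF Am x(1) HOL.refl] single_idem(1)[OF D(1)] single_uminus[OF D(1)] True by simp
  next
    case False
    let ?A1 = "A - {x, - x, - x, - (- x)}"
    have A1: "signed_pairing n ?A1 uminus" by (rule signed_pairing_remove[OF Am x(1)])
    have y1: "y \<in> ?A1" using D False by auto
    have "?A1 - {y, - y, - y, - (- y)} = ?A0" by auto
    then have "hook_prod A uminus = hook_prod ?A0 uminus * single y * single x"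
      using hook_prod_remove(1)[OF Am x(1) HOL.refl] hook_prod_remove(1)[OF A1 y1 HOL.refl] by simp
    then show ?thesis
      using singles_commute[of x y] D False by (auto simp: mult.assoc abs_eq_iff)
  qed
  have nin: "x \<notin> ?A0" "- x \<notin> ?A0" "y \<notin> ?A0" "- y \<notin> ?A0" by auto
  have c: "hook_prod ?A0 \<beta> * single x = single x * hook_prod ?A0 \<beta>"
    "hook_prod ?A0 \<beta> * single y = single y * hook_prod ?A0 \<beta>"
    using D nin by (intro hook_prod_commute[OF A0]; force simp: signed_points_iff)+
  have swap: "single x * (single y * hook_prod ?A0 \<beta>) = hook_prod ?A0 \<beta> * (single x * single y)"
  proof -
    have "single x * (single y * hook_prod ?A0 \<beta>) = single x * hook_prod ?A0 \<beta> * single y"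
      by (simp only: c(2) mult.assoc)
    also have "\<dots> = hook_prod ?A0 \<beta> * (single x * single y)" by (simp only: c(1)[symmetric] mult.assoc)
    finally show ?thesis .
  qed
  have "bottom_half A \<beta> = hook_prod ?A0 uminus * (single x * (single y * hook_prod ?A0 \<beta>)) * hook x y"
    unfolding bottom_half_def P hook_prod_remove(1)[OF A x] by (simp add: mult.assoc)
  also note swap
  finally show ?thesis unfolding bottom_half_def blk_def by (simp only: mult.assoc)
qed

context
  fixes x y
  assumes xy: "x \<in> signed_points n" "y \<in> signed_points n" "\<bar>x\<bar> \<noteq> \<bar>y\<bar>"
begin

lemma yx: "y \<in> signed_points n" "x \<in> signed_points n" "\<bar>y\<bar> \<noteq> \<bar>x\<bar>"
  using xy by auto

lemma hook_sym': "hook y x = hook x y"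
  using xy by (intro hook_sym) auto

lemma blk_hook: "blk x y * hook x y = blk x y"
  using hook_idem[OF xy] by (simp add: blk_def mult.assoc)

lemma hook_blk: "hook x y * blk x y = hook x y"
proof -
  have "hook x y * blk x y = hook x y * single x * single y * hook x y"
    by (simp add: blk_def mult.assoc)
  also have "\<dots> = hook x y * (single y * single y) * hook x y"
    by (simp only: hook_single_sym[OF xy] mult.assoc)
  also have "\<dots> = hook y x * single y * hook y x"
    using single_idem(1)[OF xy(2)] hook_sym' by simp
  also have "\<dots> = hook x y" using hook_single_hook[OF yx] hook_sym' by simp
  finally show ?thesis .
qed

lemma blk_single_right: "blk x y * single x = single x * single y"
proof -
  have "blk x y * single x = single y * (single x * hook x y * single x)"
    using singles_commute[OF xy] by (simp add: blk_def mult.assoc)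
  also have "\<dots> = single y * (single x * single y)" using single_hook_single[OF xy] by simp
  also have "\<dots> = single x * (single y * single y)"
    by (simp only: singles_commute[OF xy, symmetric] mult.assoc[symmetric])
  finally show ?thesis using single_idem(1)[OF xy(2)] by simp
qed

lemma single_blk: "single x * blk x y = blk x y"
  using single_idem(1)[OF xy(1)] by (simp add: blk_def flip: mult.assoc)

lemma single_hook_eq_blk: "single y * hook x y = blk x y"
proof -
  have "blk x y = single x * (single y * hook x y)" by (simp add: blk_def mult.assoc)
  also have "\<dots> = single x * (single x * hook x y)" using single_hook[OF xy] by simp
  also have "\<dots> = single y * hook x y"
    by (simp only: single_idem(1)[OF xy(1)] mult.assoc[symmetric]) (simp only: single_hook[OF xy])
  finally show ?thesis by simp
qed

lemma blk_flip_hook: "blk x (- y) * hook x y = blk x y"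
proof -
  let ?s = "signed_transp y (- y)"
  have my: "- y \<in> signed_points n" using xy by simp
  have nz: "y \<noteq> 0" using xy by (auto simp: signed_points_iff)
  have s: "signed_perm n ?s" using xy my by (intro signed_transp_points) auto
  have sx: "?s x = x" using xy by (intro signed_transp_outside) auto
  have sy: "?s y = - y" using nz by (simp add: signed_transp_apply)
  have move: "hook x y * rep ?s = rep ?s * hook x (- y)"
    using hook_move[OF xy(1,2) _ s] sx sy xy(3) by auto
  have PP: "single x * single y * rep ?s = single x * single y"
    using single_idem(2)[OF xy(2)] by (simp add: mult.assoc)
  have "blk x (- y) * hook x y = single x * single y * (rep ?s * hook x (- y)) * hook x y"
    using PP single_uminus[OF xy(2)] by (simp add: blk_def flip: mult.assoc)
  also have "\<dots> = single x * single y * (hook y x * rep ?s * hook y x)"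
    by (simp only: move[symmetric] mult.assoc hook_sym')
  also have "\<dots> = blk x y"
    by (simp only: hook_sign_hook[OF yx]) (simp only: hook_sym' blk_def)
  finally show ?thesis .
qed

end

context
  fixes x y q
  assumes xyq: "x \<in> signed_points n" "y \<in> signed_points n" "q \<in> signed_points n"
    "\<bar>x\<bar> \<noteq> \<bar>y\<bar>" "\<bar>x\<bar> \<noteq> \<bar>q\<bar>" "\<bar>y\<bar> \<noteq> \<bar>q\<bar>"
begin

lemma transp_xq: "signed_perm n (signed_transp q x)" "signed_transp q x y = y" "signed_transp q x q = x" "signed_transp q x x = q"
  using xyq by (auto intro!: signed_transp_points signed_transp_outside simp: signed_transp_apply signed_points_iff)

lemma hook_hook_transp: "hook y q * hook x y = rep (signed_transp q x) * hook x y"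
proof -
  have "hook y q * hook x y = hook q y * hook y x"
    using hook_sym'[of x y] hook_sym'[of q y] xyq by auto
  also have "\<dots> = hook q y * rep (signed_transp q x)"
    using xyq by (intro hook_hook_adjacent) auto
  also have "\<dots> = rep (signed_transp q x) * hook x y"
    using hook_move[of q y "signed_transp q x"] transp_xq xyq by auto
  finally show ?thesis .
qed

lemma single_move: "single q * rep (signed_transp q x) = rep (signed_transp q x) * single x"
  using hook_move[of q "- q" "signed_transp q x"] transp_xq xyq signed_perm_uminus[OF transp_xq(1), of q]
  by (auto simp: signed_points_iff)

lemma single_move_y: "single y * rep (signed_transp q x) = rep (signed_transp q x) * single y"
  using hook_move[of y "- y" "signed_transp q x"] transp_xq xyq signed_perm_uminus[OF transp_xq(1), of y]
  by (auto simp: signed_points_iff)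

lemma single_commute: "single x * single y = single y * single x" "single x * single q = single q * single x"
   "single y * single q = single q * single y"
  using singles_commute[of x y] singles_commute[of x q] singles_commute[of y q] xyq by auto

lemma single_commute_hook: "single q * hook x y = hook x y * single q"
  using single_hook_commute[of q x y] xyq by auto

text \<open>The point \<open>x\<close> lies on a strand, \<open>y\<close> is paired with
  \<open>q\<close>. Hooking \<open>x\<close> to \<open>y\<close> makes the strand end at
  \<open>q\<close>, hence the exchange of \<open>q\<close> and \<open>x\<close>.\<close>
lemma blk_hook_through: "blk y q * hook x y = rep (signed_transp q x) * blk x y"
proof -
  have "blk y q * hook x y = single y * single q * (rep (signed_transp q x) * hook x y)"
    unfolding blk_def by (simp only: mult.assoc hook_hook_transp)
  also have "\<dots> = single y * (rep (signed_transp q x) * single x) * hook x y"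
    by (simp only: single_move[symmetric] mult.assoc)
  also have "\<dots> = rep (signed_transp q x) * (single y * single x) * hook x y"
    by (simp only: single_move_y mult.assoc[symmetric])
  finally show ?thesis by (simp only: single_commute[symmetric] blk_def mult.assoc)
qed

text \<open>The point \<open>x\<close> is joined to \<open>- x\<close>. Hooking it to
  \<open>y\<close>, the partner of \<open>q\<close>, leaves \<open>q\<close> joined to \<open>-
  q\<close>.\<close>
lemma single_blk_hook: "single x * blk y q * hook x y = blk x y * single q"
proof -
  have "single x * blk y q * hook x y = single x * single y * single q * (rep (signed_transp q x) * hook x y)"
    unfolding blk_def by (simp only: mult.assoc hook_hook_transp)
  also have "single x * single y * single q = single y * (single q * single x)"
    by (simp only: single_commute mult.assoc)
  also have "\<dots> * (rep (signed_transp q x) * hook x y) = single y * (single q * single x * rep (signed_transp q x)) * hook x y"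
    by (simp only: mult.assoc)
  also have "single q * single x * rep (signed_transp q x) = single q * single x"
    using xyq by (intro singles_transp) auto
  also have "single y * (single q * single x) = single x * single y * single q"
    by (simp only: single_commute(2)[symmetric]) (simp only: single_commute(1) mult.assoc[symmetric])
  finally show ?thesis by (simp only: single_commute_hook blk_def mult.assoc)
qed

end

text \<open>Hooking \<open>x\<close> to \<open>y\<close> frees their former partners
  \<open>p\<close> and \<open>q\<close>, which become partners of each other.\<close>
lemma blk_blk_hook:
  assumes "x \<in> signed_points n" "y \<in> signed_points n" "p \<in> signed_points n" "q \<in> signed_points n"
    and "\<bar>x\<bar> \<noteq> \<bar>y\<bar>" "\<bar>x\<bar> \<noteq> \<bar>p\<bar>" "\<bar>y\<bar> \<noteq> \<bar>p\<bar>" "\<bar>x\<bar> \<noteq> \<bar>q\<bar>" "\<bar>y\<bar> \<noteq> \<bar>q\<bar>" "\<bar>p\<bar> \<noteq> \<bar>q\<bar>"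
  shows "blk x p * blk y q * hook x y = blk x y * blk p q"
proof -
  let ?t = "signed_transp q x"
  note xyq = assms(1,2,4,5,8,9)
  note t = transp_xq[OF xyq]
  have tp: "?t p = p" using assms by (intro signed_transp_outside) auto
  have comm: "single x * single y = single y * single x" "single x * single q = single q * single x"
    "single y * single q = single q * single y" "single p * single x = single x * single p"
    "single p * single y = single y * single p" "single p * single q = single q * single p"
    using assms by (auto intro!: singles_commute)
  have hcomm: "hook x p * single y = single y * hook x p" "hook x p * single q = single q * hook x p"
    "hook x y * single p = single p * hook x y" "hook x y * single q = single q * hook x y"
    "hook p q * hook x y = hook x y * hook p q"
    using single_hook_commute[of y x p] single_hook_commute[of q x p] single_hook_commute[of p x y]
      single_hook_commute[of q x y] pairs_commute[of p q x y] assms by auto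
  have move: "hook x p * rep ?t = rep ?t * hook p q"
    using hook_move[of x p ?t] t tp assms hook_sym'[of p q] by auto
  have "blk x p * blk y q * hook x y = single x * single p * (hook x p * single y) * single q * (hook y q * hook x y)"
    by (simp only: blk_def mult.assoc)
  also have "\<dots> = single x * single p * single y * (hook x p * single q) * (rep ?t * hook x y)"
    by (simp only: hcomm hook_hook_transp[OF xyq] mult.assoc)
  also have "\<dots> = single x * single p * single y * single q * (hook x p * rep ?t) * hook x y"
    by (simp only: hcomm mult.assoc)
  also have "\<dots> = single x * single p * single y * single q * rep ?t * (hook p q * hook x y)"
    by (simp only: move mult.assoc)
  also have "single x * single p * single y * single q = single p * single y * (single q * single x)"
  proof -
    have "single x * single p * single y * single q = single p * (single x * single y) * single q"
      by (simp only: comm(4) mult.assoc[symmetric])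
    also have "\<dots> = single p * single y * (single x * single q)" by (simp only: comm(1) mult.assoc)
    finally show ?thesis by (simp only: comm(2))
  qed
  also have "\<dots> * rep ?t = single p * single y * (single q * single x)"
    using singles_transp[of q x] assms by (simp add: mult.assoc)
  also have "\<dots> = single x * single y * (single p * single q)"
  proof -
    have "single p * single y * (single q * single x) = single p * (single y * single x) * single q"
      by (simp only: comm(2)[symmetric] mult.assoc)
    also have "\<dots> = single p * single x * single y * single q" by (simp only: comm(1)[symmetric] mult.assoc)
    also have "\<dots> = single x * (single p * single y) * single q" by (simp only: comm(4) mult.assoc)
    also have "\<dots> = single x * single y * (single p * single q)" by (simp only: comm(5) mult.assoc)
    finally show ?thesis .
  qed
  also have "\<dots> * (hook p q * hook x y) = single x * single y * (single p * (single q * hook x y)) * hook p q"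
    by (simp only: hcomm mult.assoc)
  also have "\<dots> = single x * single y * hook x y * (single p * single q * hook p q)"
  proof -
    have "single p * (single q * hook x y) = single p * hook x y * single q"
      by (simp only: hcomm(4)[symmetric] mult.assoc)
    also have "\<dots> = hook x y * (single p * single q)"
      by (simp only: hcomm(3)[symmetric] mult.assoc)
    finally show ?thesis by (simp only: mult.assoc)
  qed
  finally show ?thesis by (simp only: blk_def)
qed

end

section \<open>The partition monoid\<close>

definition emb :: "nat \<Rightarrow> nat \<Rightarrow> 'v + 'v \<Rightarrow> nat \<times> 'v" where
  "emb k l = case_sum (Pair k) (Pair l)"

lemma emb_simps [simp]: "emb k l (Inl v) = (k, v)" "emb k l (Inr v) = (l, v)"
  by (simp_all add: emb_def)

definition place :: "nat \<Rightarrow> nat \<Rightarrow> ('v + 'v) rel \<Rightarrow> (nat \<times> 'v) rel" where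
  "place k l r = map_prod (emb k l) (emb k l) ` r"

text \<open>The rows of the stack are numbered 0, 1, 2. Reachability between outer rows ignores
  components inside the middle row, so nothing has to be discarded, and the composition is defined
  for arbitrary relations.\<close>
definition stack_comp :: "('v + 'v) rel \<Rightarrow> ('v + 'v) rel \<Rightarrow> ('v + 'v) rel" where
  "stack_comp r s = {(a, b). (emb 0 2 a, emb 0 2 b) \<in> (place 0 1 r \<union> place 1 2 s)\<^sup>*}"

lemma rtrancl_map_inj:
  assumes "inj \<phi>"
  shows "(\<phi> a, \<phi> b) \<in> (map_prod \<phi> \<phi> ` R)\<^sup>* \<longleftrightarrow> (a, b) \<in> R\<^sup>*"
proof
  assume "(a, b) \<in> R\<^sup>*"
  then show "(\<phi> a, \<phi> b) \<in> (map_prod \<phi> \<phi> ` R)\<^sup>*"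
    by (induction rule: rtrancl_induct) (auto intro: rtrancl_into_rtrancl)
next
  have "\<exists>c. v = \<phi> c \<and> (a, c) \<in> R\<^sup>*" if "(\<phi> a, v) \<in> (map_prod \<phi> \<phi> ` R)\<^sup>*" for v
    using that
  proof (induction rule: rtrancl_induct)
    case (step v w)
    then show ?case using injD[OF assms] by (fastforce intro: rtrancl_into_rtrancl)
  qed blast
  moreover assume "(\<phi> a, \<phi> b) \<in> (map_prod \<phi> \<phi> ` R)\<^sup>*"
  ultimately show "(a, b) \<in> R\<^sup>*" using injD[OF assms] by blast
qed

lemma stack_comp_rows:
  assumes "k \<noteq> l" "k \<noteq> m" "l \<noteq> m"
  shows "(a, b) \<in> stack_comp r s \<longleftrightarrow> (emb k m a, emb k m b) \<in> (place k l r \<union> place l m s)\<^sup>*"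
proof -
  define h where "h i = (if i = 0 then k else if i = 1 then l else if i = 2 then m else i + k + l + m)" for i :: nat
  have inj: "inj (map_prod h (id :: 'a \<Rightarrow> 'a))"
    using assms unfolding inj_def h_def by (auto split: if_splits)
  have emb: "map_prod h id (emb i j c) = emb (h i) (h j) c" for i j and c :: "'a + 'a"
    by (cases c) simp_all
  have place: "map_prod (map_prod h id) (map_prod h id) ` place i j t = place (h i) (h j) t" for i j and t :: "('a + 'a) rel"
    unfolding place_def image_image by (rule image_cong) (auto simp: emb)
  have h: "h 0 = k" "h (Suc 0) = l" "h 2 = m" by (simp_all add: h_def)
  show ?thesis
    using rtrancl_map_inj[OF inj, of "emb 0 2 a" "emb 0 2 b" "place 0 1 r \<union> place 1 2 s"]
    by (simp add: stack_comp_def image_Un place emb h)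
qed

text \<open>The remaining edges stay inside \<open>K\<close>, so a path between points of
  \<open>K\<close> consists of such edges and of excursions in \<open>R1\<close>; each excursion can
  be replaced by a path in \<open>P\<close>.\<close>
lemma rtrancl_contract:
  assumes "R2 \<subseteq> K \<times> K" "P \<subseteq> R1\<^sup>*"
    and contract: "\<And>u v. u \<in> K \<Longrightarrow> v \<in> K \<Longrightarrow> (u, v) \<in> R1\<^sup>* \<Longrightarrow> (u, v) \<in> P\<^sup>*"
    and ab: "a \<in> K" "b \<in> K"
  shows "(a, b) \<in> (R1 \<union> R2)\<^sup>* \<longleftrightarrow> (a, b) \<in> (P \<union> R2)\<^sup>*"
proof
  have "R1\<^sup>* \<subseteq> (R1 \<union> R2)\<^sup>*" by (rule rtrancl_mono) simp
  then have "P \<union> R2 \<subseteq> (R1 \<union> R2)\<^sup>*" using assms(2) by auto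
  then show "(a, b) \<in> (P \<union> R2)\<^sup>* \<Longrightarrow> (a, b) \<in> (R1 \<union> R2)\<^sup>*" using rtrancl_subset_rtrancl by blast
next
  have mono: "P\<^sup>* \<subseteq> (P \<union> R2)\<^sup>*" by (rule rtrancl_mono) simp
  assume "(a, b) \<in> (R1 \<union> R2)\<^sup>*"
  then have "\<exists>c\<in>K. (a, c) \<in> (P \<union> R2)\<^sup>* \<and> (c, b) \<in> R1\<^sup>*"
  proof (induction rule: rtrancl_induct)
    case base
    show ?case using ab by blast
  next
    case (step v w)
    then obtain c where c: "c \<in> K" "(a, c) \<in> (P \<union> R2)\<^sup>*" "(c, v) \<in> R1\<^sup>*" by blast
    show ?case
    proof (cases "(v, w) \<in> R1")
      case True
      then show ?thesis using c by (meson rtrancl_into_rtrancl)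
    next
      case False
      then have vw: "(v, w) \<in> R2" "v \<in> K" "w \<in> K" using step assms(1) by auto
      then have "(c, v) \<in> (P \<union> R2)\<^sup>*" using contract[OF c(1) vw(2) c(3)] mono by blast
      then have "(a, w) \<in> (P \<union> R2)\<^sup>*" using c(2) vw(1) by (meson UnI2 rtrancl_into_rtrancl rtrancl_trans)
      then show ?thesis using vw by blast
    qed
  qed
  then obtain c where c: "c \<in> K" "(a, c) \<in> (P \<union> R2)\<^sup>*" "(c, b) \<in> R1\<^sup>*" by blast
  then have "(c, b) \<in> (P \<union> R2)\<^sup>*" using contract[OF c(1) ab(2) c(3)] mono by blast
  then show "(a, b) \<in> (P \<union> R2)\<^sup>*" using c(2) by (meson rtrancl_trans)
qed

lemma place_rows: "(u, v) \<in> place k l r \<Longrightarrow> fst u \<in> {k, l} \<and> fst v \<in> {k, l}"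
proof -
  have "fst (emb k l a) \<in> {k, l}" for a :: "'a + 'a" by (cases a) simp_all
  then show "(u, v) \<in> place k l r \<Longrightarrow> fst u \<in> {k, l} \<and> fst v \<in> {k, l}" by (auto simp: place_def)
qed

lemma emb_surj: "fst u \<in> {k, l} \<Longrightarrow> \<exists>a. u = emb k l a"
  by (cases u) (auto intro: exI[of _ "Inl _"] exI[of _ "Inr _"] simp: emb_def)

text \<open>The row \<open>l\<close> may be eliminated from every larger stack whose other edges
  avoid it. In a stack of four rows this can be done with either inner row first, which is
  associativity.\<close>
lemma contract_two_rows:
  assumes klm: "k \<noteq> l" "k \<noteq> m" "l \<noteq> m" and R: "R \<subseteq> {u. fst u \<noteq> l} \<times> {u. fst u \<noteq> l}"
    and ab: "fst a \<noteq> l" "fst b \<noteq> l"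
  shows "(a, b) \<in> (place k l r \<union> place l m s \<union> R)\<^sup>* \<longleftrightarrow> (a, b) \<in> (place k m (stack_comp r s) \<union> R)\<^sup>*"
proof (rule rtrancl_contract[where K = "{u. fst u \<noteq> l}"])
  let ?R1 = "place k l r \<union> place l m s"
  show "place k m (stack_comp r s) \<subseteq> ?R1\<^sup>*"
    using stack_comp_rows[OF klm, of _ _ r s] by (auto simp: place_def)
  fix u v assume uv: "u \<in> {u. fst u \<noteq> l}" "v \<in> {u. fst u \<noteq> l}" "(u, v) \<in> ?R1\<^sup>*"
  show "(u, v) \<in> (place k m (stack_comp r s))\<^sup>*"
  proof (cases "u = v")
    case False
    have "fst u \<in> {k, l, m}" using uv(3) False by (metis (no_types, lifting) Un_iff converse_rtranclE insert_iff place_rows)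
    moreover have "fst v \<in> {k, l, m}" using uv(3) False by (metis (no_types, lifting) Un_iff rtranclE insert_iff place_rows)
    ultimately obtain c d where cd: "u = emb k m c" "v = emb k m d" using uv(1,2) emb_surj[of u k m] emb_surj[of v k m] by auto
    then have "(c, d) \<in> stack_comp r s" using uv(3) stack_comp_rows[OF klm] by blast
    then have "(u, v) \<in> place k m (stack_comp r s)" unfolding cd place_def by force
    then show ?thesis by blast
  qed simp
qed (use R ab in auto)

lemma stack_comp_assoc: "stack_comp (stack_comp r s) t = stack_comp r (stack_comp s t)"
proof -
  have "(a, b) \<in> stack_comp (stack_comp r s) t \<longleftrightarrow> (a, b) \<in> stack_comp r (stack_comp s t)" for a b
  proof -
    have ends: "fst (emb 0 3 a) \<noteq> 1" "fst (emb 0 3 b) \<noteq> 1" "fst (emb 0 3 a) \<noteq> 2" "fst (emb 0 3 b) \<noteq> 2"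
      by (cases a; cases b; simp)+
    have "(a, b) \<in> stack_comp (stack_comp r s) t
      \<longleftrightarrow> (emb 0 3 a, emb 0 3 b) \<in> (place 0 2 (stack_comp r s) \<union> place 2 3 t)\<^sup>*"
      by (rule stack_comp_rows) auto
    also have "\<dots> \<longleftrightarrow> (emb 0 3 a, emb 0 3 b) \<in> (place 0 1 r \<union> place 1 2 s \<union> place 2 3 t)\<^sup>*"
      by (rule contract_two_rows[symmetric]) (use ends in \<open>auto dest!: place_rows\<close>)
    also have "\<dots> \<longleftrightarrow> (emb 0 3 a, emb 0 3 b) \<in> (place 1 2 s \<union> place 2 3 t \<union> place 0 1 r)\<^sup>*"
      by (simp add: Un_ac)
    also have "\<dots> \<longleftrightarrow> (emb 0 3 a, emb 0 3 b) \<in> (place 1 3 (stack_comp s t) \<union> place 0 1 r)\<^sup>*"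
      by (rule contract_two_rows) (use ends in \<open>auto dest!: place_rows\<close>)
    also have "\<dots> \<longleftrightarrow> (emb 0 3 a, emb 0 3 b) \<in> (place 0 1 r \<union> place 1 3 (stack_comp s t))\<^sup>*"
      by (simp add: Un_ac)
    also have "\<dots> \<longleftrightarrow> (a, b) \<in> stack_comp r (stack_comp s t)"
      by (rule stack_comp_rows[symmetric]) auto
    finally show ?thesis .
  qed
  then show ?thesis by auto
qed

lemma place_edge: "(a, b) \<in> r \<Longrightarrow> (emb k l a, emb k l b) \<in> place k l r"
  unfolding place_def by force

lemma place_equiv_sym:
  assumes "equiv UNIV r" shows "Relation.sym (place k l r)"
proof (rule symI)
  fix u v assume "(u, v) \<in> place k l r"
  then obtain a b where "(a, b) \<in> r" "u = emb k l a" "v = emb k l b" by (auto simp: place_def)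
  moreover have "(b, a) \<in> r" using assms \<open>(a, b) \<in> r\<close> by (meson equivE symE)
  ultimately show "(v, u) \<in> place k l r" using place_edge by metis
qed

lemma stack_comp_equiv:
  assumes "equiv UNIV r" "equiv UNIV s"
  shows "equiv UNIV (stack_comp r s)"
proof (rule equivI)
  show "stack_comp r s \<subseteq> UNIV \<times> UNIV" by simp
  show "refl_on UNIV (stack_comp r s)" by (simp add: refl_on_def stack_comp_def)
  have "Relation.sym ((place 0 1 r \<union> place 1 2 s)\<^sup>*)"
    using assms by (intro sym_rtrancl sym_Un place_equiv_sym)
  then show "Relation.sym (stack_comp r s)" by (intro symI) (auto simp: stack_comp_def dest: symD)
  show "Relation.trans (stack_comp r s)"
    by (rule transI) (auto simp: stack_comp_def intro: rtrancl_trans)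
qed

text \<open>The map \<open>\<pi>\<close> retracts the stack onto its outer rows. If all edges become
  related by \<open>q\<close>, then all paths do; conversely it suffices to find paths for the pairs
  in \<open>q\<close>.\<close>
lemma stack_comp_eqI:
  fixes \<pi> :: "nat \<times> 'v \<Rightarrow> 'v + 'v"
  assumes q: "equiv UNIV q"
    and top: "\<And>a b. (a, b) \<in> r \<Longrightarrow> (\<pi> (emb 0 1 a), \<pi> (emb 0 1 b)) \<in> q"
    and bot: "\<And>a b. (a, b) \<in> s \<Longrightarrow> (\<pi> (emb 1 2 a), \<pi> (emb 1 2 b)) \<in> q"
    and outer: "\<And>a. \<pi> (emb 0 2 a) = a"
    and path: "\<And>a b. (a, b) \<in> q \<Longrightarrow> (emb 0 2 a, emb 0 2 b) \<in> (place 0 1 r \<union> place 1 2 s)\<^sup>*"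
  shows "stack_comp r s = q"
proof -
  have refl_q: "(c, c) \<in> q" for c using q by (simp add: equiv_def refl_on_def)
  have trans_q: "(c, d) \<in> q \<Longrightarrow> (d, e) \<in> q \<Longrightarrow> (c, e) \<in> q" for c d e
    using q by (meson equivE transE)
  have "(\<pi> u, \<pi> v) \<in> q" if "(u, v) \<in> (place 0 1 r \<union> place 1 2 s)\<^sup>*" for u v
    using that
  proof (induction rule: rtrancl_induct)
    case (step v w)
    have "(\<pi> v, \<pi> w) \<in> q" using step(2) top bot by (auto simp: place_def)
    then show ?case using step(3) trans_q by blast
  qed (rule refl_q)
  then have "(a, b) \<in> q" if "(a, b) \<in> stack_comp r s" for a b
    using that outer unfolding stack_comp_def by fastforce
  then show ?thesis using path by (auto simp: stack_comp_def)
qed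

definition strand_rel :: "('v + 'v) rel" where
  "strand_rel = {(a, b). case_sum id id a = case_sum id id b}"

lemma strand_rel_equiv: "equiv UNIV strand_rel"
  by (rule equivI) (auto simp: strand_rel_def refl_on_def sym_def trans_def)

lemma strand_place: "((k, v), (l, v)) \<in> place k l strand_rel" "((l, v), (k, v)) \<in> place k l strand_rel"
  using place_edge[of "Inl v" "Inr v" strand_rel k l] place_edge[of "Inr v" "Inl v" strand_rel k l]
  by (simp_all add: strand_rel_def)

lemma strand_left: assumes "equiv UNIV r" shows "stack_comp strand_rel r = r"
proof (rule stack_comp_eqI[OF assms, where \<pi> = "\<lambda>(k, v). if k = 2 then Inr v else Inl v"])
  have refl_r: "(c, c) \<in> r" for c using assms by (simp add: equiv_def refl_on_def)
  fix a b :: "'a + 'a"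
  show "(a, b) \<in> strand_rel \<Longrightarrow> ((\<lambda>(k, v). if k = 2 then Inr v else Inl v) (emb 0 1 a), (\<lambda>(k, v). if k = 2 then Inr v else Inl v) (emb 0 1 b)) \<in> r"
    by (cases a; cases b) (simp_all add: strand_rel_def refl_r)
  assume ab: "(a, b) \<in> r"
  show "((\<lambda>(k, v). if k = 2 then Inr v else Inl v) (emb 1 2 a), (\<lambda>(k, v). if k = 2 then Inr v else Inl v) (emb 1 2 b)) \<in> r"
    using ab by (cases a; cases b) simp_all
  let ?R = "place 0 1 strand_rel \<union> place 1 2 r"
  have e: "((0, v), (1, v)) \<in> ?R\<^sup>*" "((1, v), (0, v)) \<in> ?R\<^sup>*" for v
    by (rule r_into_rtrancl, rule UnI1, rule strand_place)+
  have "(emb 0 2 c, emb 1 2 c) \<in> ?R\<^sup>*" "(emb 1 2 c, emb 0 2 c) \<in> ?R\<^sup>*" for c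
    using e by (cases c; simp)+
  moreover have "(emb 1 2 a, emb 1 2 b) \<in> ?R\<^sup>*" by (rule r_into_rtrancl, rule UnI2, rule place_edge[OF ab])
  ultimately show "(emb 0 2 a, emb 0 2 b) \<in> ?R\<^sup>*" by (meson rtrancl_trans)
next
  fix a :: "'a + 'a"
  show "(\<lambda>(k, v). if k = 2 then Inr v else Inl v) (emb 0 2 a) = a" by (cases a) simp_all
qed

lemma strand_right: assumes "equiv UNIV r" shows "stack_comp r strand_rel = r"
proof (rule stack_comp_eqI[OF assms, where \<pi> = "\<lambda>(k, v). if k = 0 then Inl v else Inr v"])
  have refl_r: "(c, c) \<in> r" for c using assms by (simp add: equiv_def refl_on_def)
  fix a b :: "'a + 'a"
  show "(a, b) \<in> strand_rel \<Longrightarrow> ((\<lambda>(k, v). if k = 0 then Inl v else Inr v) (emb 1 2 a), (\<lambda>(k, v). if k = 0 then Inl v else Inr v) (emb 1 2 b)) \<in> r"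
    by (cases a; cases b) (simp_all add: strand_rel_def refl_r)
  assume ab: "(a, b) \<in> r"
  show "((\<lambda>(k, v). if k = 0 then Inl v else Inr v) (emb 0 1 a), (\<lambda>(k, v). if k = 0 then Inl v else Inr v) (emb 0 1 b)) \<in> r"
    using ab by (cases a; cases b) simp_all
  let ?R = "place 0 1 r \<union> place 1 2 strand_rel"
  have e: "((1, v), (2, v)) \<in> ?R\<^sup>*" "((2, v), (1, v)) \<in> ?R\<^sup>*" for v
    by (rule r_into_rtrancl, rule UnI2, rule strand_place)+
  have "(emb 0 2 c, emb 0 1 c) \<in> ?R\<^sup>*" "(emb 0 1 c, emb 0 2 c) \<in> ?R\<^sup>*" for c
    using e by (cases c; simp)+
  moreover have "(emb 0 1 a, emb 0 1 b) \<in> ?R\<^sup>*" by (rule r_into_rtrancl, rule UnI1, rule place_edge[OF ab])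
  ultimately show "(emb 0 2 a, emb 0 2 b) \<in> ?R\<^sup>*" by (meson rtrancl_trans)
next
  fix a :: "'a + 'a"
  show "(\<lambda>(k, v). if k = 0 then Inl v else Inr v) (emb 0 2 a) = a" by (cases a) simp_all
qed

text \<open>Equivalence relations on all of \<open>'v + 'v\<close>, not only on the points of one
  diagram: the monoid does not depend on the number of points, and all products exist.\<close>
typedef 'v partn = "{r :: ('v + 'v) rel. equiv UNIV r}" morphisms related Partn
  using strand_rel_equiv by blast

lemma related_equiv: "equiv UNIV (related d)"
  using related by blast

lemma related_Partn [simp]: "equiv UNIV r \<Longrightarrow> related (Partn r) = r"
  by (simp add: Partn_inverse)

instantiation partn :: (type) monoid_mult
begin
definition "1 = Partn strand_rel"
definition "d * e = Partn (stack_comp (related d) (related e))"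
instance
proof
  fix a b c :: "'a partn"
  show "a * b * c = a * (b * c)"
    by (simp add: times_partn_def stack_comp_equiv related_equiv stack_comp_assoc)
  show "1 * a = a" "a * 1 = a"
    by (simp_all add: one_partn_def times_partn_def strand_rel_equiv related_equiv strand_left strand_right related_inverse)
qed
end

lemma related_one: "related 1 = strand_rel"
  by (simp add: one_partn_def strand_rel_equiv)

lemma related_mult: "related (d * e) = stack_comp (related d) (related e)"
  by (simp add: times_partn_def stack_comp_equiv related_equiv)

section \<open>Matchings\<close>

definition matching :: "('v + 'v \<Rightarrow> 'v + 'v) \<Rightarrow> bool" where
  "matching f \<longleftrightarrow> (\<forall>u. f (f u) = u \<and> f u \<noteq> u)"

definition matching_rel :: "('v + 'v \<Rightarrow> 'v + 'v) \<Rightarrow> ('v + 'v) rel" where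
  "matching_rel f = {(u, v). v = u \<or> v = f u}"

definition matching_diagram :: "('v + 'v \<Rightarrow> 'v + 'v) \<Rightarrow> 'v partn" where
  "matching_diagram f = Partn (matching_rel f)"

lemma matching_rel_equiv: "matching f \<Longrightarrow> equiv UNIV (matching_rel f)"
  by (rule equivI) (auto simp: matching_rel_def matching_def refl_on_def sym_def trans_def)

lemma related_matching: "matching f \<Longrightarrow> related (matching_diagram f) = matching_rel f"
  by (simp add: matching_diagram_def matching_rel_equiv)

lemma matching_diagram_inj:
  assumes "matching f" "matching f'" "matching_diagram f = matching_diagram f'"
  shows "f = f'"
proof
  fix u
  have "(u, f u) \<in> matching_rel f'"
    using related_matching[OF assms(1)] related_matching[OF assms(2)] assms(3) by (auto simp: matching_rel_def)
  then show "f u = f' u" using assms(1) by (auto simp: matching_rel_def matching_def)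
qed

lemma matchingD: assumes "matching f" shows "f (f u) = u" "f u \<noteq> u" "f u = f v \<longleftrightarrow> u = v"
  using assms by (auto simp: matching_def) (metis assms matching_def)

definition strand :: "'v + 'v \<Rightarrow> 'v + 'v" where "strand = case_sum Inr Inl"

lemma strand_simps [simp]: "strand (Inl v) = Inr v" "strand (Inr v) = Inl v"
  by (simp_all add: strand_def)

lemma matching_strand: "matching strand"
  unfolding matching_def
proof
  show "strand (strand u) = u \<and> strand u \<noteq> u" for u :: "'a + 'a" by (cases u) simp_all
qed

lemma matching_diagram_strand: "matching_diagram strand = 1"
proof -
  have "(a, b) \<in> matching_rel strand \<longleftrightarrow> (a, b) \<in> strand_rel" for a b :: "'a + 'a"
    by (cases a; cases b) (auto simp: matching_rel_def strand_rel_def)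
  then have "matching_rel strand = (strand_rel :: ('a + 'a) rel)" by auto
  then show ?thesis by (simp add: matching_diagram_def one_partn_def)
qed

text \<open>The effect on a matching of a cup and a cap that join \<open>x\<close> and
  \<open>y\<close> below it: \<open>Inr x\<close> and \<open>Inr y\<close> become partners, and so
  do their former partners. If \<open>Inr x\<close> and \<open>Inr y\<close> were partners, nothing
  changes.\<close>
definition rejoin :: "'v \<Rightarrow> 'v \<Rightarrow> ('v + 'v \<Rightarrow> 'v + 'v) \<Rightarrow> 'v + 'v \<Rightarrow> 'v + 'v" where
  "rejoin x y f u = (if u = Inr x then Inr y else if u = Inr y then Inr x
    else if u = f (Inr x) then f (Inr y) else if u = f (Inr y) then f (Inr x) else f u)"

definition relabel :: "('v \<Rightarrow> 'v) \<Rightarrow> ('v + 'v \<Rightarrow> 'v + 'v) \<Rightarrow> 'v + 'v \<Rightarrow> 'v + 'v" where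
  "relabel p f u = map_sum id p (f (map_sum id (inverse_fun p) u))"

text \<open>Written as a conjugate by a transposition, the new map is visibly a fixed-point free
  involution again.\<close>
lemma rejoin_eq_conjugate:
  assumes f: "matching f" and xy: "x \<noteq> y"
  shows "rejoin x y f u = transpose (Inr y) (f (Inr x)) (f (transpose (Inr y) (f (Inr x)) u))"
proof -
  let ?t = "transpose (Inr y) (f (Inr x))"
  note F = matchingD[OF f]
  consider "u = Inr x" | "u = Inr y" | "u \<noteq> Inr x" "u \<noteq> Inr y" "u = f (Inr x)"
    | "u \<noteq> Inr x" "u \<noteq> Inr y" "u \<noteq> f (Inr x)" "u = f (Inr y)"
    | "u \<noteq> Inr x" "u \<noteq> Inr y" "u \<noteq> f (Inr x)" "u \<noteq> f (Inr y)" by blast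
  then show ?thesis
  proof cases
    case 1
    then show ?thesis using F(2)[of "Inr x"] xy by (simp add: rejoin_def transpose_def)
  next
    case 2
    then show ?thesis using F(1)[of "Inr x"] F(2)[of "Inr x"] xy by (simp add: rejoin_def)
  next
    case 3
    then show ?thesis using F(2)[of "Inr y"] F(3)[of "Inr y" "Inr x"] xy by (simp add: rejoin_def)
  next
    case 4
    then show ?thesis using F(1)[of "Inr y"] by (simp add: rejoin_def)
  next
    case 5
    then have "f u \<noteq> Inr y" "f u \<noteq> f (Inr x)" using F(1)[of u] F(3)[of u "Inr x"] by auto
    then show ?thesis using 5 by (simp add: rejoin_def)
  qed
qed

lemma matching_rejoin:
  assumes f: "matching f" and xy: "x \<noteq> y"
  shows "matching (rejoin x y f)"
  unfolding matching_def rejoin_eq_conjugate[OF assms]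
  using matchingD[OF f] by (metis transpose_involutory)

lemma map_sum_bij:
  assumes "bij p"
  shows "map_sum id p (map_sum id (inverse_fun p) u) = u" "map_sum id (inverse_fun p) (map_sum id p u) = u"
  using assms by (cases u; simp add: bij_def surj_f_inv_f)+

lemma matching_relabel:
  assumes f: "matching f" and p: "bij p"
  shows "matching (relabel p f)"
  unfolding matching_def relabel_def
  using matchingD[OF f] map_sum_bij[OF p] by metis

lemma matching_relD: "(a, b) \<in> matching_rel f \<Longrightarrow> b = a \<or> b = f a"
  by (simp add: matching_rel_def)

theorem matching_rejoin_mult:
  assumes f: "matching f" and xy: "x \<noteq> y"
  shows "matching_diagram f * matching_diagram (rejoin x y strand) = matching_diagram (rejoin x y f)"
proof -
  note F = matchingD[OF f]
  let ?h = "rejoin x y strand" and ?f' = "rejoin x y f"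
  have h: "matching ?h" by (rule matching_rejoin[OF matching_strand xy])
  have f': "matching ?f'" by (rule matching_rejoin[OF f xy])
  define mid where "mid v = (if v \<noteq> x \<and> v \<noteq> y then Inr v else if f (Inr x) = Inr y then Inr x
     else f (Inr v))" for v
  define \<pi> where "\<pi> = (\<lambda>(k :: nat, v). if k = 0 then Inl v else if k = 1 then mid v else Inr v)"
  let ?R = "place 0 1 (matching_rel f) \<union> place 1 2 (matching_rel ?h)"
  have h_simps: "?h (Inl z) = (if z = x then Inl y else if z = y then Inl x else Inr z)"
    "?h (Inr z) = (if z = x then Inr y else if z = y then Inr x else Inl z)" for z
    using xy by (auto simp: rejoin_def)
  have "stack_comp (matching_rel f) (matching_rel ?h) = matching_rel ?f'"
  proof (rule stack_comp_eqI[OF matching_rel_equiv[OF f'], where \<pi> = \<pi>])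
    fix a b :: "'a + 'a"
    have refl': "(c, c) \<in> matching_rel ?f'" for c by (simp add: matching_rel_def)
    have sym': "(c, d) \<in> matching_rel ?f' \<Longrightarrow> (d, c) \<in> matching_rel ?f'" for c d
      using matching_rel_equiv[OF f'] by (meson equivE symE)
    define \<theta> where "\<theta> u = \<pi> (emb 0 1 u)" for u
    have \<theta>: "\<theta> u = (if u = Inr x \<or> u = Inr y then (if f (Inr x) = Inr y then Inr x else f u) else u)" for u
      by (cases u) (auto simp: \<theta>_def \<pi>_def mid_def)
    show "(\<pi> (emb 0 1 a), \<pi> (emb 0 1 b)) \<in> matching_rel ?f'" if ab: "(a, b) \<in> matching_rel f"
    proof (cases "b = a")
      case False
      then have b: "b = f a" using matching_relD[OF ab] by simp
      have "(\<theta> a, \<theta> (f a)) \<in> matching_rel ?f'"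
      proof (cases "f (Inr x) = Inr y")
        case True
        then have "f (Inr y) = Inr x" using F(1)[of "Inr x"] by simp
        then show ?thesis using True F(1)[of a]
          by (cases "a = Inr x \<or> a = Inr y") (auto simp: \<theta> matching_rel_def rejoin_def)
      next
        case False
        then have "f (Inr y) \<noteq> Inr x" using F(1)[of "Inr y"] by auto
        consider "a = Inr x \<or> a = Inr y" | "f a = Inr x \<or> f a = Inr y"
          | "a \<noteq> Inr x" "a \<noteq> Inr y" "f a \<noteq> Inr x" "f a \<noteq> Inr y" by blast
        then show ?thesis
        proof cases
          case 1
          then have "\<theta> a = f a" "\<theta> (f a) = f a"
            using False \<open>f (Inr y) \<noteq> Inr x\<close> F(2)[of "Inr x"] F(2)[of "Inr y"] by (auto simp: \<theta>)
          then show ?thesis by (simp add: refl')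
        next
          case 2
          then have "a = f (Inr x) \<or> a = f (Inr y)" using F(1)[of a] by auto
          then have "\<theta> a = a" "\<theta> (f a) = a"
            using 2 False \<open>f (Inr y) \<noteq> Inr x\<close> F(2)[of "Inr x"] F(2)[of "Inr y"] F(1)[of a] by (auto simp: \<theta>)
          then show ?thesis by (simp add: refl')
        next
          case 3
          then have "\<theta> a = a" "\<theta> (f a) = f a" by (auto simp: \<theta>)
          moreover have "?f' a = f a" using 3 F(1)[of "Inr x"] F(1)[of "Inr y"] by (auto simp: rejoin_def)
          ultimately show ?thesis by (simp add: matching_rel_def)
        qed
      qed
      then show ?thesis by (simp add: b \<theta>_def)
    qed (simp add: refl')
    show "(\<pi> (emb 1 2 a), \<pi> (emb 1 2 b)) \<in> matching_rel ?f'" if ab: "(a, b) \<in> matching_rel ?h"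
    proof (cases "b = a")
      case False
      then have b: "b = ?h a" using matching_relD[OF ab] by simp
      have "(mid x, mid y) \<in> matching_rel ?f'"
        using F(2)[of "Inr x"] F(3)[of "Inr x" "Inr y"] F(1)[of "Inr y"] F(2)[of "Inr y"] xy
        by (auto simp: mid_def matching_rel_def rejoin_def)
      note mids = this sym'[OF this]
      have "(Inr x, Inr y) \<in> matching_rel ?f'" by (simp add: matching_rel_def rejoin_def)
      note bots = this sym'[OF this]
      have "mid z = Inr z" if "z \<noteq> x" "z \<noteq> y" for z using that by (simp add: mid_def)
      then show ?thesis unfolding b using mids bots
        by (cases a) (simp_all add: h_simps \<pi>_def refl')
    qed (simp add: refl')
    show "\<pi> (emb 0 2 a) = a" by (cases a) (simp_all add: \<pi>_def)
    show "(emb 0 2 a, emb 0 2 b) \<in> ?R\<^sup>*" if ab: "(a, b) \<in> matching_rel ?f'"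
    proof (cases "b = a")
      case False
      then have b: "b = ?f' a" using matching_relD[OF ab] by simp
      have f_edge: "(emb 0 1 c, emb 0 1 (f c)) \<in> ?R\<^sup>*" for c
        by (rule r_into_rtrancl, rule UnI1, rule place_edge) (simp add: matching_rel_def)
      have h_edge: "(emb 1 2 c, emb 1 2 (?h c)) \<in> ?R\<^sup>*" for c
        by (rule r_into_rtrancl, rule UnI2, rule place_edge) (simp add: matching_rel_def)
      have out: "(emb 0 2 c, emb 0 1 c) \<in> ?R\<^sup>*" "(emb 0 1 c, emb 0 2 c) \<in> ?R\<^sup>*"
        if "c \<noteq> Inr x" "c \<noteq> Inr y" for c
        using that h_edge[of "Inl (projr c)"] h_edge[of "Inr (projr c)"]
        by (cases c; auto simp: h_simps)+
      have mid_edge: "((1, x), (1, y)) \<in> ?R\<^sup>*" "((1, y), (1, x)) \<in> ?R\<^sup>*"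
        using h_edge[of "Inl x"] h_edge[of "Inl y"] xy by (simp_all add: h_simps)
      have via: "(emb 0 2 (f (Inr v)), emb 0 2 (f (Inr w))) \<in> ?R\<^sup>*"
        if "((1, v), (1, w)) \<in> ?R\<^sup>*" "f (Inr v) \<noteq> Inr x" "f (Inr v) \<noteq> Inr y" "f (Inr w) \<noteq> Inr x" "f (Inr w) \<noteq> Inr y" for v w
        using out(1)[of "f (Inr v)"] out(2)[of "f (Inr w)"] f_edge[of "f (Inr v)"] f_edge[of "Inr w"] that F(1)
        by simp
      consider "a = Inr x" | "a = Inr y" | "a \<noteq> Inr x" "a \<noteq> Inr y" "a = f (Inr x) \<or> a = f (Inr y)"
        | "a \<noteq> Inr x" "a \<noteq> Inr y" "a \<noteq> f (Inr x)" "a \<noteq> f (Inr y)" by blast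
      then show ?thesis
      proof cases
        case 1
        then show ?thesis using h_edge[of "Inr x"] by (simp add: b h_simps rejoin_def)
      next
        case 2
        then show ?thesis using h_edge[of "Inr y"] xy by (simp add: b h_simps rejoin_def)
      next
        case 3
        then have "f (Inr x) \<noteq> Inr y" "f (Inr y) \<noteq> Inr x" using F(1)[of "Inr x"] F(1)[of "Inr y"] by auto
        then show ?thesis
          using 3 via[OF mid_edge(1)] via[OF mid_edge(2)] F(2)[of "Inr x"] F(2)[of "Inr y"] F(3)[of "Inr x" "Inr y"] xy
          by (auto simp: b rejoin_def)
      next
        case 4
        then have "f a \<noteq> Inr x" "f a \<noteq> Inr y" "?f' a = f a" using F(1)[of a] by (auto simp: rejoin_def)
        then show ?thesis using out(1)[of a] f_edge[of a] out(2)[of "f a"] 4 unfolding b by simp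
      qed
    qed simp
  qed
  then show ?thesis
    by (simp add: times_partn_def related_matching[OF f] related_matching[OF h]) (simp add: matching_diagram_def)
qed

theorem matching_relabel_mult:
  assumes f: "matching f" and p: "bij p"
  shows "matching_diagram f * matching_diagram (relabel p strand) = matching_diagram (relabel p f)"
proof -
  note F = matchingD[OF f] and P = map_sum_bij[OF p]
  let ?h = "relabel p strand" and ?f' = "relabel p f"
  have h: "matching ?h" by (rule matching_relabel[OF matching_strand p])
  have f': "matching ?f'" by (rule matching_relabel[OF f p])
  define \<pi> where "\<pi> = (\<lambda>(k :: nat, v). if k = 0 then Inl v else if k = 1 then Inr (p v) else Inr v)"
  let ?R = "place 0 1 (matching_rel f) \<union> place 1 2 (matching_rel ?h)"
  have ip: "inverse_fun p (p z) = z" "p (inverse_fun p z) = z" for z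
    using p by (auto simp: bij_def surj_f_inv_f)
  have h_simps: "?h (Inl z) = Inr (p z)" "?h (Inr z) = Inl (inverse_fun p z)" for z
    by (simp_all add: relabel_def)
  have \<pi>_top: "\<pi> (emb 0 1 a) = map_sum id p a" for a by (cases a) (simp_all add: \<pi>_def)
  have "stack_comp (matching_rel f) (matching_rel ?h) = matching_rel ?f'"
  proof (rule stack_comp_eqI[OF matching_rel_equiv[OF f'], where \<pi> = \<pi>])
    fix a b :: "'a + 'a"
    show "(\<pi> (emb 0 1 a), \<pi> (emb 0 1 b)) \<in> matching_rel ?f'" if "(a, b) \<in> matching_rel f"
      unfolding \<pi>_top using matching_relD[OF that] by (auto simp: matching_rel_def relabel_def P)
    show "(\<pi> (emb 1 2 a), \<pi> (emb 1 2 b)) \<in> matching_rel ?f'" if "(a, b) \<in> matching_rel ?h"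
      using matching_relD[OF that] by (cases a) (auto simp: matching_rel_def h_simps \<pi>_def ip)
    show "\<pi> (emb 0 2 a) = a" by (cases a) (simp_all add: \<pi>_def)
    have h_edge: "(emb 1 2 c, emb 1 2 (?h c)) \<in> ?R\<^sup>*" for c
      by (rule r_into_rtrancl, rule UnI2, rule place_edge) (simp add: matching_rel_def)
    have out: "(emb 0 2 (map_sum id p c), emb 0 1 c) \<in> ?R\<^sup>*" "(emb 0 1 c, emb 0 2 (map_sum id p c)) \<in> ?R\<^sup>*" for c
      using h_edge[of "Inl (projr c)"] h_edge[of "Inr (p (projr c))"] by (cases c; auto simp: h_simps ip)+
    show "(emb 0 2 a, emb 0 2 b) \<in> ?R\<^sup>*" if ab: "(a, b) \<in> matching_rel ?f'"
    proof (cases "b = a")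
      case False
      define c where "c = map_sum id (inverse_fun p) a"
      have "b = map_sum id p (f c)" "a = map_sum id p c"
        using matching_relD[OF ab] False by (simp_all add: relabel_def c_def P)
      moreover have "(emb 0 1 c, emb 0 1 (f c)) \<in> ?R\<^sup>*"
        by (rule r_into_rtrancl, rule UnI1, rule place_edge) (simp add: matching_rel_def)
      ultimately show ?thesis using out(1)[of c] out(2)[of "f c"] by (meson rtrancl_trans)
    qed simp
  qed
  then show ?thesis
    by (simp add: times_partn_def related_matching[OF f] related_matching[OF h]) (simp add: matching_diagram_def)
qed

section \<open>Relations between diagrams\<close>

definition perm_part :: "('v \<Rightarrow> 'v) \<Rightarrow> 'v partn" where
  "perm_part p = matching_diagram (relabel p strand)"

text \<open>Cups and caps without symmetry are the simplest elements with which a matching can be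
  multiplied; the symmetric hooks are single ones or products of two commuting ones.\<close>
definition cup_cap :: "'v \<Rightarrow> 'v \<Rightarrow> 'v partn" where
  "cup_cap x y = matching_diagram (rejoin x y strand)"

lemma relabel_comp:
  assumes "bij p" "bij q" shows "relabel q (relabel p f) = relabel (q \<circ> p) f"
proof
  fix u
  have "inverse_fun (q \<circ> p) = inverse_fun p \<circ> inverse_fun q" by (simp add: o_inv_distrib assms)
  then show "relabel q (relabel p f) u = relabel (q \<circ> p) f u"
    by (cases u) (simp_all add: relabel_def sum.map_comp)
qed

lemma relabel_rejoin:
  assumes p: "bij p"
  shows "relabel p (rejoin x y f) = rejoin (p x) (p y) (relabel p f)"
proof
  fix u :: "'a + 'a"
  have inj: "map_sum id p a = map_sum id p b \<longleftrightarrow> a = b" for a b :: "'a + 'a"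
    using p by (cases a; cases b) (auto simp: bij_def inj_eq)
  define w where "w = map_sum id (inverse_fun p) u"
  have u: "u = map_sum id p w" by (simp add: w_def map_sum_bij[OF p])
  have R: "relabel p g (map_sum id p w) = map_sum id p (g w)" for g w
    by (simp add: relabel_def map_sum_bij[OF p])
  have R': "relabel p g (Inr (p z)) = map_sum id p (g (Inr z))" for g z
    using R[of g "Inr z"] by simp
  show "relabel p (rejoin x y f) u = rejoin (p x) (p y) (relabel p f) u"
    unfolding u R rejoin_def R'
    using inj[of w "Inr x"] inj[of w "Inr y"] inj[of w "f (Inr x)"] inj[of w "f (Inr y)"] by simp
qed

lemma perm_part_mult:
  assumes "bij p" "bij q" shows "perm_part p * perm_part q = perm_part (q \<circ> p)"
  unfolding perm_part_def matching_relabel_mult[OF matching_relabel[OF matching_strand assms(1)] assms(2)]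
  by (simp only: relabel_comp[OF assms])

lemma perm_part_id: "perm_part id = 1"
proof -
  have "relabel id strand = (strand :: 'a + 'a \<Rightarrow> _)" by (simp add: relabel_def fun_eq_iff sum.map_id)
  then show ?thesis by (simp add: perm_part_def matching_diagram_strand)
qed

lemma cup_cap_move:
  assumes "bij p" "x \<noteq> y"
  shows "cup_cap x y * perm_part p = perm_part p * cup_cap (p x) (p y)"
proof -
  have "p x \<noteq> p y" using assms by (auto simp: bij_def inj_eq)
  then show ?thesis
    unfolding cup_cap_def perm_part_def
    by (simp add: matching_relabel_mult matching_rejoin_mult matching_relabel matching_rejoin matching_strand assms relabel_rejoin)
qed

lemma rejoin_strand:
  assumes "x \<noteq> y"
  shows "rejoin x y strand (Inl z) = (if z = x then Inl y else if z = y then Inl x else Inr z)"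
    "rejoin x y strand (Inr z) = (if z = x then Inr y else if z = y then Inr x else Inl z)"
  using assms by (auto simp: rejoin_def)

lemma cup_cap_mult:
  assumes "x \<noteq> y" "z \<noteq> w"
  shows "cup_cap x y * cup_cap z w = matching_diagram (rejoin z w (rejoin x y strand))"
  unfolding cup_cap_def by (rule matching_rejoin_mult[OF matching_rejoin[OF matching_strand assms(1)] assms(2)])

lemma matching_fun_eqI: "(\<And>z. f (Inl z) = g (Inl z)) \<Longrightarrow> (\<And>z. f (Inr z) = g (Inr z)) \<Longrightarrow> f = g"
  by (rule ext) (metis sum.exhaust)

lemma cup_cap_sym: assumes "x \<noteq> y" shows "cup_cap y x = cup_cap x y"
proof -
  have "rejoin y x strand = rejoin x y strand"
    by (rule matching_fun_eqI) (use assms in \<open>auto simp: rejoin_strand\<close>)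
  then show ?thesis by (simp add: cup_cap_def)
qed

lemma cup_cap_idem: assumes "x \<noteq> y" shows "cup_cap x y * cup_cap x y = cup_cap x y"
proof -
  have "rejoin x y (rejoin x y strand) = rejoin x y strand"
    by (rule matching_fun_eqI) (use assms in \<open>auto simp: rejoin_def\<close>)
  then show ?thesis by (simp add: cup_cap_mult[OF assms assms]) (simp add: cup_cap_def)
qed

lemma cup_cap_commute:
  assumes "x \<noteq> y" "z \<noteq> w" "x \<noteq> z" "x \<noteq> w" "y \<noteq> z" "y \<noteq> w"
  shows "cup_cap x y * cup_cap z w = cup_cap z w * cup_cap x y"
proof -
  have "rejoin z w (rejoin x y strand) = rejoin x y (rejoin z w strand)"
    by (rule matching_fun_eqI) (use assms in \<open>auto simp: rejoin_def\<close>)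
  then show ?thesis by (simp add: cup_cap_mult assms)
qed

lemma cup_cap_transpose:
  assumes "x \<noteq> y" shows "cup_cap x y * perm_part (transpose x y) = cup_cap x y"
proof -
  have "relabel (transpose x y) (rejoin x y strand) = rejoin x y strand"
    by (rule matching_fun_eqI) (use assms in \<open>auto simp: relabel_def rejoin_strand transpose_def\<close>)
  then show ?thesis
    unfolding cup_cap_def perm_part_def
    by (simp add: matching_relabel_mult matching_rejoin[OF matching_strand assms])
qed

lemma cup_cap_adjacent:
  assumes "x \<noteq> y" "y \<noteq> z" "x \<noteq> z"
  shows "cup_cap x y * cup_cap y z = cup_cap x y * perm_part (transpose x z)"
proof -
  have "relabel (transpose x z) (rejoin x y strand) = rejoin y z (rejoin x y strand)"
  proof (rule matching_fun_eqI)
    fix v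
    show "relabel (transpose x z) (rejoin x y strand) (Inl v) = rejoin y z (rejoin x y strand) (Inl v)"
      using assms by (auto simp: relabel_def rejoin_strand transpose_def rejoin_def[of y z])
    show "relabel (transpose x z) (rejoin x y strand) (Inr v) = rejoin y z (rejoin x y strand) (Inr v)"
      using assms by (auto simp: relabel_def rejoin_strand transpose_def rejoin_def[of y z])
  qed
  then show ?thesis
    using cup_cap_mult[OF assms(1,2)] unfolding cup_cap_def perm_part_def
    by (simp add: matching_relabel_mult matching_rejoin[OF matching_strand assms(1)])
qed

lemma perm_part_transpose_square: "perm_part (transpose x y) * perm_part (transpose x y) = 1"
  by (simp add: perm_part_mult perm_part_id)

lemma cup_cap_adjacent':
  assumes "x \<noteq> y" "y \<noteq> z" "x \<noteq> z"
  shows "cup_cap x y * cup_cap y z = perm_part (transpose x z) * cup_cap y z"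
  using cup_cap_adjacent[OF assms] cup_cap_move[of "transpose x z" x y] cup_cap_sym[of y z] assms by simp

text \<open>A strand that turns back and forth straightens out.\<close>
lemma cup_cap_zigzag:
  assumes "x \<noteq> y" "y \<noteq> z" "x \<noteq> z"
  shows "cup_cap x y * cup_cap y z * cup_cap x y = cup_cap x y"
proof -
  have "cup_cap x y * cup_cap y z * cup_cap x y = perm_part (transpose x z) * (cup_cap z y * cup_cap y x)"
    using cup_cap_adjacent'[OF assms] cup_cap_sym assms by (metis mult.assoc)
  also have "\<dots> = perm_part (transpose x z) * perm_part (transpose x z) * cup_cap x y"
    using cup_cap_adjacent'[of z y x] cup_cap_sym[of x y] assms by (simp add: transpose_commute mult.assoc)
  finally show ?thesis by (simp add: perm_part_transpose_square)
qed

definition hook_part :: "int \<Rightarrow> int \<Rightarrow> int partn" where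
  "hook_part x y = (if y = - x then cup_cap x y else cup_cap x y * cup_cap (- x) (- y))"

fun letter_part :: "letter \<Rightarrow> int partn" where
  "letter_part (S i) = perm_part (s_perm i)"
| "letter_part (H i) = (if i = 0 then hook_part 1 (- 1) else hook_part (int i) (int i + 1))"

lemma hook_part_pair_commute:
  fixes x y :: int
  assumes "x \<noteq> 0" "y \<noteq> 0" "x \<noteq> y" "y \<noteq> - x"
  shows "cup_cap (- x) (- y) * cup_cap x y = cup_cap x y * cup_cap (- x) (- y)"
  using assms by (intro cup_cap_commute) auto

lemma hook_part_move:
  assumes g: "signed_perm m g" and xy: "x \<noteq> y"
  shows "hook_part x y * perm_part g = perm_part g * hook_part (g x) (g y)"
proof (cases "y = - x")
  case True
  then show ?thesis
    using cup_cap_move[OF signed_perm_bij[OF g] xy] signed_perm_uminus[OF g] by (simp add: hook_part_def)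
next
  case False
  then have "g y \<noteq> - g x" using signed_perm_inj[OF g, of y "- x"] signed_perm_uminus[OF g] by simp
  moreover have "cup_cap x y * cup_cap (- x) (- y) * perm_part g
      = perm_part g * (cup_cap (g x) (g y) * cup_cap (g (- x)) (g (- y)))"
    using cup_cap_move[OF signed_perm_bij[OF g] xy] cup_cap_move[OF signed_perm_bij[OF g], of "- x" "- y"] xy
    by (simp add: mult.assoc) (simp flip: mult.assoc)
  ultimately show ?thesis using False signed_perm_uminus[OF g] by (simp add: hook_part_def)
qed

lemma hook_part_sym: assumes "x \<noteq> y" shows "hook_part y x = hook_part x y"
  using assms cup_cap_sym[of x y] cup_cap_sym[of "- x" "- y"] by (auto simp: hook_part_def)

lemma hook_part_uminus:
  assumes "x \<noteq> 0" "y \<noteq> 0" "x \<noteq> y" shows "hook_part (- x) (- y) = hook_part x y"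
  using hook_part_pair_commute[OF assms] cup_cap_sym[of x "- x"] assms by (auto simp: hook_part_def)

lemma commuting_idem_mult:
  fixes a :: "'m::monoid_mult"
  assumes "a * a = a" "b * b = b" "b * a = a * b" shows "a * b * (a * b) = a * b"
proof -
  have "a * b * (a * b) = a * (b * a) * b" by (simp add: mult.assoc)
  also have "\<dots> = a * a * (b * b)" by (simp only: assms(3) mult.assoc)
  finally show ?thesis by (simp add: assms)
qed

lemma hook_part_idem:
  assumes "x \<noteq> 0" "y \<noteq> 0" "x \<noteq> y" shows "hook_part x y * hook_part x y = hook_part x y"
  using hook_part_pair_commute[OF assms] assms
  by (auto simp: hook_part_def cup_cap_idem intro!: commuting_idem_mult)

lemma hook_part_commute:
  assumes "x \<noteq> y" "z \<noteq> w" "\<bar>x\<bar> \<noteq> \<bar>z\<bar>" "\<bar>x\<bar> \<noteq> \<bar>w\<bar>" "\<bar>y\<bar> \<noteq> \<bar>z\<bar>" "\<bar>y\<bar> \<noteq> \<bar>w\<bar>"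
  shows "hook_part x y * hook_part z w = hook_part z w * hook_part x y"
proof -
  have ne: "x \<noteq> z" "x \<noteq> - z" "- x \<noteq> z" "x \<noteq> w" "x \<noteq> - w" "- x \<noteq> w" "y \<noteq> z" "y \<noteq> - z" "- y \<noteq> z" "y \<noteq> w" "y \<noteq> - w" "- y \<noteq> w"
    using assms(3-) by auto
  have c: "hook_part x y * cup_cap z w = cup_cap z w * hook_part x y"
    "hook_part x y * cup_cap (- z) (- w) = cup_cap (- z) (- w) * hook_part x y"
    unfolding hook_part_def using assms(1,2) ne by (auto intro!: commute_mult cup_cap_commute)
  have "hook_part z w * hook_part x y = hook_part x y * hook_part z w"
    unfolding hook_part_def[of z w] using c by (auto intro!: commute_mult)
  then show ?thesis by simp
qed

lemma hook_part_adjacent: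
  assumes "x \<noteq> 0" "y \<noteq> 0" "z \<noteq> 0" "\<bar>x\<bar> \<noteq> \<bar>y\<bar>" "\<bar>x\<bar> \<noteq> \<bar>z\<bar>" "\<bar>y\<bar> \<noteq> \<bar>z\<bar>"
  shows "hook_part x y * hook_part y z = hook_part x y * perm_part (signed_transp x z)"
proof -
  have ne: "x \<noteq> y" "x \<noteq> - y" "y \<noteq> z" "y \<noteq> - z" "x \<noteq> z" "x \<noteq> - z" "- x \<noteq> y" "- y \<noteq> z" "- x \<noteq> z"
    using assms(4-) by auto
  let ?t = "transpose x z" and ?t' = "transpose (- x) (- z)"
  have "hook_part x y * hook_part y z = cup_cap x y * (cup_cap (- x) (- y) * cup_cap y z) * cup_cap (- y) (- z)"
    using ne by (simp add: hook_part_def mult.assoc)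
  also have "cup_cap (- x) (- y) * cup_cap y z = cup_cap y z * cup_cap (- x) (- y)"
    using ne assms(1-3) by (intro cup_cap_commute) auto
  also have "cup_cap x y * (cup_cap y z * cup_cap (- x) (- y)) * cup_cap (- y) (- z)
      = (cup_cap x y * cup_cap y z) * (cup_cap (- x) (- y) * cup_cap (- y) (- z))"
    by (simp add: mult.assoc)
  also have "\<dots> = cup_cap x y * (perm_part ?t * cup_cap (- x) (- y)) * perm_part ?t'"
    using ne by (simp add: cup_cap_adjacent mult.assoc)
  also have "perm_part ?t * cup_cap (- x) (- y) = cup_cap (- x) (- y) * perm_part ?t"
    using cup_cap_move[of ?t "- x" "- y"] ne assms(1-3) by (auto simp: transpose_def split: if_splits)
  also have "cup_cap x y * (cup_cap (- x) (- y) * perm_part ?t) * perm_part ?t'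
      = hook_part x y * perm_part (?t' \<circ> ?t)"
    using ne by (simp add: hook_part_def mult.assoc perm_part_mult)
  also have "?t' \<circ> ?t = signed_transp x z"
    using ne assms(1-3) by (auto simp: signed_transp_def transpose_def fun_eq_iff)
  finally show ?thesis .
qed

lemma s_perm_bij: "bij (s_perm i)"
  using s_perm_signed[of i "Suc i"] by (simp add: signed_perm_bij)

lemma s_perm_eq_iff: "s_perm i x = s_perm i y \<longleftrightarrow> x = y"
  by (metis s_perm_involution)

lemma hook_part_s:
  assumes "x \<noteq> y"
  shows "hook_part x y * perm_part (s_perm i) = perm_part (s_perm i) * hook_part (s_perm i x) (s_perm i y)"
    "hook_part x y * (perm_part (s_perm i) * c) = perm_part (s_perm i) * (hook_part (s_perm i x) (s_perm i y) * c)"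
proof -
  show 1: "hook_part x y * perm_part (s_perm i) = perm_part (s_perm i) * hook_part (s_perm i x) (s_perm i y)"
    using assms by (intro hook_part_move[OF s_perm_signed[of i "Suc i"]]) auto
  show "hook_part x y * (perm_part (s_perm i) * c) = perm_part (s_perm i) * (hook_part (s_perm i x) (s_perm i y) * c)"
    unfolding mult.assoc[symmetric] 1 ..
qed

lemma perm_part_square: "perm_part (s_perm i) * perm_part (s_perm i) = 1"
    "perm_part (s_perm i) * (perm_part (s_perm i) * c) = c"
proof -
  have "s_perm i \<circ> s_perm i = id" by (simp add: fun_eq_iff s_perm_involution)
  then show 1: "perm_part (s_perm i) * perm_part (s_perm i) = 1"
    by (simp add: perm_part_mult s_perm_bij perm_part_id)
  show "perm_part (s_perm i) * (perm_part (s_perm i) * c) = c"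
    unfolding mult.assoc[symmetric] 1 by simp
qed

lemma hook_part_absorb:
  assumes "0 < i" shows "hook_part (int i) (int i + 1) * perm_part (s_perm i) = hook_part (int i) (int i + 1)"
proof -
  let ?t = "transpose (int i) (int i + 1)" and ?t' = "transpose (- int i) (- (int i + 1))"
  have s: "s_perm i = ?t' \<circ> ?t"
    using assms by (auto simp: s_perm_apply transpose_def fun_eq_iff)
  have "perm_part ?t * cup_cap (- int i) (- (int i + 1)) = cup_cap (- int i) (- (int i + 1)) * perm_part ?t"
    using cup_cap_move[of ?t "- int i" "- (int i + 1)"] assms by (simp add: transpose_def split: if_splits)
  then have "cup_cap (int i) (int i + 1) * cup_cap (- int i) (- (int i + 1)) * (perm_part ?t * perm_part ?t')
    = (cup_cap (int i) (int i + 1) * perm_part ?t) * (cup_cap (- int i) (- (int i + 1)) * perm_part ?t')"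
    by (simp add: mult.assoc) (simp flip: mult.assoc)
  then show ?thesis
    using assms by (simp add: s hook_part_def cup_cap_transpose flip: perm_part_mult)
qed

lemma hook_part_absorb0: "hook_part 1 (- 1) * perm_part (s_perm 0) = hook_part 1 (- 1)"
  by (simp add: hook_part_def s_perm_def cup_cap_transpose)

lemma perm_part_triple:
  assumes "0 < i"
  shows "perm_part (signed_transp (int i) (int i + 2)) = perm_part (s_perm i) * (perm_part (s_perm (Suc i)) * perm_part (s_perm i))"
    "perm_part (signed_transp (int i) (int i + 2)) = perm_part (s_perm (Suc i)) * (perm_part (s_perm i) * perm_part (s_perm (Suc i)))"
proof -
  have "s_perm i (s_perm (Suc i) (s_perm i x)) = signed_transp (int i) (int i + 2) x" for x
  proof -
    define a b c where "a = int i" and "b = int i + 1" and "c = int i + 2"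
    have i: "s_perm i a = b" "s_perm i b = a" "s_perm i c = c"
      "s_perm i (- a) = - b" "s_perm i (- b) = - a" "s_perm i (- c) = - c"
      and Suc_i: "s_perm (Suc i) a = a" "s_perm (Suc i) b = c" "s_perm (Suc i) c = b"
      "s_perm (Suc i) (- a) = - a" "s_perm (Suc i) (- b) = - c" "s_perm (Suc i) (- c) = - b"
      and pos: "0 < a" "a < b" "b < c"
      using assms by (simp_all add: a_def b_def c_def s_perm_apply)
    have far: "s_perm i x = x" "s_perm (Suc i) x = x" if "\<bar>x\<bar> \<noteq> a" "\<bar>x\<bar> \<noteq> b" "\<bar>x\<bar> \<noteq> c"
      using that by (auto intro!: s_perm_far simp: a_def b_def c_def)
    have "s_perm i (s_perm (Suc i) (s_perm i x)) = signed_transp a c x"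
    proof -
      consider "\<bar>x\<bar> \<noteq> a" "\<bar>x\<bar> \<noteq> b" "\<bar>x\<bar> \<noteq> c" | "x = a" | "x = b" | "x = c" | "x = - a" | "x = - b" | "x = - c"
        by linarith
      then show ?thesis
      proof cases
        case 1
        then show ?thesis using far[OF 1] pos signed_transp_outside[of x a c] by simp
      qed (use pos in \<open>simp_all add: i Suc_i signed_transp_def transpose_def\<close>)
    qed
    then show ?thesis by (simp add: a_def c_def)
  qed
  then have 1: "s_perm i \<circ> (s_perm (Suc i) \<circ> s_perm i) = signed_transp (int i) (int i + 2)"
    by (auto simp: fun_eq_iff)
  then have 2: "s_perm (Suc i) \<circ> (s_perm i \<circ> s_perm (Suc i)) = signed_transp (int i) (int i + 2)"
    using s_perm_braid3[OF assms] by (simp add: fun_eq_iff)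
  show "perm_part (signed_transp (int i) (int i + 2)) = perm_part (s_perm i) * (perm_part (s_perm (Suc i)) * perm_part (s_perm i))"
    unfolding 1[symmetric] by (simp add: perm_part_mult s_perm_bij bij_comp comp_assoc)
  show "perm_part (signed_transp (int i) (int i + 2)) = perm_part (s_perm (Suc i)) * (perm_part (s_perm i) * perm_part (s_perm (Suc i)))"
    unfolding 2[symmetric] by (simp add: perm_part_mult s_perm_bij bij_comp comp_assoc)
qed

lemma signed_transp_sym: "x \<noteq> 0 \<Longrightarrow> y \<noteq> 0 \<Longrightarrow> signed_transp y x = signed_transp x y"
  by (auto simp: signed_transp_def transpose_commute fun_eq_iff)

lemma hook_part_up:
  assumes "0 < i"
  shows "hook_part (int i) (int i + 1) * hook_part (int i + 1) (int i + 2)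
    = hook_part (int i) (int i + 1) * (perm_part (s_perm (Suc i)) * perm_part (s_perm i))"
proof -
  have "hook_part (int i) (int i + 1) * hook_part (int i + 1) (int i + 2)
      = (hook_part (int i) (int i + 1) * perm_part (s_perm i)) * (perm_part (s_perm (Suc i)) * perm_part (s_perm i))"
    using hook_part_adjacent[of "int i" "int i + 1" "int i + 2"] assms
    by (simp add: perm_part_triple(1) mult.assoc)
  then show ?thesis by (simp only: hook_part_absorb[OF assms])
qed

lemma hook_part_down:
  assumes "0 < i"
  shows "hook_part (int i + 1) (int i + 2) * hook_part (int i) (int i + 1)
    = hook_part (int i + 1) (int i + 2) * (perm_part (s_perm i) * perm_part (s_perm (Suc i)))"
proof -
  have "hook_part (int i + 1) (int i + 2) * hook_part (int i) (int i + 1)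
      = hook_part (int i + 2) (int i + 1) * hook_part (int i + 1) (int i)"
    using hook_part_sym[of "int i + 1" "int i + 2"] hook_part_sym[of "int i" "int i + 1"] by simp
  also have "\<dots> = hook_part (int i + 1) (int i + 2) * perm_part (signed_transp (int i) (int i + 2))"
    using hook_part_adjacent[of "int i + 2" "int i + 1" "int i"] assms
      hook_part_sym[of "int i + 1" "int i + 2"] signed_transp_sym[of "int i" "int i + 2"] by simp
  also have "\<dots> = (hook_part (int i + 1) (int i + 2) * perm_part (s_perm (Suc i))) * (perm_part (s_perm i) * perm_part (s_perm (Suc i)))"
    using assms by (simp add: perm_part_triple(2) mult.assoc)
  also have "hook_part (int i + 1) (int i + 2) * perm_part (s_perm (Suc i)) = hook_part (int i + 1) (int i + 2)"
    using hook_part_absorb[of "Suc i"] by (simp add: add.commute)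
  finally show ?thesis .
qed

text \<open>The relations with indices 0 and 1 alone involve no points except 1, 2 and their
  negatives. Two matchings that arise from such words are compared at these four points and at one
  other.\<close>
lemma five_points:
  fixes z :: int
  obtains "z = 1" | "z = - 1" | "z = 2" | "z = - 2" | "z \<noteq> 1" "z \<noteq> - 1" "z \<noteq> 2" "z \<noteq> - 2"
  by blast

lemma rejoin_pair_single:
  "rejoin 1 (- 1) (rejoin (- 1) (- 2) (rejoin 1 2 strand)) = rejoin 2 (- 2 :: int) (rejoin (- 1) (- 2) (rejoin 1 2 strand))"
proof (rule matching_fun_eqI)
  fix z :: int
  show "rejoin 1 (- 1) (rejoin (- 1) (- 2) (rejoin 1 2 strand)) (Inl z) = rejoin 2 (- 2) (rejoin (- 1) (- 2) (rejoin 1 2 strand)) (Inl z)"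
    by (rule five_points[of z]) (simp_all add: rejoin_def)
  show "rejoin 1 (- 1) (rejoin (- 1) (- 2) (rejoin 1 2 strand)) (Inr z) = rejoin 2 (- 2) (rejoin (- 1) (- 2) (rejoin 1 2 strand)) (Inr z)"
    by (rule five_points[of z]) (simp_all add: rejoin_def)
qed

lemma rejoin_single_pair:
  "rejoin (- 1) (- 2) (rejoin 1 2 (rejoin 1 (- 1) strand)) = rejoin (- 1) (- 2 :: int) (rejoin 1 2 (rejoin 2 (- 2) strand))"
proof (rule matching_fun_eqI)
  fix z :: int
  show "rejoin (- 1) (- 2) (rejoin 1 2 (rejoin 1 (- 1) strand)) (Inl z) = rejoin (- 1) (- 2) (rejoin 1 2 (rejoin 2 (- 2) strand)) (Inl z)"
    by (rule five_points[of z]) (simp_all add: rejoin_def)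
  show "rejoin (- 1) (- 2) (rejoin 1 2 (rejoin 1 (- 1) strand)) (Inr z) = rejoin (- 1) (- 2) (rejoin 1 2 (rejoin 2 (- 2) strand)) (Inr z)"
    by (rule five_points[of z]) (simp_all add: rejoin_def)
qed

lemma rejoin_single_pair_single:
  "rejoin 1 (- 1) (rejoin (- 1) (- 2) (rejoin 1 2 (rejoin 1 (- 1) strand))) = rejoin 2 (- 2 :: int) (rejoin 1 (- 1) strand)"
proof (rule matching_fun_eqI)
  fix z :: int
  show "rejoin 1 (- 1) (rejoin (- 1) (- 2) (rejoin 1 2 (rejoin 1 (- 1) strand))) (Inl z) = rejoin 2 (- 2) (rejoin 1 (- 1) strand) (Inl z)"
    by (rule five_points[of z]) (simp_all add: rejoin_def)
  show "rejoin 1 (- 1) (rejoin (- 1) (- 2) (rejoin 1 2 (rejoin 1 (- 1) strand))) (Inr z) = rejoin 2 (- 2) (rejoin 1 (- 1) strand) (Inr z)"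
    by (rule five_points[of z]) (simp_all add: rejoin_def)
qed

lemma relabel_singles:
  "relabel (s_perm 1) (rejoin 2 (- 2) (rejoin 1 (- 1) strand)) = rejoin 2 (- 2) (rejoin 1 (- 1) strand)"
proof -
  have "relabel (s_perm 1) (rejoin 2 (- 2) (rejoin 1 (- 1) strand)) = rejoin 1 (- 1) (rejoin 2 (- 2) (relabel (s_perm 1) strand))"
    by (simp add: relabel_rejoin s_perm_bij s_perm_apply)
  also have "\<dots> = rejoin 2 (- 2) (rejoin 1 (- 1) strand)"
  proof (rule matching_fun_eqI)
    have inv: "inverse_fun (s_perm 1) = s_perm 1"
      by (rule inv_unique_comp) (simp_all add: fun_eq_iff s_perm_involution)
    fix z :: int
    show "rejoin 1 (- 1) (rejoin 2 (- 2) (relabel (s_perm 1) strand)) (Inl z) = rejoin 2 (- 2) (rejoin 1 (- 1) strand) (Inl z)"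
      by (rule five_points[of z]) (simp_all add: rejoin_def relabel_def inv[simplified] s_perm_apply)
    show "rejoin 1 (- 1) (rejoin 2 (- 2) (relabel (s_perm 1) strand)) (Inr z) = rejoin 2 (- 2) (rejoin 1 (- 1) strand) (Inr z)"
      by (rule five_points[of z]) (simp_all add: rejoin_def relabel_def inv[simplified] s_perm_apply)
  qed
  finally show ?thesis .
qed

lemma square_free_mult:
  fixes a b d :: "'m::monoid_mult"
  assumes "a * d * a = a" "b * a = a * b" "b * b = b" "a * a = a"
  shows "(a * b) * d * (a * b) = a * b"
proof -
  have "(a * b) * d * (a * b) = b * (a * d * a) * b"
    by (simp only: assms(2)[symmetric] mult.assoc)
  also have "\<dots> = a * (b * b)" by (simp only: assms(1)) (simp only: assms(2) mult.assoc)
  finally show ?thesis by (simp add: assms)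
qed

lemma letter_part_relations_12:
  defines "s \<equiv> perm_part (s_perm 1)" and "P \<equiv> hook_part 1 (- 1)" and "Q \<equiv> hook_part 2 (- 2)" and "h \<equiv> hook_part 1 2"
  shows "h * P * h = h" "h * perm_part (s_perm 0) * h = h" "P * h * P = P * Q" "P * Q * s = P * Q"
    "h * P = h * Q" "P * h = Q * h" "s * P * s = Q" "P * Q = Q * P" "P * (s * P) = P * Q"
proof -
  let ?a = "cup_cap 1 (2::int)" and ?b = "cup_cap (- 1) (- 2 :: int)"
  have h: "h = ?a * ?b" by (simp add: h_def hook_part_def)
  have P: "P = cup_cap 1 (- 1)" and Q: "Q = cup_cap 2 (- 2)" by (simp_all add: P_def Q_def hook_part_def)
  have ab: "?b * ?a = ?a * ?b" "?a * ?a = ?a" "?b * ?b = ?b"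
    by (simp_all add: cup_cap_idem cup_cap_commute)
  have "cup_cap 2 1 * cup_cap 1 (- 1) * cup_cap 2 1 = cup_cap 2 (1::int)" by (rule cup_cap_zigzag) auto
  then have aPa: "?a * P * ?a = ?a" by (simp add: P cup_cap_sym)
  show "h * P * h = h" unfolding h by (rule square_free_mult[OF aPa ab(1,3,2)])
  have "?a * perm_part (s_perm 0) = ?a * cup_cap 2 (- 1)"
    using cup_cap_adjacent[of 1 2 "- 1 :: int"] by (simp add: s_perm_def)
  moreover have "?a * cup_cap 2 (- 1) * ?a = ?a" by (rule cup_cap_zigzag) auto
  ultimately have "?a * perm_part (s_perm 0) * ?a = ?a" by simp
  then show "h * perm_part (s_perm 0) * h = h" unfolding h by (rule square_free_mult[OF _ ab(1,3,2)])
  have md: "matching (strand :: int + int \<Rightarrow> _)" "\<And>x y f. matching f \<Longrightarrow> x \<noteq> y \<Longrightarrow> matching (rejoin (x::int) y f)"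
    by (simp_all add: matching_strand matching_rejoin)
  have mult: "matching f \<Longrightarrow> x \<noteq> y \<Longrightarrow> matching_diagram f * cup_cap x y = matching_diagram (rejoin x y f)" for f and x y :: int
    unfolding cup_cap_def by (rule matching_rejoin_mult)
  have start: "cup_cap x y = matching_diagram (rejoin x y strand)" for x y :: int by (rule cup_cap_def)
  have PQ: "P * Q = matching_diagram (rejoin 2 (- 2) (rejoin 1 (- 1) strand))"
    unfolding P Q by (subst start[of 1]) (simp add: mult md)
  have "P * h * P = matching_diagram (rejoin 1 (- 1) (rejoin (- 1) (- 2) (rejoin 1 2 (rejoin 1 (- 1) strand))))"
    unfolding P h mult.assoc[symmetric] by (subst start[of 1 "- 1"]) (simp add: mult md)
  then show "P * h * P = P * Q" unfolding PQ rejoin_single_pair_single .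
  have "P * Q * s = matching_diagram (relabel (s_perm 1) (rejoin 2 (- 2) (rejoin 1 (- 1) strand)))"
    unfolding PQ s_def perm_part_def by (rule matching_relabel_mult) (simp_all add: md s_perm_bij)
  then show "P * Q * s = P * Q" unfolding PQ relabel_singles .
  have "h * P = matching_diagram (rejoin 1 (- 1) (rejoin (- 1) (- 2) (rejoin 1 2 strand)))"
    "h * Q = matching_diagram (rejoin 2 (- 2) (rejoin (- 1) (- 2) (rejoin 1 2 strand)))"
    unfolding P Q h by (subst start[of 1 2], simp add: mult md)+
  then show "h * P = h * Q" by (simp only: rejoin_pair_single)
  have "P * h = matching_diagram (rejoin (- 1) (- 2) (rejoin 1 2 (rejoin 1 (- 1) strand)))"
    unfolding P h mult.assoc[symmetric] by (subst start[of 1 "- 1"]) (simp add: mult md)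
  moreover have "Q * h = matching_diagram (rejoin (- 1) (- 2) (rejoin 1 2 (rejoin 2 (- 2) strand)))"
    unfolding Q h mult.assoc[symmetric] by (subst start[of 2 "- 2"]) (simp add: mult md)
  ultimately show "P * h = Q * h" by (simp only: rejoin_single_pair)
  have Ps: "P * s = s * Q" and Qs: "Q * s = s * P"
    unfolding P_def s_def Q_def by (simp_all add: hook_part_s s_perm_apply)
  show "P * (s * P) = P * Q" using \<open>P * Q * s = P * Q\<close> by (simp add: Qs[symmetric] mult.assoc)
  show "s * P * s = Q" using Ps using perm_part_square(2)[of 1 Q] by (simp add: s_def mult.assoc)
  show "P * Q = Q * P" unfolding P Q by (rule cup_cap_commute) auto
qed

lemma neighbour_values:
  assumes "0 < i"
  shows "s_perm i (int i) = int i + 1" "s_perm i (int i + 1) = int i" "s_perm i (int i + 2) = int i + 2"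
    "s_perm (Suc i) (int i) = int i" "s_perm (Suc i) (int i + 1) = int i + 2" "s_perm (Suc i) (int i + 2) = int i + 1"
  using assms by (simp_all add: s_perm_apply)

text \<open>Relations with indices at least 1 are instances of identities for neighbouring or
  distant hooks; those that connect the indices 0 and 1 are reduced to
  \<open>letter_part_relations_12\<close>.\<close>
theorem letter_part_relations:
  assumes "(u, v) \<in> brauer_relations_B n"
  shows "prod_list (map letter_part u) = prod_list (map letter_part v)"
proof -
  interpret coxeter_B n "\<lambda>i. perm_part (s_perm i)"
  proof
    fix i j
    show "perm_part (s_perm i) * perm_part (s_perm i) = 1" by (rule perm_part_square)
    show "perm_part (s_perm 0) * perm_part (s_perm 1) * perm_part (s_perm 0) * perm_part (s_perm 1) =
      perm_part (s_perm 1) * perm_part (s_perm 0) * perm_part (s_perm 1) * perm_part (s_perm 0)"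
      by (simp add: perm_part_mult s_perm_bij bij_comp, rule arg_cong[where f = perm_part])
        (simp add: fun_eq_iff s_perm_braid4[simplified])
    show "0 < i \<Longrightarrow> perm_part (s_perm i) * perm_part (s_perm (Suc i)) * perm_part (s_perm i) =
      perm_part (s_perm (Suc i)) * perm_part (s_perm i) * perm_part (s_perm (Suc i))"
      using perm_part_triple[of i] by (simp add: mult.assoc)
    show "Suc i < j \<Longrightarrow> perm_part (s_perm i) * perm_part (s_perm j) = perm_part (s_perm j) * perm_part (s_perm i)"
      by (simp add: perm_part_mult s_perm_bij, rule arg_cong[where f = perm_part])
        (simp add: fun_eq_iff s_perm_commute[symmetric])
  qed
  note sigma4 = braid4 and sigma3 = braid3
  note R12 = letter_part_relations_12
  have neighbours: thesis
    if "0 < i" "0 < j" "\<bar>int i - int j\<bar> = 1" "j = Suc i \<Longrightarrow> thesis" "i = Suc j \<Longrightarrow> thesis" for i j thesis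
    using that by force
  from assms show ?thesis
  proof cases
    case braid4
    then show ?thesis using sigma4 by (simp add: mult.assoc)
  next
    case (braid3 i j)
    show ?thesis
    proof (rule neighbours[of i j])
      assume "j = Suc i"
      then show ?thesis using braid3 sigma3[of i] by (simp add: mult.assoc)
    next
      assume "i = Suc j"
      then show ?thesis using braid3 sigma3[of j, symmetric] by (simp add: mult.assoc)
    qed (use braid3 in auto)
  next
    case (SS_comm i j)
    then have "Suc i < j \<or> Suc j < i" by linarith
    with SS_comm show ?thesis using far[of i j] by simp
  next
    case (HSS i j)
    show ?thesis
    proof (rule neighbours[of i j])
      assume j: "j = Suc i"
      then have "hook_part (int i) (int i + 1) * (perm_part (s_perm (Suc i)) * perm_part (s_perm i))
        = perm_part (s_perm (Suc i)) * (perm_part (s_perm i) * hook_part (int i + 1) (int i + 2))"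
        using HSS by (simp add: hook_part_s neighbour_values)
      then show ?thesis using HSS j by (simp add: mult.assoc add.commute)
    next
      assume i: "i = Suc j"
      then have "hook_part (int j + 1) (int j + 2) * (perm_part (s_perm j) * perm_part (s_perm (Suc j)))
        = perm_part (s_perm j) * (perm_part (s_perm (Suc j)) * hook_part (int j) (int j + 1))"
        using HSS by (simp add: hook_part_s neighbour_values)
      then show ?thesis using HSS i by (simp add: mult.assoc add.commute)
    qed (use HSS in auto)
  next
    case H0_S1S0S1
    then show ?thesis by (simp add: hook_part_s s_perm_eq_iff s_perm_apply mult.assoc)
  next
    case H1_S0S1S0
    have "hook_part (- 2) (- 1) = hook_part 1 2" 
      using hook_part_sym[of "- 1" "- 2"] hook_part_uminus[of 1 2] by simp
    with H1_S0S1S0 show ?thesis by (simp add: hook_part_s s_perm_eq_iff s_perm_apply mult.assoc)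
  next
    case (HS_comm i j)
    then have "s_perm j (int i) = int i" "s_perm j (int i + 1) = int i + 1" "i = 0 \<Longrightarrow> s_perm j 1 = 1 \<and> s_perm j (- 1) = - 1"
      by (auto intro!: s_perm_far)
    with HS_comm show ?thesis by (auto simp: hook_part_s)
  next
    case (HH_comm i j)
    then show ?thesis by (auto intro!: hook_part_commute)
  next
    case (HS_same_comm i)
    then show ?thesis
      using hook_part_sym[of "int i" "int i + 1"] hook_part_sym[of 1 "- 1"]
      by (auto simp: hook_part_s s_perm_apply)
  next
    case (S_square i)
    then show ?thesis by (simp add: square)
  next
    case (H_idem i)
    then show ?thesis by (auto simp: hook_part_idem)
  next
    case (HS_absorb i)
    then show ?thesis
      using hook_part_sym[of "int i" "int i + 1"] by (auto simp: hook_part_s s_perm_apply)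
  next
    case (SH_absorb i)
    then have "perm_part (s_perm i) * hook_part (int i) (int i + 1) = hook_part (int i) (int i + 1) * perm_part (s_perm i)"
      using hook_part_sym[of "int i" "int i + 1"] by (simp add: hook_part_s s_perm_apply)
    with SH_absorb show ?thesis using hook_part_absorb[of i] by simp
  next
    case (HHS i j)
    show ?thesis
    proof (rule neighbours[of i j])
      assume j: "j = Suc i"
      have "hook_part (int i) (int i + 1) * hook_part (int i + 1) (int i + 2) * perm_part (s_perm i)
        = hook_part (int i) (int i + 1) * perm_part (s_perm (Suc i))"
        using HHS by (simp add: hook_part_up mult.assoc perm_part_square)
      then show ?thesis using HHS j by (simp add: mult.assoc add.commute)
    next
      assume i: "i = Suc j"
      have "hook_part (int j + 1) (int j + 2) * hook_part (int j) (int j + 1) * perm_part (s_perm (Suc j))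
        = hook_part (int j + 1) (int j + 2) * perm_part (s_perm j)"
        using HHS by (simp add: hook_part_down mult.assoc perm_part_square)
      then show ?thesis using HHS i by (simp add: mult.assoc add.commute)
    qed (use HHS in auto)
  next
    case (SHH i j)
    show ?thesis
    proof (rule neighbours[of i j])
      assume j: "j = Suc i"
      have "hook_part (int i + 1) (int i + 2) * hook_part (int i) (int i + 1)
        = perm_part (s_perm i) * perm_part (s_perm (Suc i)) * hook_part (int i) (int i + 1)"
        using SHH j by (simp add: hook_part_down hook_part_s neighbour_values mult.assoc)
      then show ?thesis using SHH j perm_part_square(2)[of i] by (simp add: mult.assoc add.commute)
    next
      assume i: "i = Suc j"
      have "hook_part (int j) (int j + 1) * hook_part (int j + 1) (int j + 2)
        = perm_part (s_perm (Suc j)) * perm_part (s_perm j) * hook_part (int j + 1) (int j + 2)"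
        using SHH i by (simp add: hook_part_up hook_part_s neighbour_values mult.assoc)
      then show ?thesis using SHH i perm_part_square(2)[of "Suc j"] by (simp add: mult.assoc add.commute)
    qed (use SHH in auto)
  next
    case H0_idem
    then show ?thesis by (simp add: hook_part_idem)
  next
    case H1H0H1
    then show ?thesis using R12(1) by (simp add: mult.assoc)
  next
    case H1S0H1
    then show ?thesis using R12(2) by (simp add: mult.assoc)
  next
    case H0H1H0
    then show ?thesis using R12(3,9) by (simp add: mult.assoc)
  next
    case S1H0S1H0
    have "P * (s * P * s) = (s * P * s) * P" if "s = perm_part (s_perm 1)" "P = hook_part 1 (- 1)" for s P
      unfolding that R12(7) by (rule R12(8))
    with S1H0S1H0 show ?thesis by (simp add: mult.assoc)
  next
    case H0S1H0S1
    have "P * (s * P * s) = P * (s * P)" if "s = perm_part (s_perm 1)" "P = hook_part 1 (- 1)" for s P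
      unfolding that R12(7) by (rule R12(9)[symmetric])
    with H0S1H0S1 show ?thesis by (simp add: mult.assoc)
  next
    case H1H0
    then show ?thesis using R12(5,7) by (simp add: mult.assoc)
  next
    case H0H1
    have "P * h = (s * P * s) * h" if "s = perm_part (s_perm 1)" "P = hook_part 1 (- 1)" "h = hook_part 1 2" for s P h
      unfolding that R12(7) by (rule R12(6))
    with H0H1 show ?thesis by (simp add: mult.assoc)
  next
    case H0S0
    then show ?thesis using hook_part_sym[of 1 "- 1"] by (simp add: hook_part_s)
  next
    case S0H0
    then show ?thesis using hook_part_absorb0 hook_part_sym[of 1 "- 1"] by (simp add: hook_part_s)
  qed
qed

section \<open>Symmetric matchings and the action of the letters\<close>

abbreviation flip :: "int + int \<Rightarrow> int + int" where "flip \<equiv> map_sum uminus uminus"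

text \<open>A symmetric diagram as the involution that exchanges the two points of each block. It is
  extended by vertical strands to all integers, so that it defines an element of
  \<open>partn\<close>.\<close>
definition signed_matching :: "nat \<Rightarrow> (int + int \<Rightarrow> int + int) \<Rightarrow> bool" where
  "signed_matching n f \<longleftrightarrow> matching f \<and> (\<forall>u. f (flip u) = flip (f u)) \<and>
    (\<forall>x. x \<notin> signed_points n \<longrightarrow> f (Inl x) = Inr x)"

lemma signed_matchingD:
  assumes "signed_matching n f"
  shows "matching f" "f (flip u) = flip (f u)" "x \<notin> signed_points n \<Longrightarrow> f (Inl x) = Inr x"
    "f (f u) = u" "f u \<noteq> u" "f u = f v \<longleftrightarrow> u = v"
  using assms matchingD[of f] by (auto simp: signed_matching_def)

lemma signed_matching_rows:
  assumes f: "signed_matching n f"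
  shows "f (Inr x) = Inr y \<Longrightarrow> f (Inr y) = Inr x" "f (Inr x) = Inr y \<Longrightarrow> f (Inr (- x)) = Inr (- y)"
    "f (Inl x) = Inl y \<Longrightarrow> f (Inl y) = Inl x" "f (Inl x) = Inl y \<Longrightarrow> f (Inl (- x)) = Inl (- y)"
    "f (Inr x) = Inl y \<Longrightarrow> f (Inl y) = Inr x" "f (Inr x) = Inl y \<Longrightarrow> f (Inr (- x)) = Inl (- y)"
    "f (Inl x) = Inr y \<Longrightarrow> f (Inr y) = Inl x" "f (Inl x) = Inr y \<Longrightarrow> f (Inl (- x)) = Inr (- y)"
proof -
  note D = signed_matchingD(4)[OF f] and E = signed_matchingD(2)[OF f, of "Inr x"] signed_matchingD(2)[OF f, of "Inl x"]
  show "f (Inr x) = Inr y \<Longrightarrow> f (Inr y) = Inr x" using D[of "Inr x"] by simp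
  show "f (Inr x) = Inr y \<Longrightarrow> f (Inr (- x)) = Inr (- y)" using E by simp
  show "f (Inl x) = Inl y \<Longrightarrow> f (Inl y) = Inl x" using D[of "Inl x"] by simp
  show "f (Inl x) = Inl y \<Longrightarrow> f (Inl (- x)) = Inl (- y)" using E by simp
  show "f (Inr x) = Inl y \<Longrightarrow> f (Inl y) = Inr x" using D[of "Inr x"] by simp
  show "f (Inr x) = Inl y \<Longrightarrow> f (Inr (- x)) = Inl (- y)" using E by simp
  show "f (Inl x) = Inr y \<Longrightarrow> f (Inr y) = Inl x" using D[of "Inl x"] by simp
  show "f (Inl x) = Inr y \<Longrightarrow> f (Inl (- x)) = Inr (- y)" using E by simp
qed

lemma signed_matching_points:
  assumes f: "signed_matching n f"
  shows "f (Inr x) = Inr y \<Longrightarrow> x \<in> signed_points n" "f (Inl x) = Inl y \<Longrightarrow> x \<in> signed_points n"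
    "f (Inl x) = Inr y \<Longrightarrow> x \<in> signed_points n \<longleftrightarrow> y \<in> signed_points n"
proof -
  have out: "f (Inl x) = Inr x \<and> f (Inr x) = Inl x" if "x \<notin> signed_points n" for x
    using signed_matchingD(3)[OF f that] signed_matchingD(4)[OF f, of "Inl x"] by simp
  show "f (Inr x) = Inr y \<Longrightarrow> x \<in> signed_points n" "f (Inl x) = Inl y \<Longrightarrow> x \<in> signed_points n"
    using out[of x] by auto
  show "f (Inl x) = Inr y \<Longrightarrow> x \<in> signed_points n \<longleftrightarrow> y \<in> signed_points n"
    using out[of x] out[of y] signed_matching_rows(7)[OF f, of x y] by auto
qed

definition hook_act :: "int \<Rightarrow> int \<Rightarrow> (int + int \<Rightarrow> int + int) \<Rightarrow> int + int \<Rightarrow> int + int" where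
  "hook_act x y f = (if y = - x then rejoin x y f else rejoin (- x) (- y) (rejoin x y f))"

lemma matching_hook_act: "matching f \<Longrightarrow> x \<noteq> y \<Longrightarrow> matching (hook_act x y f)"
  by (auto simp: hook_act_def intro!: matching_rejoin)

lemma hook_act_mult:
  assumes "matching f" "x \<noteq> y"
  shows "matching_diagram f * hook_part x y = matching_diagram (hook_act x y f)"
  using assms
  by (auto simp: hook_act_def hook_part_def cup_cap_def matching_rejoin_mult matching_rejoin simp flip: mult.assoc)

lemma hook_act_sym:
  assumes "matching f" "x \<noteq> y" shows "hook_act y x f = hook_act x y f"
proof (rule matching_diagram_inj)
  show "matching_diagram (hook_act y x f) = matching_diagram (hook_act x y f)"
    using assms hook_part_sym[of x y] by (simp flip: hook_act_mult)
qed (use assms in \<open>auto intro!: matching_hook_act\<close>)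

lemma rejoin_commute:
  fixes x y :: int
  assumes "matching f" "x \<noteq> 0" "y \<noteq> 0" "x \<noteq> y" "y \<noteq> - x"
  shows "rejoin x y (rejoin (- x) (- y) f) = rejoin (- x) (- y) (rejoin x y f)"
proof (rule matching_diagram_inj)
  have ne: "- x \<noteq> - y" using assms by simp
  have "matching_diagram f * (cup_cap (- x) (- y) * cup_cap x y) = matching_diagram f * (cup_cap x y * cup_cap (- x) (- y))"
    using hook_part_pair_commute[OF assms(2-)] by simp
  then show "matching_diagram (rejoin x y (rejoin (- x) (- y) f)) = matching_diagram (rejoin (- x) (- y) (rejoin x y f))"
    using assms(1,4) ne unfolding cup_cap_def mult.assoc[symmetric] by (simp add: matching_rejoin_mult matching_rejoin)
qed (use assms in \<open>auto intro!: matching_rejoin\<close>)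

lemma rejoin_flip:
  assumes "\<And>v. g (flip v) = flip (g' v)"
  shows "rejoin x y g (flip u) = flip (rejoin (- x) (- y) g' u)"
proof -
  have flip_flip: "flip (flip v) = v" for v by (cases v) simp_all
  have flip_eq: "flip u = v \<longleftrightarrow> u = flip v" for u v by (metis flip_flip)
  have g: "g (Inr z) = flip (g' (Inr (- z)))" for z using assms[of "Inr (- z)"] by simp
  show ?thesis
    unfolding rejoin_def g assms by (simp add: flip_eq flip_flip)
qed

lemma signed_matching_hook_act:
  assumes f: "signed_matching n f" and xy: "x \<in> signed_points n" "y \<in> signed_points n" "x \<noteq> y"
  shows "signed_matching n (hook_act x y f)"
  unfolding signed_matching_def
proof (intro conjI allI impI)
  note D = signed_matchingD[OF f]
  show "matching (hook_act x y f)" by (rule matching_hook_act[OF D(1) xy(3)])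
  fix u
  have nz: "x \<noteq> 0" "y \<noteq> 0" using xy by (auto simp: signed_points_iff)
  have once: "rejoin x y f (flip v) = flip (rejoin (- x) (- y) f v)" for v by (rule rejoin_flip[where g = f and g' = f, OF D(2)])
  show "hook_act x y f (flip u) = flip (hook_act x y f u)"
  proof (cases "y = - x")
    case True
    have "rejoin (- x) x f = rejoin x (- x) f"
      using hook_act_sym[OF D(1) xy(3)] True by (simp add: hook_act_def)
    then show ?thesis using once[of u] True by (simp add: hook_act_def)
  next
    case False
    have "rejoin (- x) (- y) (rejoin x y f) (flip u) = flip (rejoin (- (- x)) (- (- y)) (rejoin (- x) (- y) f) u)"
      by (rule rejoin_flip[where g = "rejoin x y f" and g' = "rejoin (- x) (- y) f", OF once])
    then show ?thesis using False rejoin_commute[OF D(1) nz xy(3) False] by (simp add: hook_act_def)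
  qed
  fix z assume z: "z \<notin> signed_points n"
  have keep: "rejoin a b g (Inl z) = Inr z"
    if "matching g" "g (Inl z) = Inr z" "a \<in> signed_points n" "b \<in> signed_points n" for a b g
  proof -
    have "g (Inr a) \<noteq> Inl z" "g (Inr b) \<noteq> Inl z"
      using that z matchingD(1)[OF that(1), of "Inr a"] matchingD(1)[OF that(1), of "Inr b"] by auto
    then show ?thesis using that(2) by (auto simp: rejoin_def)
  qed
  have "rejoin x y f (Inl z) = Inr z" by (rule keep[OF D(1) D(3)[OF z] xy(1,2)])
  then show "hook_act x y f (Inl z) = Inr z"
    using keep[of "rejoin x y f" "- x" "- y"] matching_rejoin[OF D(1) xy(3)] xy by (auto simp: hook_act_def)
qed

lemma signed_matching_relabel:
  assumes f: "signed_matching n f" and p: "signed_perm n p"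
  shows "signed_matching n (relabel p f)"
  unfolding signed_matching_def
proof (intro conjI allI impI)
  note D = signed_matchingD[OF f]
  note ip = signed_perm_inverse[OF p]
  show "matching (relabel p f)" by (rule matching_relabel[OF D(1) signed_perm_bij[OF p]])
  fix u
  have "map_sum id (inverse_fun p) (flip u) = flip (map_sum id (inverse_fun p) u)"
    using signed_perm_uminus[OF ip] by (cases u) simp_all
  moreover have "map_sum id p (flip v) = flip (map_sum id p v)" for v
    using signed_perm_uminus[OF p] by (cases v) simp_all
  ultimately show "relabel p f (flip u) = flip (relabel p f u)" by (simp add: relabel_def D(2))
  fix z assume "z \<notin> signed_points n"
  then show "relabel p f (Inl z) = Inr z"
    using D(3)[of z] signed_perm_outside[OF p, of z] signed_perm_zero[OF p]
    by (cases "z = 0") (auto simp: relabel_def signed_points_iff not_le)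
qed

text \<open>With \<open>c = Inl\<close> or \<open>c = Inr\<close>, the points of the top or bottom
  row whose partners lie in the same row.\<close>
definition row_points :: "nat \<Rightarrow> (int \<Rightarrow> int + int) \<Rightarrow> (int + int \<Rightarrow> int + int) \<Rightarrow> int set" where
  "row_points n c f = {x \<in> signed_points n. \<exists>y. f (c x) = c y}"

definition row_partner :: "(int \<Rightarrow> int + int) \<Rightarrow> (int + int \<Rightarrow> int + int) \<Rightarrow> int \<Rightarrow> int" where
  "row_partner c f x = (THE y. f (c x) = c y)"

lemma row_partner_eq [simp]:
  "f (Inl x) = Inl y \<Longrightarrow> row_partner Inl f x = y" "f (Inr x) = Inr y \<Longrightarrow> row_partner Inr f x = y"
  by (auto simp: row_partner_def)

lemma row_partner_cong: "f' (c x) = f (c x) \<Longrightarrow> row_partner c f' x = row_partner c f x"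
  by (simp add: row_partner_def)

lemma row_points_iff:
  assumes "signed_matching n f"
  shows "x \<in> row_points n Inl f \<longleftrightarrow> (\<exists>y. f (Inl x) = Inl y)" "x \<in> row_points n Inr f \<longleftrightarrow> (\<exists>y. f (Inr x) = Inr y)"
  using signed_matching_points[OF assms] by (auto simp: row_points_def)

lemma signed_pairing_top:
  assumes f: "signed_matching n f" shows "signed_pairing n (row_points n Inl f) (row_partner Inl f)"
  unfolding signed_pairing_def
proof (intro conjI ballI)
  show "row_points n Inl f \<subseteq> signed_points n" by (auto simp: row_points_def)
  fix x assume "x \<in> row_points n Inl f"
  then obtain y where y: "f (Inl x) = Inl y" by (auto simp: row_points_def)
  note R = signed_matching_rows(3,4)[OF f y]
  show "- x \<in> row_points n Inl f" "row_partner Inl f x \<in> row_points n Inl f"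
    "row_partner Inl f (- x) = - row_partner Inl f x" "row_partner Inl f (row_partner Inl f x) = x" "row_partner Inl f x \<noteq> x"
    using y R signed_matchingD(5)[OF f, of "Inl x"] by (auto simp: row_points_iff[OF f])
qed

lemma signed_pairing_bottom:
  assumes f: "signed_matching n f" shows "signed_pairing n (row_points n Inr f) (row_partner Inr f)"
  unfolding signed_pairing_def
proof (intro conjI ballI)
  show "row_points n Inr f \<subseteq> signed_points n" by (auto simp: row_points_def)
  fix x assume "x \<in> row_points n Inr f"
  then obtain y where y: "f (Inr x) = Inr y" by (auto simp: row_points_def)
  note R = signed_matching_rows(1,2)[OF f y]
  show "- x \<in> row_points n Inr f" "row_partner Inr f x \<in> row_points n Inr f"
    "row_partner Inr f (- x) = - row_partner Inr f x" "row_partner Inr f (row_partner Inr f x) = x" "row_partner Inr f x \<noteq> x"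
    using y R signed_matchingD(5)[OF f, of "Inr x"] by (auto simp: row_points_iff[OF f])
qed

section \<open>Normal forms\<close>

context brauer_B_relations
begin

text \<open>A relation and not a function of \<open>f\<close>: the permutation is prescribed on the
  through strands only, and the freedom to choose it is needed when a letter is multiplied.\<close>
definition normal_form :: "(int + int \<Rightarrow> int + int) \<Rightarrow> 'm \<Rightarrow> bool" where
  "normal_form f m \<longleftrightarrow> (\<exists>g. signed_perm n g \<and> (\<forall>x y. f (Inl x) = Inr y \<longrightarrow> g x = y) \<and>
    m = hook_prod (row_points n Inl f) (row_partner Inl f) * rep g * bottom_half (row_points n Inr f) (row_partner Inr f))"

text \<open>Two permutations that extend the through strands differ by one that fixes the lower ends
  of these strands. It only moves points at which \<open>bottom_half\<close> has singles and is
  absorbed by \<open>singles_absorb_rep\<close>.\<close>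
lemma normal_form_unique:
  assumes f: "signed_matching n f" and "normal_form f m" "normal_form f m'"
  shows "m = m'"
proof -
  let ?B = "row_points n Inr f"
  let ?q = "bottom_half ?B (row_partner Inr f)"
  obtain g where g: "signed_perm n g" "\<And>x y. f (Inl x) = Inr y \<Longrightarrow> g x = y"
    "m = hook_prod (row_points n Inl f) (row_partner Inl f) * rep g * ?q"
    using assms(2) unfolding normal_form_def by blast
  obtain g' where g': "signed_perm n g'" "\<And>x y. f (Inl x) = Inr y \<Longrightarrow> g' x = y"
    "m' = hook_prod (row_points n Inl f) (row_partner Inl f) * rep g' * ?q"
    using assms(3) unfolding normal_form_def by blast
  \<comment> \<open>the permutation by which the two choices differ\<close>
  let ?k = "g' \<circ> inverse_fun g"
  have k: "signed_perm n ?k" by (rule signed_perm_comp[OF signed_perm_inverse[OF g(1)] g'(1)])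
  have "?k y = y" if "y \<in> signed_points n" "y \<notin> ?B" for y
  proof -
    have "\<nexists>b. f (Inr y) = Inr b" using that(2) row_points_iff(2)[OF f] by blast
    then obtain x where "f (Inr y) = Inl x" by (cases "f (Inr y)") auto
    then have x: "f (Inl x) = Inr y" by (rule signed_matching_rows[OF f])
    then have "inverse_fun g y = x" using g(2) signed_perm_inverse_simps(2)[OF g(1), of x] by simp
    then show ?thesis using g'(2)[OF x] by simp
  qed
  then have absorb: "rep ?k * hook_prod ?B uminus = hook_prod ?B uminus"
    by (intro singles_absorb_rep signed_pairing_singles[OF signed_pairing_bottom[OF f]] k)
  have "g' = ?k \<circ> g" using g(1) by (simp add: fun_eq_iff)
  then have "rep g' = rep g * rep ?k" using rep_mult[OF g(1) k] by simp
  then have "rep g' * ?q = rep g * ((rep ?k * hook_prod ?B uminus) * hook_prod ?B (row_partner Inr f))"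
    by (simp add: bottom_half_def mult.assoc)
  then have "rep g' * ?q = rep g * ?q" unfolding absorb by (simp add: bottom_half_def)
  then show ?thesis using g(3) g'(3) by (simp add: mult.assoc)
qed

lemma normal_form_one: "normal_form strand 1"
proof -
  have "row_points n Inl strand = {}" "row_points n Inr strand = {}" by (auto simp: row_points_def)
  then show ?thesis
    unfolding normal_form_def bottom_half_def by (intro exI[of _ id]) simp
qed

lemma normal_form_rep:
  assumes f: "signed_matching n f" and p: "signed_perm n p" and m: "normal_form f m"
  shows "normal_form (relabel p f) (m * rep p)"
proof -
  let ?B = "row_points n Inr f" and ?\<beta> = "row_partner Inr f" and ?f' = "relabel p f"
  obtain g where g: "signed_perm n g" "\<And>x y. f (Inl x) = Inr y \<Longrightarrow> g x = y"
    "m = hook_prod (row_points n Inl f) (row_partner Inl f) * rep g * bottom_half ?B ?\<beta>"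
    using m unfolding normal_form_def by blast
  note B = signed_pairing_bottom[OF f]
  note f' = signed_matching_relabel[OF f p]
  have top: "?f' (Inl x) = map_sum id p (f (Inl x))" for x by (simp add: relabel_def)
  have bot: "?f' (Inr (p x)) = map_sum id p (f (Inr x))" for x using p by (simp add: relabel_def)
  have T: "row_points n Inl ?f' = row_points n Inl f"
  proof (rule Set.set_eqI)
    fix x show "x \<in> row_points n Inl ?f' \<longleftrightarrow> x \<in> row_points n Inl f"
      by (cases "f (Inl x)") (auto simp: row_points_iff[OF f] row_points_iff[OF f'] top)
  qed
  have \<beta>T: "row_partner Inl ?f' x = row_partner Inl f x" if "x \<in> row_points n Inl f" for x
    using that top by (auto simp: row_points_def)
  have B': "row_points n Inr ?f' = p ` ?B"
  proof (rule Set.set_eqI)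
    fix y
    obtain x where y: "y = p x" using signed_perm_inverse_simps(1)[OF p] by metis
    have "y \<in> row_points n Inr ?f' \<longleftrightarrow> x \<in> ?B"
      by (cases "f (Inr x)") (auto simp: row_points_iff[OF f] row_points_iff[OF f'] y bot)
    then show "y \<in> row_points n Inr ?f' \<longleftrightarrow> y \<in> p ` ?B" using y signed_perm_inj[OF p] by auto
  qed
  have \<beta>B: "row_partner Inr ?f' y = (p \<circ> ?\<beta> \<circ> inverse_fun p) y" if "y \<in> p ` ?B" for y
    using that p bot by (auto simp: row_points_def)
  have neg: "(p \<circ> uminus \<circ> inverse_fun p) y = - y" for y
    using p signed_perm_uminus[OF p] by simp
  have "bottom_half ?B ?\<beta> * rep p = hook_prod ?B uminus * (rep p * hook_prod (p ` ?B) (p \<circ> ?\<beta> \<circ> inverse_fun p))"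
    by (simp only: bottom_half_def mult.assoc hook_prod_move[OF B p])
  also have "\<dots> = rep p * (hook_prod (p ` ?B) (p \<circ> uminus \<circ> inverse_fun p) * hook_prod (p ` ?B) (p \<circ> ?\<beta> \<circ> inverse_fun p))"
    by (simp only: mult.assoc[symmetric] hook_prod_move[OF signed_pairing_singles[OF B] p])
  also have "hook_prod (p ` ?B) (p \<circ> uminus \<circ> inverse_fun p) = hook_prod (p ` ?B) uminus"
    using neg by (intro hook_prod_cong) simp
  also have "hook_prod (p ` ?B) (p \<circ> ?\<beta> \<circ> inverse_fun p) = hook_prod (p ` ?B) (row_partner Inr ?f')"
    using \<beta>B by (intro hook_prod_cong) simp
  finally have "bottom_half ?B ?\<beta> * rep p = rep p * bottom_half (row_points n Inr ?f') (row_partner Inr ?f')"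
    by (simp add: bottom_half_def B')
  then have "m * rep p = hook_prod (row_points n Inl ?f') (row_partner Inl ?f') * (rep g * rep p) * bottom_half (row_points n Inr ?f') (row_partner Inr ?f')"
    using hook_prod_cong[OF \<beta>T] by (simp add: g(3) T mult.assoc)
  moreover have "(p \<circ> g) x = y" if "?f' (Inl x) = Inr y" for x y
    using that g(2)[of x] by (cases "f (Inl x)") (auto simp: top)
  ultimately show ?thesis
    unfolding normal_form_def rep_mult[OF g(1) p]
    by (intro exI[of _ "p \<circ> g"]) (simp add: signed_perm_comp g(1) p)
qed

text \<open>If the top row and the through strands stay as they are, the same permutation can be
  kept and only the last factor has to be compared.\<close>
lemma normal_form_bottom:
  assumes f: "signed_matching n f" and f': "signed_matching n f'" and m: "normal_form f m"
    and top: "\<And>z. f' (Inl z) = f (Inl z)"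
    and half: "bottom_half (row_points n Inr f) (row_partner Inr f) * c = bottom_half (row_points n Inr f) (row_partner Inr f')"
  shows "normal_form f' (m * c)"
proof -
  have T: "row_points n Inl f' = row_points n Inl f" by (simp add: row_points_def top)
  have \<beta>T: "row_partner Inl f' = row_partner Inl f" by (simp add: row_partner_def fun_eq_iff top)
  have B: "row_points n Inr f' = row_points n Inr f"
  proof (rule Set.set_eqI)
    fix y
    have "y \<notin> row_points n Inr h \<longleftrightarrow> (\<exists>x. h (Inl x) = Inr y)" if h: "signed_matching n h" for h
      using row_points_iff(2)[OF h, of y] signed_matching_rows(5,7)[OF h, of _ y]
      by (cases "h (Inr y)") (auto dest: signed_matching_rows[OF h])
    from this[OF f] this[OF f'] show "y \<in> row_points n Inr f' \<longleftrightarrow> y \<in> row_points n Inr f"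
      by (auto simp: top)
  qed
  from m show ?thesis
    unfolding normal_form_def T \<beta>T B top half[symmetric] by (auto simp: mult.assoc)
qed

end

section \<open>Multiplying a normal form by a hook\<close>

lemma signed_points_neq:
  assumes "x \<in> signed_points n" shows "x \<noteq> 0" "x \<noteq> - x" "- x \<noteq> x"
  using assms by (auto simp: signed_points_iff)

lemma pull_through:
  fixes s :: "'m::monoid_mult"
  assumes "s * r = r * s'" "q * s' = s' * q" shows "e * (s * r) * (q * b) = e * r * (q * s') * b"
  by (simp only: assms mult.assoc)

lemma absorb_right:
  fixes s :: "'m::monoid_mult"
  assumes "s * b = c" shows "e * (q * s) * b = e * (q * c)"
  by (simp only: assms mult.assoc)

context brauer_B_relations
begin

lemma bottom_half_remove2:
  assumes A: "signed_pairing n A \<beta>" and x: "x \<in> A" "\<beta> x = p" and y: "y \<in> A" "\<beta> y = q"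
    and "y \<notin> {x, - x, p, - p}"
  defines "A0 \<equiv> A - {x, - x, p, - p} - {y, - y, q, - q}"
  shows "bottom_half A \<beta> = bottom_half A0 \<beta> * (blk x p * blk y q)" "signed_pairing n A0 \<beta>"
proof -
  let ?A1 = "A - {y, - y, q, - q}"
  have A1: "signed_pairing n ?A1 \<beta>" using signed_pairing_remove[OF A y(1)] y(2) by simp
  have "x \<notin> {y, - y, q, - q}"
  proof
    assume "x \<in> {y, - y, q, - q}"
    then have "y \<in> {x, - x, p, - p}"
      using x y signed_pairingD(4,5)[OF A y(1)] signed_pairingD(4)[OF A signed_pairingD(3)[OF A y(1)]] by auto
    then show False using assms(6) by simp
  qed
  then have x1: "x \<in> ?A1" using x by simp
  have "?A1 - {x, - x, p, - p} = A0" by (auto simp: A0_def)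
  then show "bottom_half A \<beta> = bottom_half A0 \<beta> * (blk x p * blk y q)" "signed_pairing n A0 \<beta>"
    using bottom_half_remove[OF A y] bottom_half_remove[OF A1 x1 x(2)] signed_pairing_remove[OF A1 x1] x(2)
    by (simp_all add: mult.assoc)
qed

text \<open>Hooking \<open>x\<close> to \<open>y\<close> joins their former partners
  \<open>a\<close> and \<open>b\<close>. A point joined to its own negative has no other partner to
  offer: if \<open>x\<close> is such a point, \<open>b\<close> ends up joined to \<open>- b\<close>,
  and if \<open>y\<close> is one as well, the points that are left form no new pair. This explains
  the cases of the last hypothesis.\<close>
lemma bottom_half_hook:
  assumes A: "signed_pairing n A \<beta>" and A': "signed_pairing n A \<beta>'"
    and x: "x \<in> A" "\<beta> x = a" and y: "y \<in> A" "\<beta> y = b" and xy: "\<bar>x\<bar> \<noteq> \<bar>y\<bar>"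
    and x': "\<beta>' x = y"
    and same: "\<And>z. z \<in> A \<Longrightarrow> z \<notin> {x, - x, y, - y, a, - a, b, - b} \<Longrightarrow> \<beta>' z = \<beta> z"
    and ab: "if a = - x then b \<noteq> - y \<longrightarrow> \<beta>' b = - b
      else if b = - y then \<beta>' a = - a else a \<noteq> y \<and> a \<noteq> - y \<longrightarrow> \<beta>' a = b"
  shows "bottom_half A \<beta> * hook x y = bottom_half A \<beta>'"
proof -
  note D = signed_pairingD[OF A]
  have pts: "x \<in> signed_points n" "y \<in> signed_points n" "a \<in> signed_points n" "b \<in> signed_points n"
    and aA: "a \<in> A" and bA: "b \<in> A"
    using D(1,3,8) x y by auto
  have ne: "a \<noteq> x" "b \<noteq> y" "y \<noteq> x" "x \<noteq> y" using D(6) x y xy by auto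
  have partners: "\<beta> a = x" "\<beta> b = y" "\<beta> (- x) = - a" "\<beta> (- y) = - b" using D(4,5) x y by auto
  show ?thesis
  proof (cases "a = y \<or> a = - y")
    case True
    then have b: "b = x \<or> b = - x" using partners y D(4)[OF y(1)] by auto
    \<comment> \<open>the two orbits are already paired with each other, possibly with the other sign\<close>
    have orb: "{x, - x, y, - y} = {x, - x, a, - a}" using True by auto
    let ?A0 = "A - {x, - x, a, - a}"
    have q: "bottom_half A \<beta> = bottom_half ?A0 \<beta> * blk x a" by (rule bottom_half_remove[OF A x])
    have q': "bottom_half A \<beta>' = bottom_half ?A0 \<beta>' * blk x y"
      using bottom_half_remove[OF A' x(1) x'] orb by simp
    have "bottom_half ?A0 \<beta>' = bottom_half ?A0 \<beta>"
      using True b by (intro bottom_half_cong same) auto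
    moreover have "blk x a * hook x y = blk x y"
      using True blk_hook[OF pts(1,2) xy] blk_flip_hook[OF pts(1,2) xy] by auto
    ultimately show ?thesis by (simp add: q q' mult.assoc)
  next
    case False
    then have a_abs: "\<bar>a\<bar> \<noteq> \<bar>y\<bar>" by (auto simp: abs_eq_iff)
    have y_out: "y \<notin> {x, - x, a, - a}" using False xy by (auto simp: abs_eq_iff)
    have b_out: "\<bar>b\<bar> \<noteq> \<bar>x\<bar>" "\<bar>b\<bar> \<noteq> \<bar>a\<bar>"
    proof -
      have "b \<in> A - {x, - x, \<beta> x, - \<beta> x}"
        using signed_pairingD(3)[OF signed_pairing_remove[OF A x(1)], of y] y y_out x(2) by blast
      then show "\<bar>b\<bar> \<noteq> \<bar>x\<bar>" "\<bar>b\<bar> \<noteq> \<bar>a\<bar>" using x(2) by (auto simp: abs_eq_iff)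
    qed
    define A0 where "A0 = A - {x, - x, a, - a} - {y, - y, b, - b}"
    have q: "bottom_half A \<beta> = bottom_half A0 \<beta> * (blk x a * blk y b)"
      unfolding A0_def by (rule bottom_half_remove2(1)[OF A x y y_out])
    have A0_eq: "bottom_half A0 \<beta>' = bottom_half A0 \<beta>"
      by (intro bottom_half_cong same) (auto simp: A0_def)
    consider "a = - x" "b = - y" | "a = - x" "\<bar>b\<bar> \<noteq> \<bar>y\<bar>" | "\<bar>a\<bar> \<noteq> \<bar>x\<bar>" "b = - y" | "\<bar>a\<bar> \<noteq> \<bar>x\<bar>" "\<bar>b\<bar> \<noteq> \<bar>y\<bar>"
      using ne by (auto simp: abs_eq_iff)
    then show ?thesis
    proof cases
      case 1
      have "A - {x, - x, y, - y} = A0" using 1 by (auto simp: A0_def)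
      then have "bottom_half A \<beta>' = bottom_half A0 \<beta> * blk x y"
        using bottom_half_remove[OF A' x(1) x'] A0_eq by simp
      moreover have "blk x a * blk y b * hook x y = blk x y"
        using 1 blk_single[OF pts(1)] blk_single[OF pts(2)] by (simp add: blk_def[of x y])
      ultimately show ?thesis by (simp add: q mult.assoc)
    next
      case 2
      then have b': "\<beta>' b = - b" using ab by (auto simp: abs_eq_iff)
      have b_xy: "b \<notin> {x, - x, y, - y}" using 2 b_out by auto
      have "A - {x, - x, y, - y} - {b, - b, - b, - (- b)} = A0" using 2 by (auto simp: A0_def)
      then have "bottom_half A \<beta>' = bottom_half A0 \<beta> * (blk x y * single b)"
        using bottom_half_remove2(1)[OF A' x(1) x' bA b' b_xy] A0_eq blk_single[OF pts(4)] by simp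
      moreover have "blk x a * blk y b * hook x y = blk x y * single b"
        using 2 blk_single[OF pts(1)] single_blk_hook[OF pts(1,2,4)] xy b_out by simp
      ultimately show ?thesis by (simp add: q mult.assoc)
    next
      case 3
      then have a': "\<beta>' a = - a" using ab by (auto simp: abs_eq_iff)
      have a_xy: "a \<notin> {x, - x, y, - y}" using 3 a_abs by auto
      have "A - {x, - x, y, - y} - {a, - a, - a, - (- a)} = A0" using 3 by (auto simp: A0_def)
      then have "bottom_half A \<beta>' = bottom_half A0 \<beta> * (blk x y * single a)"
        using bottom_half_remove2(1)[OF A' x(1) x' aA a' a_xy] A0_eq blk_single[OF pts(3)] by simp
      moreover have "blk x a * blk y b * hook x y = blk x y * single a"
      proof -
        have "blk x a * blk y b = single y * blk x a"
        proof -
          have c: "single x * single y = single y * single x" "single a * single y = single y * single a"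
            "hook x a * single y = single y * hook x a"
            using singles_commute[of x y] singles_commute[of a y] single_hook_commute[of y x a] pts xy a_abs 3 by auto
          have "blk x a * single y = single x * (single a * single y) * hook x a"
            by (simp only: blk_def mult.assoc c(3))
          also have "\<dots> = single y * blk x a"
            by (simp only: c(2)) (simp only: blk_def mult.assoc[symmetric] c(1))
          finally show ?thesis using 3 blk_single[OF pts(2)] by simp
        qed
        then show ?thesis
          using single_blk_hook[of y x a] pts xy a_abs 3 hook_sym'[of x y] blk_sym[of x y] ne by auto
      qed
      ultimately show ?thesis by (simp add: q mult.assoc)
    next
      case 4
      then have a': "\<beta>' a = b" using ab False by (auto simp: abs_eq_iff)
      have a_xy: "a \<notin> {x, - x, y, - y}" using 4 a_abs by auto
      have "A - {x, - x, y, - y} - {a, - a, b, - b} = A0" by (auto simp: A0_def)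
      then have "bottom_half A \<beta>' = bottom_half A0 \<beta> * (blk x y * blk a b)"
        using bottom_half_remove2(1)[OF A' x(1) x' aA a' a_xy] A0_eq by simp
      moreover have "blk x a * blk y b * hook x y = blk x y * blk a b"
        using pts xy a_abs b_out 4 by (intro blk_blk_hook) auto
      ultimately show ?thesis by (simp add: q mult.assoc)
    qed
  qed
qed

text \<open>Joining \<open>x\<close> to \<open>- x\<close> frees \<open>a\<close> and \<open>-
  a\<close>, which become partners.\<close>
lemma bottom_half_single:
  assumes A: "signed_pairing n A \<beta>" and A': "signed_pairing n A \<beta>'"
    and x: "x \<in> A" "\<beta> x = a"
    and x': "\<beta>' x = - x" "\<beta>' a = - a"
    and same: "\<And>z. z \<in> A \<Longrightarrow> z \<notin> {x, - x, a, - a} \<Longrightarrow> \<beta>' z = \<beta> z"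
  shows "bottom_half A \<beta> * single x = bottom_half A \<beta>'"
proof -
  note D = signed_pairingD[OF A x(1), unfolded x(2)]
  let ?A0 = "A - {x, - x, a, - a}"
  have q: "bottom_half A \<beta> = bottom_half ?A0 \<beta> * blk x a" by (rule bottom_half_remove[OF A x])
  have A0_eq: "bottom_half ?A0 \<beta>' = bottom_half ?A0 \<beta>" by (intro bottom_half_cong same) auto
  show ?thesis
  proof (cases "a = - x")
    case True
    then have "bottom_half A \<beta>' = bottom_half ?A0 \<beta> * single x"
      using bottom_half_remove[OF A' x(1) x'(1)] A0_eq blk_single[OF D(1)] by simp
    then show ?thesis using True q blk_single[OF D(1)] single_idem(1)[OF D(1)] by (simp add: mult.assoc)
  next
    case False
    then have ax: "\<bar>x\<bar> \<noteq> \<bar>a\<bar>" using D(6) by (auto simp: abs_eq_iff)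
    have "A - {x, - x, - x, - (- x)} - {a, - a, - a, - (- a)} = ?A0" by auto
    then have "bottom_half A \<beta>' = bottom_half ?A0 \<beta> * (single x * single a)"
      using bottom_half_remove2(1)[OF A' x(1) x'(1) D(3) x'(2)] False D A0_eq blk_single[OF D(1)] blk_single[OF D(8)] by auto
    then show ?thesis using blk_single_right[OF D(1,8) ax] by (simp add: q mult.assoc)
  qed
qed

text \<open>The two strands are cut. Pulled through the permutation, the hook at \<open>x, y\<close>
  is the hook at the upper ends \<open>u, v\<close> of the strands, and this new pair of the top row
  is accompanied by the pair \<open>x, y\<close> below.\<close>
lemma normal_form_hook_both_through:
  assumes f: "signed_matching n f" and m: "normal_form f m"
    and xy: "x \<in> signed_points n" "y \<in> signed_points n" "\<bar>x\<bar> \<noteq> \<bar>y\<bar>"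
    and fx: "f (Inr x) = Inl u" and fy: "f (Inr y) = Inl v"
  shows "normal_form (hook_act x y f) (m * hook x y)"
proof -
  let ?f' = "hook_act x y f"
  let ?T = "row_points n Inl f" and ?\<alpha> = "row_partner Inl f" and ?B = "row_points n Inr f" and ?\<beta> = "row_partner Inr f"
  let ?T' = "row_points n Inl ?f'" and ?\<alpha>' = "row_partner Inl ?f'" and ?B' = "row_points n Inr ?f'" and ?\<beta>' = "row_partner Inr ?f'"
  have ne: "x \<noteq> y" "y \<noteq> - x" "x \<noteq> - y" using xy by auto
  have f': "signed_matching n ?f'" by (rule signed_matching_hook_act[OF f xy(1,2) ne(1)])
  note D = signed_matchingD[OF f] and R = signed_matching_rows[OF f] and iff = row_points_iff[OF f] and iff' = row_points_iff[OF f']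
  note nx = signed_points_neq[OF xy(1)] and ny = signed_points_neq[OF xy(2)]
  have f_eqs: "f (Inr (- x)) = Inl (- u)" "f (Inr (- y)) = Inl (- v)" "f (Inl u) = Inr x" "f (Inl v) = Inr y"
    "f (Inl (- u)) = Inr (- x)" "f (Inl (- v)) = Inr (- y)"
    using R(5,6)[OF fx] R(5,6)[OF fy] R(8)[OF R(5)[OF fx]] R(8)[OF R(5)[OF fy]] by simp_all
  have uv: "u \<in> signed_points n" "v \<in> signed_points n"
    using signed_matching_points(3)[OF f f_eqs(3)] signed_matching_points(3)[OF f f_eqs(4)] xy by auto
  note nu = signed_points_neq[OF uv(1)] and nv = signed_points_neq[OF uv(2)]
  have u_ne: "u \<noteq> v" "u \<noteq> - v" "v \<noteq> - u"
    using D(6)[of "Inr x" "Inr y"] D(6)[of "Inr x" "Inr (- y)"] D(6)[of "Inr y" "Inr (- x)"] fx fy f_eqs ne by auto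
  have bot: "?f' (Inr z) = (if z = x then Inr y else if z = y then Inr x else if z = - x then Inr (- y)
      else if z = - y then Inr (- x) else f (Inr z))" for z
    using ne nx ny fx fy f_eqs u_ne by (auto simp: hook_act_def rejoin_def)
  have top: "?f' (Inl z) = (if z = u then Inl v else if z = v then Inl u else if z = - u then Inl (- v)
      else if z = - v then Inl (- u) else f (Inl z))" for z
    using ne nx ny nu nv fx fy f_eqs u_ne by (auto simp: hook_act_def rejoin_def)
  obtain g where g: "signed_perm n g" "\<And>a b. f (Inl a) = Inr b \<Longrightarrow> g a = b"
    "m = hook_prod ?T ?\<alpha> * rep g * bottom_half ?B ?\<beta>"
    using m unfolding normal_form_def by blast
  have uT: "u \<in> ?T'" "?\<alpha>' u = v" and xB: "x \<in> ?B'" "?\<beta>' x = y" by (auto simp: iff' top bot)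
  have T: "?T' - {u, - u, v, - v} = ?T" and B: "?B' - {x, - x, y, - y} = ?B"
    by (auto simp: iff iff' top bot f_eqs fx fy split: if_splits)
  have E: "hook_prod ?T' ?\<alpha>' = hook_prod ?T ?\<alpha> * hook u v"
  proof -
    have "hook_prod ?T ?\<alpha>' = hook_prod ?T ?\<alpha>"
      by (intro hook_prod_cong row_partner_cong) (auto simp: top iff f_eqs)
    then show ?thesis using hook_prod_remove(1)[OF signed_pairing_top[OF f'] uT, unfolded T] by simp
  qed
  have F: "bottom_half ?B' ?\<beta>' = bottom_half ?B ?\<beta> * blk x y"
  proof -
    have "bottom_half ?B ?\<beta>' = bottom_half ?B ?\<beta>"
      by (intro bottom_half_cong row_partner_cong) (auto simp: bot iff f_eqs fx fy)
    then show ?thesis using bottom_half_remove[OF signed_pairing_bottom[OF f'] xB, unfolded B] by simp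
  qed
  have not_B: "x \<notin> ?B" "y \<notin> ?B" by (auto simp: iff fx fy)
  have move: "hook u v * rep g = rep g * hook x y"
    using hook_move[OF uv u_ne(1) g(1)] g(2)[OF f_eqs(3)] g(2)[OF f_eqs(4)] by simp
  have comm: "bottom_half ?B ?\<beta> * hook x y = hook x y * bottom_half ?B ?\<beta>"
    by (rule bottom_half_commute[OF signed_pairing_bottom[OF f] xy(1,2) ne(1) not_B])
  have "hook_prod ?T' ?\<alpha>' * rep g * bottom_half ?B' ?\<beta>'
      = hook_prod ?T ?\<alpha> * (hook u v * rep g) * (bottom_half ?B ?\<beta> * blk x y)"
    by (simp only: E F mult.assoc)
  also have "\<dots> = hook_prod ?T ?\<alpha> * rep g * (bottom_half ?B ?\<beta> * hook x y) * blk x y"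
    by (rule pull_through[OF move comm])
  also have "\<dots> = m * hook x y"
    by (simp only: g(3) mult.assoc hook_blk[OF xy])
  finally have "m * hook x y = hook_prod ?T' ?\<alpha>' * rep g * bottom_half ?B' ?\<beta>'" by simp
  moreover have "g a = b" if "?f' (Inl a) = Inr b" for a b
    using that g(2)[of a b] by (auto simp: top split: if_splits)
  ultimately show ?thesis unfolding normal_form_def using g(1) by blast
qed

text \<open>The strand from \<open>x\<close> is led on to the former partner of \<open>y\<close>:
  the permutation is changed by an exchange of two points, or, if \<open>y\<close> was joined to
  \<open>- y\<close>, the strand is cut, its upper end \<open>u\<close> is joined to \<open>-
  u\<close>, and \<open>x\<close> is paired with \<open>y\<close>.\<close>
lemma normal_form_hook_one_through:
  assumes f: "signed_matching n f" and m: "normal_form f m"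
    and xy: "x \<in> signed_points n" "y \<in> signed_points n" "\<bar>x\<bar> \<noteq> \<bar>y\<bar>"
    and fx: "f (Inr x) = Inl u" and fy: "f (Inr y) = Inr z"
  shows "normal_form (hook_act x y f) (m * hook x y)"
proof -
  let ?f' = "hook_act x y f"
  let ?T = "row_points n Inl f" and ?\<alpha> = "row_partner Inl f" and ?B = "row_points n Inr f" and ?\<beta> = "row_partner Inr f"
  let ?T' = "row_points n Inl ?f'" and ?\<alpha>' = "row_partner Inl ?f'" and ?B' = "row_points n Inr ?f'" and ?\<beta>' = "row_partner Inr ?f'"
  have ne: "x \<noteq> y" "y \<noteq> - x" "x \<noteq> - y" using xy by auto
  have f': "signed_matching n ?f'" by (rule signed_matching_hook_act[OF f xy(1,2) ne(1)])
  note D = signed_matchingD[OF f] and R = signed_matching_rows[OF f] and iff = row_points_iff[OF f] and iff' = row_points_iff[OF f']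
  note nx = signed_points_neq[OF xy(1)] and ny = signed_points_neq[OF xy(2)]
  have f_eqs: "f (Inr (- x)) = Inl (- u)" "f (Inr (- y)) = Inr (- z)" "f (Inl u) = Inr x" "f (Inr z) = Inr y"
    "f (Inl (- u)) = Inr (- x)" "f (Inr (- z)) = Inr (- y)"
    using R(5,6)[OF fx] R(1,2)[OF fy] R(8)[OF R(5)[OF fx]] R(2)[OF R(1)[OF fy]] by simp_all
  have uz: "u \<in> signed_points n" "z \<in> signed_points n"
    using signed_matching_points(3)[OF f f_eqs(3)] signed_matching_points(1)[OF f f_eqs(4)] xy by auto
  note nu = signed_points_neq[OF uz(1)] and nz = signed_points_neq[OF uz(2)]
  have z_ne: "z \<noteq> x" "z \<noteq> - x" "- z \<noteq> x" "z \<noteq> y" using f_eqs fx fy D(5)[of "Inr y"] by auto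
  then have zx: "\<bar>x\<bar> \<noteq> \<bar>z\<bar>" by (auto simp: abs_eq_iff)
  obtain g where g: "signed_perm n g" "\<And>a b. f (Inl a) = Inr b \<Longrightarrow> g a = b"
    "m = hook_prod ?T ?\<alpha> * rep g * bottom_half ?B ?\<beta>"
    using m unfolding normal_form_def by blast
  have bot: "?f' (Inr w) = (if w = x then Inr y else if w = y then Inr x else if w = - x then Inr (- y)
      else if w = - y then Inr (- x) else if w = z then Inl u else if w = - z then Inl (- u) else f (Inr w))"
    if "z \<noteq> - y" for w
    using that ne nx ny nu nz z_ne fx fy f_eqs by (auto simp: hook_act_def rejoin_def)
  have top: "?f' (Inl w) = (if w = u then Inr z else if w = - u then Inr (- z) else f (Inl w))"
    if "z \<noteq> - y" for w
    using that ne nx ny nu nz z_ne fx fy f_eqs by (auto simp: hook_act_def rejoin_def)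
  have bot1: "?f' (Inr w) = (if w = x then Inr y else if w = y then Inr x else if w = - x then Inr (- y)
      else if w = - y then Inr (- x) else f (Inr w))" if "z = - y" for w
    using that ne nx ny nu nz z_ne fx fy f_eqs by (auto simp: hook_act_def rejoin_def)
  have top1: "?f' (Inl w) = (if w = u then Inl (- u) else if w = - u then Inl u else f (Inl w))"
    if "z = - y" for w
    using that ne nx ny nu nz z_ne fx fy f_eqs by (auto simp: hook_act_def rejoin_def)
  have xB: "x \<in> ?B'" "?\<beta>' x = y" using bot[of x] bot1[of x] by (cases "z = - y"; auto simp: iff')+
  have yB: "y \<in> ?B" "?\<beta> y = z" by (auto simp: iff fy)
  have F: "bottom_half ?B ?\<beta> = bottom_half (?B - {y, - y, z, - z}) ?\<beta> * blk y z"
    by (rule bottom_half_remove[OF signed_pairing_bottom[OF f] yB])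
  have F': "bottom_half ?B' ?\<beta>' = bottom_half (?B' - {x, - x, y, - y}) ?\<beta>' * blk x y"
    by (rule bottom_half_remove[OF signed_pairing_bottom[OF f'] xB])
  let ?q = "bottom_half (?B - {y, - y, z, - z}) ?\<beta>"
  have pairing0: "signed_pairing n (?B - {y, - y, z, - z}) ?\<beta>"
    using signed_pairing_remove[OF signed_pairing_bottom[OF f] yB(1)] yB(2) by simp
  show ?thesis
  proof (cases "z = - y")
    case False
    note bot = bot[OF False] and top = top[OF False]
    have zy: "\<bar>y\<bar> \<noteq> \<bar>z\<bar>" using False z_ne by (auto simp: abs_eq_iff)
    let ?t = "signed_transp z x"
    note xyz = xy(1,2) uz(2) xy(3) zx zy
    note t = transp_xq[OF xyz]
    have t_off: "?t w = w" if "\<bar>w\<bar> \<noteq> \<bar>z\<bar>" "\<bar>w\<bar> \<noteq> \<bar>x\<bar>" for w using that by (rule signed_transp_outside)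
    have T: "?T' = ?T" by (auto simp: iff iff' top f_eqs split: if_splits)
    have E: "hook_prod ?T' ?\<alpha>' = hook_prod ?T ?\<alpha>"
      unfolding T by (intro hook_prod_cong row_partner_cong) (auto simp: top iff f_eqs)
    have B: "?B' - {x, - x, y, - y} = ?B - {y, - y, z, - z}"
      by (auto simp: iff iff' bot f_eqs fx fy split: if_splits)
    have Q: "bottom_half (?B' - {x, - x, y, - y}) ?\<beta>' = ?q"
      unfolding B by (intro bottom_half_cong row_partner_cong) (auto simp: bot iff fx f_eqs)
    have comm: "?q * rep ?t = rep ?t * ?q"
    proof (rule bottom_half_commute_rep[OF pairing0 t(1)])
      fix w assume "w \<in> ?B - {y, - y, z, - z}"
      then show "?t w = w" by (intro t_off) (auto simp: iff fx f_eqs abs_eq_iff)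
    qed
    have "m * hook x y = hook_prod ?T ?\<alpha> * rep g * (?q * (blk y z * hook x y))"
      by (simp only: g(3) F mult.assoc)
    also have "\<dots> = hook_prod ?T ?\<alpha> * rep g * (?q * rep ?t) * blk x y"
      by (simp only: blk_hook_through[OF xyz] mult.assoc)
    also have "\<dots> = hook_prod ?T ?\<alpha> * (rep g * rep ?t) * (?q * blk x y)"
      by (simp only: comm mult.assoc)
    also have "\<dots> = hook_prod ?T' ?\<alpha>' * rep (?t \<circ> g) * bottom_half ?B' ?\<beta>'"
      by (simp only: E F' Q rep_mult[OF g(1) t(1)])
    finally have "m * hook x y = hook_prod ?T' ?\<alpha>' * rep (?t \<circ> g) * bottom_half ?B' ?\<beta>'" .
    moreover have "(?t \<circ> g) a = b" if ab: "?f' (Inl a) = Inr b" for a b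
    proof -
      consider "a = u" "b = z" | "a = - u" "b = - z" | "a \<noteq> u" "a \<noteq> - u" "f (Inl a) = Inr b"
        using ab by (auto simp: top split: if_splits)
      then show ?thesis
      proof cases
        case 1
        then show ?thesis using g(2)[OF f_eqs(3)] t(4) by simp
      next
        case 2
        then show ?thesis using g(2)[OF f_eqs(5)] t(4) signed_perm_uminus[OF t(1), of x] by simp
      next
        case 3
        have "f (Inr b) = Inl a" using R(7)[OF 3(3)] .
        then have "b \<noteq> x" "b \<noteq> - x" "b \<noteq> z" "b \<noteq> - z" using 3 fx f_eqs by auto
        then have "?t b = b" by (intro t_off) (auto simp: abs_eq_iff)
        then show ?thesis using g(2)[OF 3(3)] by simp
      qed
    qed
    ultimately show ?thesis unfolding normal_form_def using signed_perm_comp[OF g(1) t(1)] by blast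
  next
    case True
    note bot = bot1[OF True] and top = top1[OF True]
    have uT: "u \<in> ?T'" "?\<alpha>' u = - u" by (auto simp: iff' top)
    have T: "?T' - {u, - u, - u, - (- u)} = ?T"
      by (auto simp: iff iff' top f_eqs split: if_splits)
    have E: "hook_prod ?T' ?\<alpha>' = hook_prod ?T ?\<alpha> * single u"
    proof -
      have "hook_prod ?T ?\<alpha>' = hook_prod ?T ?\<alpha>"
        by (intro hook_prod_cong row_partner_cong) (auto simp: top iff f_eqs)
      then show ?thesis using hook_prod_remove(1)[OF signed_pairing_top[OF f'] uT, unfolded T] by simp
    qed
    have B: "?B' - {x, - x, y, - y} = ?B - {y, - y, z, - z}"
      using True by (auto simp: iff iff' bot f_eqs fx fy split: if_splits)
    have Q: "bottom_half (?B' - {x, - x, y, - y}) ?\<beta>' = ?q"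
      unfolding B using True by (intro bottom_half_cong row_partner_cong) (auto simp: bot iff fx f_eqs)
    have comm: "?q * single x = single x * ?q"
      using xy nx by (intro bottom_half_commute[OF pairing0]) (auto simp: iff fx f_eqs)
    have move: "single u * rep g = rep g * single x"
      using hook_move[OF uz(1) _ nu(2) g(1)] uz g(2)[OF f_eqs(3)] signed_perm_uminus[OF g(1), of u] by simp
    have absorb: "single x * blk x y = single y * hook x y"
      by (rule HOL.trans[OF single_blk[OF xy] single_hook_eq_blk[OF xy, symmetric]])
    have "blk y z = single y" unfolding True by (rule blk_single[OF xy(2)])
    then have F_single: "bottom_half ?B ?\<beta> = ?q * single y" unfolding F by (rule arg_cong)
    have "hook_prod ?T' ?\<alpha>' * rep g * bottom_half ?B' ?\<beta>' = hook_prod ?T ?\<alpha> * (single u * rep g) * (?q * blk x y)"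
      by (simp only: E F' Q mult.assoc)
    also have "\<dots> = hook_prod ?T ?\<alpha> * rep g * (?q * single x) * blk x y"
      by (rule pull_through[OF move comm])
    also have "\<dots> = hook_prod ?T ?\<alpha> * rep g * (?q * (single y * hook x y))"
      by (rule absorb_right[OF absorb])
    also have "\<dots> = m * hook x y"
      by (simp only: g(3) F_single mult.assoc)
    finally have "m * hook x y = hook_prod ?T' ?\<alpha>' * rep g * bottom_half ?B' ?\<beta>'" by simp
    moreover have "g a = b" if "?f' (Inl a) = Inr b" for a b
      using that g(2)[of a b] by (auto simp: top split: if_splits)
    ultimately show ?thesis unfolding normal_form_def using g(1) by blast
  qed
qed

text \<open>The hook changes the pairs of the bottom row only.\<close>
lemma normal_form_hook_none_through:
  assumes f: "signed_matching n f" and m: "normal_form f m"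
    and xy: "x \<in> signed_points n" "y \<in> signed_points n" "\<bar>x\<bar> \<noteq> \<bar>y\<bar>"
    and fx: "f (Inr x) = Inr a" and fy: "f (Inr y) = Inr b"
  shows "normal_form (hook_act x y f) (m * hook x y)"
proof -
  let ?f' = "hook_act x y f"
  let ?B = "row_points n Inr f" and ?\<beta> = "row_partner Inr f" and ?\<beta>' = "row_partner Inr ?f'"
  have ne: "x \<noteq> y" "y \<noteq> - x" "x \<noteq> - y" using xy by auto
  have f': "signed_matching n ?f'" by (rule signed_matching_hook_act[OF f xy(1,2) ne(1)])
  note D = signed_matchingD[OF f] and R = signed_matching_rows[OF f] and iff = row_points_iff[OF f] and iff' = row_points_iff[OF f']
  note nx = signed_points_neq[OF xy(1)] and ny = signed_points_neq[OF xy(2)]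
  have f_eqs: "f (Inr (- x)) = Inr (- a)" "f (Inr (- y)) = Inr (- b)" "f (Inr a) = Inr x" "f (Inr b) = Inr y"
    "f (Inr (- a)) = Inr (- x)" "f (Inr (- b)) = Inr (- y)"
    using R(1,2)[OF fx] R(1,2)[OF fy] R(2)[OF R(1)[OF fx]] R(2)[OF R(1)[OF fy]] by simp_all
  have ab: "a \<in> signed_points n" "b \<in> signed_points n"
    using signed_matching_points(1)[OF f f_eqs(3)] signed_matching_points(1)[OF f f_eqs(4)] by auto
  note na = signed_points_neq[OF ab(1)] and nb = signed_points_neq[OF ab(2)]
  have ab_ne: "a \<noteq> b" "a \<noteq> - b" "b \<noteq> - a" "a \<noteq> x" "b \<noteq> y"
    using D(6)[of "Inr x" "Inr y"] D(6)[of "Inr x" "Inr (- y)"] D(6)[of "Inr y" "Inr (- x)"]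
      D(5)[of "Inr x"] D(5)[of "Inr y"] fx fy f_eqs ne by auto
  have top: "?f' (Inl w) = f (Inl w)" for w
    using D(4)[of "Inl w"] fx fy f_eqs by (auto simp: hook_act_def rejoin_def)
  have cross: "a = y \<longleftrightarrow> b = x" "a = - y \<longleftrightarrow> b = - x"
    using fx fy f_eqs by auto
  have bx: "?f' (Inr x) = Inr y"
    using ne nx ny na nb ab_ne cross fx fy f_eqs by (auto simp: hook_act_def rejoin_def)
  have other: "?f' (Inr w) = f (Inr w)" if "w \<notin> {x, - x, y, - y, a, - a, b, - b}" for w
    using that ne nx ny by (simp add: hook_act_def rejoin_def fx fy f_eqs)
  have ends: "if a = - x then b \<noteq> - y \<longrightarrow> ?f' (Inr b) = Inr (- b)
      else if b = - y then ?f' (Inr a) = Inr (- a) else a \<noteq> y \<and> a \<noteq> - y \<longrightarrow> ?f' (Inr a) = Inr b"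
  proof -
    have 1: "?f' (Inr b) = Inr (- b)" if "a = - x" "b \<noteq> - y"
    proof -
      have fx': "f (Inr x) = Inr (- x)" using fx that by simp
      have "b \<noteq> x" "b \<noteq> - x" using cross that ab_ne ne by auto
      then show ?thesis using that(2) ne nx ny nb ab_ne(5) by (simp add: hook_act_def rejoin_def fx' fy f_eqs)
    qed
    have 2: "?f' (Inr a) = Inr (- a)" if "a \<noteq> - x" "b = - y"
    proof -
      have fy': "f (Inr y) = Inr (- y)" using fy that by simp
      have "a \<noteq> y" using cross(1) that(2) ne(3) by metis
      moreover have "a \<noteq> - y" using cross(2) that(2) ne(1) by (metis neg_equal_iff_equal)
      ultimately show ?thesis using that(1) ne nx ny na ab_ne(4) by (simp add: hook_act_def rejoin_def fx fy' f_eqs)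
    qed
    have 3: "?f' (Inr a) = Inr b" if "a \<noteq> - x" "b \<noteq> - y" "a \<noteq> y" "a \<noteq> - y"
    proof -
      have "b \<noteq> x" "b \<noteq> - x" using cross that by auto
      then show ?thesis using that ne nx ny na nb ab_ne by (simp add: hook_act_def rejoin_def fx fy f_eqs)
    qed
    show ?thesis using 1 2 3 by simp
  qed
  have B': "row_points n Inr ?f' = ?B"
  proof (rule Set.set_eqI)
    fix w
    have "w \<notin> row_points n Inr h \<longleftrightarrow> (\<exists>v. h (Inl v) = Inr w)" if h: "signed_matching n h" for h
      using row_points_iff(2)[OF h, of w] by (cases "h (Inr w)") (auto dest: signed_matching_rows[OF h])
    from this[OF f] this[OF f'] show "w \<in> row_points n Inr ?f' \<longleftrightarrow> w \<in> ?B" by (auto simp: top)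
  qed
  have "bottom_half ?B ?\<beta> * hook x y = bottom_half ?B ?\<beta>'"
  proof (rule bottom_half_hook[OF signed_pairing_bottom[OF f] _ _ _ _ _ xy(3)])
    show "signed_pairing n ?B ?\<beta>'" using signed_pairing_bottom[OF f'] by (simp add: B')
    show "x \<in> ?B" "y \<in> ?B" using fx fy by (auto simp: iff)
    show "?\<beta> x = a" "?\<beta> y = b" "?\<beta>' x = y" using fx fy bx by simp_all
    show "?\<beta>' w = ?\<beta> w" if "w \<notin> {x, - x, y, - y, a, - a, b, - b}" for w
      by (rule row_partner_cong) (rule other[OF that])
    show "if a = - x then b \<noteq> - y \<longrightarrow> ?\<beta>' b = - b
      else if b = - y then ?\<beta>' a = - a else a \<noteq> y \<and> a \<noteq> - y \<longrightarrow> ?\<beta>' a = b"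
      using ends by (auto split: if_splits)
  qed
  then show ?thesis by (rule normal_form_bottom[OF f f' m top])
qed

lemma normal_form_single:
  assumes f: "signed_matching n f" and m: "normal_form f m" and x: "x \<in> signed_points n"
  shows "normal_form (hook_act x (- x) f) (m * single x)"
proof -
  let ?f' = "hook_act x (- x) f"
  let ?T = "row_points n Inl f" and ?\<alpha> = "row_partner Inl f" and ?B = "row_points n Inr f" and ?\<beta> = "row_partner Inr f"
  let ?T' = "row_points n Inl ?f'" and ?\<alpha>' = "row_partner Inl ?f'" and ?B' = "row_points n Inr ?f'" and ?\<beta>' = "row_partner Inr ?f'"
  note nx = signed_points_neq[OF x]
  have f': "signed_matching n ?f'" by (rule signed_matching_hook_act[OF f]) (use x nx in auto)
  note D = signed_matchingD[OF f] and R = signed_matching_rows[OF f] and iff = row_points_iff[OF f] and iff' = row_points_iff[OF f']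
  show ?thesis
  proof (cases "f (Inr x)")
    case (Inl u)
    note fx = this
    have f_eqs: "f (Inr (- x)) = Inl (- u)" "f (Inl u) = Inr x" "f (Inl (- u)) = Inr (- x)"
      using R(5,6)[OF fx] R(8)[OF R(5)[OF fx]] by simp_all
    have u: "u \<in> signed_points n" using signed_matching_points(3)[OF f f_eqs(2)] x by auto
    note nu = signed_points_neq[OF u]
    have bot: "?f' (Inr w) = (if w = x then Inr (- x) else if w = - x then Inr x else f (Inr w))" for w
      using nx nu fx f_eqs by (auto simp: hook_act_def rejoin_def)
    have top: "?f' (Inl w) = (if w = u then Inl (- u) else if w = - u then Inl u else f (Inl w))" for w
      using nx nu fx f_eqs by (auto simp: hook_act_def rejoin_def)
    obtain g where g: "signed_perm n g" "\<And>a b. f (Inl a) = Inr b \<Longrightarrow> g a = b"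
      "m = hook_prod ?T ?\<alpha> * rep g * bottom_half ?B ?\<beta>"
      using m unfolding normal_form_def by blast
    have uT: "u \<in> ?T'" "?\<alpha>' u = - u" and xB: "x \<in> ?B'" "?\<beta>' x = - x" by (auto simp: iff' top bot)
    have T: "?T' - {u, - u, - u, - (- u)} = ?T" and B: "?B' - {x, - x, - x, - (- x)} = ?B"
      by (auto simp: iff iff' top bot f_eqs fx split: if_splits)
    have E: "hook_prod ?T' ?\<alpha>' = hook_prod ?T ?\<alpha> * single u"
    proof -
      have "hook_prod ?T ?\<alpha>' = hook_prod ?T ?\<alpha>"
        by (intro hook_prod_cong row_partner_cong) (auto simp: top iff f_eqs)
      then show ?thesis using hook_prod_remove(1)[OF signed_pairing_top[OF f'] uT, unfolded T] by simp
    qed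
    have F: "bottom_half ?B' ?\<beta>' = bottom_half ?B ?\<beta> * single x"
    proof -
      have "bottom_half ?B ?\<beta>' = bottom_half ?B ?\<beta>"
        by (intro bottom_half_cong row_partner_cong) (auto simp: bot iff f_eqs fx)
      then show ?thesis using bottom_half_remove[OF signed_pairing_bottom[OF f'] xB, unfolded B] blk_single[OF x] by simp
    qed
    have move: "single u * rep g = rep g * single x"
      using hook_move[OF u _ nu(2) g(1)] u g(2)[OF f_eqs(2)] signed_perm_uminus[OF g(1), of u] by simp
    have comm: "bottom_half ?B ?\<beta> * single x = single x * bottom_half ?B ?\<beta>"
      using x nx by (intro bottom_half_commute[OF signed_pairing_bottom[OF f]]) (auto simp: iff fx f_eqs)
    have "hook_prod ?T' ?\<alpha>' * rep g * bottom_half ?B' ?\<beta>' = hook_prod ?T ?\<alpha> * (single u * rep g) * (bottom_half ?B ?\<beta> * single x)"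
      by (simp only: E F mult.assoc)
    also have "\<dots> = hook_prod ?T ?\<alpha> * rep g * (bottom_half ?B ?\<beta> * single x) * single x"
      by (rule pull_through[OF move comm])
    also have "\<dots> = m * single x"
      by (simp only: g(3) mult.assoc single_idem(1)[OF x])
    finally have "m * single x = hook_prod ?T' ?\<alpha>' * rep g * bottom_half ?B' ?\<beta>'" by simp
    moreover have "g a = b" if "?f' (Inl a) = Inr b" for a b
      using that g(2)[of a b] by (auto simp: top split: if_splits)
    ultimately show ?thesis unfolding normal_form_def using g(1) by blast
  next
    case (Inr a)
    note fx = this
    have f_eqs: "f (Inr (- x)) = Inr (- a)" "f (Inr a) = Inr x" "f (Inr (- a)) = Inr (- x)"
      using R(1,2)[OF fx] R(2)[OF R(1)[OF fx]] by simp_all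
    have a: "a \<in> signed_points n" "a \<noteq> x"
      using signed_matching_points(1)[OF f f_eqs(2)] D(5)[of "Inr x"] fx by auto
    note na = signed_points_neq[OF a(1)]
    have top: "?f' (Inl w) = f (Inl w)" for w
      using D(4)[of "Inl w"] fx f_eqs by (auto simp: hook_act_def rejoin_def)
    have bot: "?f' (Inr x) = Inr (- x)" "?f' (Inr a) = Inr (- a)"
      using nx na a fx f_eqs by (auto simp: hook_act_def rejoin_def)
    have other: "?f' (Inr w) = f (Inr w)" if "w \<notin> {x, - x, a, - a}" for w
      using that fx f_eqs by (auto simp: hook_act_def rejoin_def)
    have B': "?B' = ?B"
    proof (rule Set.set_eqI)
      fix w
      have "w \<notin> row_points n Inr h \<longleftrightarrow> (\<exists>v. h (Inl v) = Inr w)" if h: "signed_matching n h" for h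
        using row_points_iff(2)[OF h, of w] by (cases "h (Inr w)") (auto dest: signed_matching_rows[OF h])
      from this[OF f] this[OF f'] show "w \<in> row_points n Inr ?f' \<longleftrightarrow> w \<in> ?B" by (auto simp: top)
    qed
    have "bottom_half ?B ?\<beta> * single x = bottom_half ?B ?\<beta>'"
    proof (rule bottom_half_single[OF signed_pairing_bottom[OF f]])
      show "signed_pairing n ?B ?\<beta>'" using signed_pairing_bottom[OF f'] by (simp add: B')
      show "x \<in> ?B" using fx by (auto simp: iff)
      show "?\<beta> x = a" "?\<beta>' x = - x" "?\<beta>' a = - a" using fx bot by simp_all
      show "?\<beta>' w = ?\<beta> w" if "w \<notin> {x, - x, a, - a}" for w
        by (rule row_partner_cong) (rule other[OF that])
    qed
    then show ?thesis by (rule normal_form_bottom[OF f f' m top])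
  qed
qed

theorem normal_form_hook:
  assumes f: "signed_matching n f" and m: "normal_form f m"
    and xy: "x \<in> signed_points n" "y \<in> signed_points n" "x \<noteq> y"
  shows "normal_form (hook_act x y f) (m * hook x y)"
proof (cases "y = - x")
  case True
  then show ?thesis using normal_form_single[OF f m xy(1)] by simp
next
  case False
  then have abs: "\<bar>x\<bar> \<noteq> \<bar>y\<bar>" "\<bar>y\<bar> \<noteq> \<bar>x\<bar>" using xy(3) by (auto simp: abs_eq_iff)
  show ?thesis
  proof (cases "f (Inr x)")
    case (Inl u)
    then show ?thesis
      using normal_form_hook_both_through[OF f m xy(1,2) abs(1)] normal_form_hook_one_through[OF f m xy(1,2) abs(1)]
      by (cases "f (Inr y)") auto
  next
    case (Inr a)
    show ?thesis
    proof (cases "f (Inr y)")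
      case (Inl u)
      then show ?thesis
        using normal_form_hook_one_through[OF f m xy(2,1) abs(2) Inl Inr] hook_sym[OF xy]
          hook_act_sym[OF signed_matchingD(1)[OF f] xy(3)] by simp
    next
      case (Inr b)
      then show ?thesis using normal_form_hook_none_through[OF f m xy(1,2) abs(1)] \<open>f (Inr x) = Inr a\<close> by simp
    qed
  qed
qed

end

section \<open>A criterion for presentations\<close>

definition word_class :: "'a set \<Rightarrow> ('a list \<times> 'a list) set \<Rightarrow> 'a list \<Rightarrow> 'a list set" where
  "word_class A R w = gen_congruence A R `` {w}"

lemma gen_congruence_lists:
  assumes "R \<subseteq> lists A \<times> lists A" "(u, v) \<in> gen_congruence A R"
  shows "u \<in> lists A \<and> v \<in> lists A"
  using assms(2) by induction (use assms(1) in auto)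

lemma gen_congruence_equiv:
  assumes "R \<subseteq> lists A \<times> lists A"
  shows "equiv (lists A) (gen_congruence A R)"
proof (rule equivI)
  show "gen_congruence A R \<subseteq> lists A \<times> lists A" using gen_congruence_lists[OF assms] by auto
  show "refl_on (lists A) (gen_congruence A R)" by (auto simp: refl_on_def intro: gen_congruence.refl)
  show "Relation.sym (gen_congruence A R)" by (auto simp: sym_def intro: gen_congruence.sym)
  show "Relation.trans (gen_congruence A R)" by (auto simp: trans_def intro: gen_congruence.trans)
qed

lemma gen_congruence_append:
  assumes R: "R \<subseteq> lists A \<times> lists A"
    and "(u, u') \<in> gen_congruence A R" "(v, v') \<in> gen_congruence A R"
  shows "(u @ v, u' @ v') \<in> gen_congruence A R"
proof -
  have "(u @ v, u' @ v) \<in> gen_congruence A R"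
    using gen_congruence.append[OF assms(2), of "[]" v] gen_congruence_lists[OF R assms(3)] by simp
  moreover have "(u' @ v, u' @ v') \<in> gen_congruence A R"
    using gen_congruence.append[OF assms(3), of u' "[]"] gen_congruence_lists[OF R assms(2)] by simp
  ultimately show ?thesis by (rule gen_congruence.trans)
qed

lemma word_class_eq_iff:
  assumes "R \<subseteq> lists A \<times> lists A" "u \<in> lists A" "v \<in> lists A"
  shows "word_class A R u = word_class A R v \<longleftrightarrow> (u, v) \<in> gen_congruence A R"
  unfolding word_class_def using eq_equiv_class_iff[OF gen_congruence_equiv[OF assms(1)] assms(2,3)] .

lemma word_class_self: "w \<in> lists A \<Longrightarrow> w \<in> word_class A R w"
  by (simp add: word_class_def gen_congruence.refl)

lemma word_class_Union:
  assumes R: "R \<subseteq> lists A \<times> lists A" and "u \<in> lists A" "v \<in> lists A"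
  shows "(\<Union>u'\<in>word_class A R u. \<Union>v'\<in>word_class A R v. gen_congruence A R `` {u' @ v'}) = word_class A R (u @ v)"
proof -
  have "gen_congruence A R `` {u' @ v'} = word_class A R (u @ v)"
    if uv: "u' \<in> word_class A R u" "v' \<in> word_class A R v" for u' v'
  proof -
    have "(u @ v, u' @ v') \<in> gen_congruence A R"
      using uv by (intro gen_congruence_append[OF R]) (auto simp: word_class_def)
    then show ?thesis
      unfolding word_class_def using equiv_class_eq[OF gen_congruence_equiv[OF R]] by metis
  qed
  then show ?thesis using word_class_self[OF assms(2)] word_class_self[OF assms(3)] by fastforce
qed

text \<open>The map from words to \<open>M\<close> is determined by its values on letters. It
  induces the required isomorphism if it respects the relations, reaches every element, and
  identifies only congruent words.\<close>
theorem is_presentationI: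
  fixes M (structure)
  assumes M: "monoid M" and R: "R \<subseteq> lists A \<times> lists A"
    and closed: "\<And>a. a \<in> A \<Longrightarrow> f a \<in> carrier M"
    and ev: "ev = (\<lambda>w. foldr (\<lambda>a m. f a \<otimes> m) w \<one>)"
    and relations: "\<And>u v. (u, v) \<in> R \<Longrightarrow> ev u = ev v"
    and generates: "\<And>x. x \<in> carrier M \<Longrightarrow> \<exists>w\<in>lists A. ev w = x"
    and complete: "\<And>u v. u \<in> lists A \<Longrightarrow> v \<in> lists A \<Longrightarrow> ev u = ev v \<Longrightarrow> (u, v) \<in> gen_congruence A R"
  shows "is_presentation A R M f"
proof -
  interpret monoid M by (rule M)
  let ?cls = "word_class A R" and ?P = "presented_monoid A R"
  have ev_closed: "ev w \<in> carrier M" if "w \<in> lists A" for w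
    using that closed unfolding ev by (induction w) auto
  have ev_append: "ev (u @ v) = ev u \<otimes> ev v" if "u \<in> lists A" "v \<in> lists A" for u v
    using that(1)
  proof (induction u)
    case Nil
    then show ?case using ev_closed[OF that(2)] by (simp add: ev)
  next
    case (Cons a u)
    then show ?case using closed ev_closed[of u] ev_closed[OF that(2)] by (simp add: ev m_assoc)
  qed
  have sound: "ev u = ev v" if "(u, v) \<in> gen_congruence A R" for u v
    using that
  proof induction
    case (append u v x y)
    have "u \<in> lists A" "v \<in> lists A" using gen_congruence_lists[OF R append.hyps(1)] by auto
    then show ?case using append by (simp add: ev_append)
  qed (use relations in auto)
  define h where "h C = ev (SOME w. w \<in> C)" for C
  have h: "h (?cls w) = ev w" if "w \<in> lists A" for w
  proof -
    have "(SOME v. v \<in> ?cls w) \<in> ?cls w" using word_class_self[OF that] by (rule someI)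
    then show ?thesis using sound unfolding h_def word_class_def by fastforce
  qed
  have carrier: "carrier ?P = ?cls ` lists A"
    by (auto simp: presented_monoid_def quotient_def word_class_def)
  have carrierE: "\<exists>w\<in>lists A. C = ?cls w" if "C \<in> carrier ?P" for C
    using that unfolding carrier by (rule imageE) (rule bexI)
  have mult: "?cls u \<otimes>\<^bsub>?P\<^esub> ?cls v = ?cls (u @ v)" if "u \<in> lists A" "v \<in> lists A" for u v
    using word_class_Union[OF R that] by (simp add: presented_monoid_def)
  have "h \<in> iso ?P M"
  proof (rule isoI)
    show "h \<in> hom ?P M"
    proof (rule homI)
      fix C D assume "C \<in> carrier ?P" "D \<in> carrier ?P"
      then obtain u v where uv: "u \<in> lists A" "C = ?cls u" "v \<in> lists A" "D = ?cls v"
        by (meson carrierE)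
      have "u @ v \<in> lists A" using uv(1,3) by simp
      then show "h (C \<otimes>\<^bsub>?P\<^esub> D) = h C \<otimes> h D"
        unfolding uv(2,4) mult[OF uv(1,3)] h[OF uv(1)] h[OF uv(3)] by (simp only: h ev_append[OF uv(1,3)])
      show "h C \<in> carrier M" unfolding uv(2) h[OF uv(1)] by (rule ev_closed[OF uv(1)])
    qed
    show "bij_betw h (carrier ?P) (carrier M)"
      unfolding bij_betw_def
    proof
      show "inj_on h (carrier ?P)"
      proof (rule inj_onI)
        fix C D assume "C \<in> carrier ?P" "D \<in> carrier ?P" and eq: "h C = h D"
        then obtain u v where uv: "u \<in> lists A" "C = ?cls u" "v \<in> lists A" "D = ?cls v"
          by (meson carrierE)
        then have "ev u = ev v" using eq h[OF uv(1)] h[OF uv(3)] by (simp only:)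
        then have "(u, v) \<in> gen_congruence A R" by (rule complete[OF uv(1,3)])
        then show "C = D" unfolding uv(2,4) using word_class_eq_iff[OF R uv(1,3)] by (simp only:)
      qed
      show "h ` carrier ?P = carrier M"
      proof (intro subset_antisym subsetI)
        fix x assume "x \<in> h ` carrier ?P"
        then obtain C where C: "C \<in> carrier ?P" "x = h C" by (rule imageE) blast
        then obtain w where "w \<in> lists A" "x = h (?cls w)" using carrierE[OF C(1)] by blast
        then show "x \<in> carrier M" using ev_closed h by metis
      next
        fix x assume "x \<in> carrier M"
        then obtain w where w: "w \<in> lists A" "ev w = x" using generates by blast
        then have "x = h (?cls w)" using h[OF w(1)] by (simp only:)
        moreover have "?cls w \<in> carrier ?P" unfolding carrier using w(1) by (rule imageI)
        ultimately show "x \<in> h ` carrier ?P" by (rule image_eqI)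
      qed
    qed
  qed
  moreover have "h (gen_congruence A R `` {[a]}) = f a" if "a \<in> A" for a
    using h[of "[a]"] that closed[OF that] by (simp add: word_class_def ev)
  ultimately show ?thesis unfolding is_presentation_def using M R by blast
qed

section \<open>The right action on word classes\<close>

text \<open>The operator acts on classes through a representative; the choice is harmless because
  the relation is a congruence. Sets that are not classes are left alone, since operators have to be
  total.\<close>
definition append_letter :: "'a set \<Rightarrow> ('a list \<times> 'a list) set \<Rightarrow> 'a \<Rightarrow> 'a list set endo" where
  "append_letter A R a = Endo (\<lambda>C. if C \<in> word_class A R ` lists A then word_class A R ((SOME w. w \<in> C) @ [a]) else C)"

lemma append_letters_class:
  assumes R: "R \<subseteq> lists A \<times> lists A"
  shows "u \<in> lists A \<Longrightarrow> w \<in> lists A \<Longrightarrow>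
    apply_endo (prod_list (map (append_letter A R) w)) (word_class A R u) = word_class A R (u @ w)"
proof (induction w arbitrary: u)
  case (Cons a w)
  let ?v = "SOME v. v \<in> word_class A R u"
  have "?v \<in> word_class A R u" using word_class_self[OF Cons.prems(1)] by (rule someI)
  then have "(u, ?v) \<in> gen_congruence A R" by (simp add: word_class_def)
  then have "(u @ [a], ?v @ [a]) \<in> gen_congruence A R"
    using Cons.prems by (intro gen_congruence_append[OF R] gen_congruence.refl) auto
  then have "word_class A R (?v @ [a]) = word_class A R (u @ [a])"
    using gen_congruence_lists[OF R] word_class_eq_iff[OF R] by metis
  then have "apply_endo (append_letter A R a) (word_class A R u) = word_class A R (u @ [a])"
    using Cons.prems by (simp add: append_letter_def)
  then show ?case using Cons.IH[of "u @ [a]"] Cons.prems by simp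
qed simp

lemma append_letters_other:
  "C \<notin> word_class A R ` lists A \<Longrightarrow> apply_endo (prod_list (map (append_letter A R) w)) C = C"
  by (induction w) (auto simp: append_letter_def)

text \<open>On classes of words this is the congruence property, on all other sets both sides are
  the identity.\<close>
lemma append_letter_relations:
  assumes R: "R \<subseteq> lists A \<times> lists A" and uv: "(u, v) \<in> R"
  shows "prod_list (map (append_letter A R) u) = prod_list (map (append_letter A R) v)"
proof -
  have l: "u \<in> lists A" "v \<in> lists A" using assms by auto
  have "apply_endo (prod_list (map (append_letter A R) u)) C = apply_endo (prod_list (map (append_letter A R) v)) C" for C
  proof (cases "C \<in> word_class A R ` lists A")
    case True
    then obtain w where w: "C = word_class A R w" "w \<in> lists A" by blast
    have "(w @ u, w @ v) \<in> gen_congruence A R"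
      using w uv by (intro gen_congruence_append[OF R] gen_congruence.refl gen_congruence.base)
    then show ?thesis
      using append_letters_class[OF R w(2)] l word_class_eq_iff[OF R] w by simp
  qed (simp add: append_letters_other)
  then show ?thesis by (metis apply_endo_inject ext)
qed

text \<open>Applied to the class of the empty word, a product of these operators gives the class of
  the word.\<close>
lemma append_letter_faithful:
  assumes R: "R \<subseteq> lists A \<times> lists A" and "u \<in> lists A" "v \<in> lists A"
    and "prod_list (map (append_letter A R) u) = prod_list (map (append_letter A R) v)"
  shows "(u, v) \<in> gen_congruence A R"
proof -
  have "word_class A R u = word_class A R v"
    using append_letters_class[OF R, of "[]" u] append_letters_class[OF R, of "[]" v] assms(2-4) by simp
  then show ?thesis using word_class_eq_iff[OF R assms(2,3)] by blast
qed

section \<open>Brauer diagrams as symmetric matchings\<close>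

definition vertices :: "nat \<Rightarrow> (int + int) set" where
  "vertices n = signed_points n <+> signed_points n"

lemma vertices_iff [simp]:
  "Inl x \<in> vertices n \<longleftrightarrow> x \<in> signed_points n" "Inr x \<in> vertices n \<longleftrightarrow> x \<in> signed_points n"
  by (auto simp: vertices_def)

definition diagram_of :: "nat \<Rightarrow> (int + int \<Rightarrow> int + int) \<Rightarrow> int diagram" where
  "diagram_of n f = (\<lambda>u. {u, f u}) ` vertices n"

lemma flip_vertices [simp]: "flip u \<in> vertices n \<longleftrightarrow> u \<in> vertices n"
  by (cases u) auto

lemma signed_matching_vertices:
  assumes f: "signed_matching n f" shows "f u \<in> vertices n \<longleftrightarrow> u \<in> vertices n"
proof -
  note D = signed_matchingD[OF f]
  have out: "f u \<notin> vertices n" if u: "u \<notin> vertices n" for u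
  proof (cases u)
    case (Inl x)
    then show ?thesis using u D(3)[of x] by auto
  next
    case (Inr x)
    then have "f (Inl x) = Inr x" using u D(3)[of x] by auto
    then have "f u = Inl x" using D(4)[of "Inl x"] Inr by simp
    then show ?thesis using u Inr by auto
  qed
  from out[of u] out[of "f u"] show ?thesis unfolding D(4) by blast
qed

lemma signed_matching_outside:
  assumes f: "signed_matching n f" and "u \<notin> vertices n" shows "f u = strand u"
proof (cases u)
  case (Inl x)
  then show ?thesis using assms signed_matchingD(3)[OF f, of x] by auto
next
  case (Inr x)
  then have "f (Inl x) = Inr x" using assms signed_matchingD(3)[OF f, of x] by auto
  then show ?thesis using signed_matchingD(4)[OF f, of "Inl x"] Inr by simp
qed

lemma diagram_of_inj:
  assumes f: "signed_matching n f" and g: "signed_matching n g" and "diagram_of n f = diagram_of n g"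
  shows "f = g"
proof
  fix u show "f u = g u"
  proof (cases "u \<in> vertices n")
    case True
    then have "{u, f u} \<in> diagram_of n g" using assms(3) by (auto simp: diagram_of_def)
    then obtain v where "{u, f u} = {v, g v}" by (auto simp: diagram_of_def)
    then show ?thesis
      using signed_matchingD(4)[OF g, of v] signed_matchingD(5)[OF f, of u] by (auto simp: doubleton_eq_iff)
  next
    case False
    then show ?thesis using signed_matching_outside[OF f] signed_matching_outside[OF g] by simp
  qed
qed

lemma diagram_of_carrier:
  assumes f: "signed_matching n f" shows "diagram_of n f \<in> carrier (brauer_monoid_B n)"
proof -
  note D = signed_matchingD[OF f] and V = signed_matching_vertices[OF f]
  have "partition_on (vertices n) (diagram_of n f)"
  proof (rule partition_onI)
    show "\<Union> (diagram_of n f) = vertices n"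
      by (auto simp: diagram_of_def V)
    fix B C assume "B \<in> diagram_of n f" "C \<in> diagram_of n f" "B \<noteq> C"
    then obtain u v where uv: "B = {u, f u}" "C = {v, f v}" by (auto simp: diagram_of_def)
    have "{a, f a} = {w, f w}" if "w \<in> {a, f a}" for a w using that by (auto simp: D(4))
    then have "B = C" if "w \<in> B" "w \<in> C" for w using that uv by metis
    then show "disjnt B C" using \<open>B \<noteq> C\<close> by (auto simp: disjnt_def)
  next
    show "{} \<notin> diagram_of n f" by (auto simp: diagram_of_def)
  qed
  moreover have "card B = 2" if B: "B \<in> diagram_of n f" for B
  proof -
    obtain u where "B = {u, f u}" using B by (auto simp: diagram_of_def)
    then show ?thesis using D(5)[of u] by (metis card_2_iff)
  qed
  moreover have "swap_diagram (diagram_of n f) = diagram_of n f"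
  proof -
    have "swap_diagram (diagram_of n f) = (\<lambda>u. {u, f u}) ` flip ` vertices n"
      by (simp add: swap_diagram_def diagram_of_def image_image D(2))
    also have "flip ` vertices n = vertices n"
    proof (rule Set.set_eqI)
      fix u
      have "flip (flip u) = u" by (cases u) simp_all
      then show "u \<in> flip ` vertices n \<longleftrightarrow> u \<in> vertices n" by (metis flip_vertices image_iff)
    qed
    finally show ?thesis by (simp add: diagram_of_def)
  qed
  ultimately show ?thesis by (simp add: brauer_monoid_B_def brauer_monoid_def brauer_diagrams_def vertices_def)
qed

lemma carrier_diagram_of:
  assumes "d \<in> carrier (brauer_monoid_B n)"
  obtains f where "signed_matching n f" "d = diagram_of n f"
proof -
  have part: "partition_on (vertices n) d" and card: "\<And>B. B \<in> d \<Longrightarrow> card B = 2" and swap: "swap_diagram d = d"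
    using assms by (auto simp: brauer_monoid_B_def brauer_monoid_def brauer_diagrams_def vertices_def)
  have same_block: "B = C" if "B \<in> d" "C \<in> d" "u \<in> B" "u \<in> C" for B C u
    using part that unfolding partition_on_def disjoint_def by (metis disjoint_iff)
  have uniq: "\<exists>!v. v \<noteq> u \<and> {u, v} \<in> d" if u: "u \<in> vertices n" for u
  proof -
    have "u \<in> \<Union> d" using part u by (simp add: partition_on_def)
    then obtain B where B: "B \<in> d" "u \<in> B" by blast
    obtain a b where ab: "B = {a, b}" "a \<noteq> b" using card[OF B(1)] by (meson card_2_iff)
    then obtain v where v: "B = {u, v}" "v \<noteq> u" using B(2) by (metis doubleton_eq_iff insertE singletonD)
    show ?thesis
    proof (rule ex1I[of _ v])
      show "v \<noteq> u \<and> {u, v} \<in> d" using v B by simp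
      fix w assume w: "w \<noteq> u \<and> {u, w} \<in> d"
      then have "{u, w} = {u, v}" using same_block[of "{u, w}" B u] B v(1) by simp
      then show "w = v" using w by (simp add: doubleton_eq_iff)
    qed
  qed
  define f where "f u = (if u \<in> vertices n then THE v. v \<noteq> u \<and> {u, v} \<in> d else strand u)" for u
  have f: "f u \<noteq> u" "{u, f u} \<in> d" if "u \<in> vertices n" for u
    using theI'[OF uniq[OF that]] that by (simp_all add: f_def)
  have f_eq: "f u = v" if "u \<in> vertices n" "v \<noteq> u" "{u, v} \<in> d" for u v
    using uniq[OF that(1)] f[OF that(1)] that by blast
  have sub: "B \<subseteq> vertices n" if "B \<in> d" for B using part that by (auto simp: partition_on_def)
  have f_in: "f u \<in> vertices n" if "u \<in> vertices n" for u using sub[OF f(2)[OF that]] by simp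
  have ff: "f (f u) = u" if "u \<in> vertices n" for u
    using f[OF that] f_in[OF that] by (intro f_eq) (auto simp: insert_commute)
  have out: "f u = strand u" "strand u \<notin> vertices n" if "u \<notin> vertices n" for u
    using that by (cases u; auto simp: f_def)+
  have flip_eq: "flip a = flip b \<longleftrightarrow> a = b" for a b by (cases a; cases b) auto
  have fflip: "f (flip u) = flip (f u)" for u
  proof (cases "u \<in> vertices n")
    case True
    have "flip ` {u, f u} \<in> d" using swap f(2)[OF True] unfolding swap_diagram_def by blast
    then show ?thesis using True f(1)[OF True] by (intro f_eq) (auto simp: flip_eq)
  next
    case False
    then have "f (flip u) = strand (flip u)" "f u = strand u" by (auto intro!: out)
    then show ?thesis by (cases u) auto
  qed
  have "matching f"
    unfolding matching_def
  proof
    fix u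
    show "f (f u) = u \<and> f u \<noteq> u"
    proof (cases "u \<in> vertices n")
      case True
      then show ?thesis using f ff by auto
    next
      case False
      then show ?thesis
        using out[of u] out[of "strand u"] matchingD(1,2)[OF matching_strand, of u] by simp
    qed
  qed
  then have "signed_matching n f"
    unfolding signed_matching_def using fflip out by auto
  moreover have "d = diagram_of n f"
  proof (intro subset_antisym subsetI)
    fix B assume B: "B \<in> d"
    obtain u v where uv: "B = {u, v}" "u \<noteq> v" using card[OF B] by (meson card_2_iff)
    then have "u \<in> vertices n" using sub[OF B] by auto
    moreover have "f u = v" using uv B \<open>u \<in> vertices n\<close> by (intro f_eq) auto
    ultimately show "B \<in> diagram_of n f" using uv by (auto simp: diagram_of_def)
  qed (auto simp: diagram_of_def f)
  ultimately show ?thesis by (rule that)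
qed

text \<open>Translates the vertices of a concatenated diagram into the row numbering of
  \<open>stack_comp\<close>.\<close>
definition row_node :: "'v + 'v + 'v \<Rightarrow> nat \<times> 'v" where
  "row_node = case_sum (Pair 0) (case_sum (Pair 1) (Pair 2))"

lemma matching_rel_block:
  assumes "matching f" "s \<in> {w, f w}" "t \<in> {w, f w}" shows "(s, t) \<in> matching_rel f"
  using assms(2,3) matchingD(1)[OF assms(1), of w] by (auto simp: matching_rel_def)

lemma place_vertices:
  assumes "(a, b) \<in> place k l r" "\<And>k l u. emb k l u \<in> V \<longleftrightarrow> u \<in> W" "a \<in> V"
  shows "\<exists>s t. (s, t) \<in> r \<and> a = emb k l s \<and> b = emb k l t \<and> s \<in> W"
  using assms unfolding place_def by blast

text \<open>For \<open>a\<close> in \<open>W\<close> the component of \<open>j a\<close> is a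
  reachability class; by assumption it meets the image of \<open>j\<close> in \<open>j a\<close> and
  \<open>j (h a)\<close>. Components that miss this image give the empty set, which is
  removed.\<close>
lemma preimages_of_components:
  fixes S :: "'a set set" and j :: "'b \<Rightarrow> 'a" and h :: "'b \<Rightarrow> 'b"
  assumes field: "\<And>a. j a \<in> \<Union> S \<longleftrightarrow> a \<in> W"
    and outer: "\<And>a b. a \<in> W \<Longrightarrow> (j a, j b) \<in> {(u, v). \<exists>B\<in>S. u \<in> B \<and> v \<in> B}\<^sup>* \<longleftrightarrow> b = a \<or> b = h a"
  shows "{j -` C | C. C \<in> \<Union> S // {(u, v). \<exists>B\<in>S. u \<in> B \<and> v \<in> B}\<^sup>+} - {{}} = (\<lambda>a. {a, h a}) ` W"
proof -
  define R where "R = {(u, v). \<exists>B\<in>S. u \<in> B \<and> v \<in> B}"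
  have sym_R: "Relation.sym R" unfolding R_def by (rule symI) blast
  have sym: "(v, w) \<in> R\<^sup>*" if "(w, v) \<in> R\<^sup>*" for v w
    using symD[OF sym_rtrancl[OF sym_R] that] .
  have R_field: "v \<in> \<Union> S" if "(u, v) \<in> R" for u v using that unfolding R_def by blast
  have refl_R: "(u, u) \<in> R" if "u \<in> \<Union> S" for u using that unfolding R_def by blast
  have trancl: "(u, v) \<in> R\<^sup>+ \<longleftrightarrow> (u, v) \<in> R\<^sup>*" if "u \<in> \<Union> S" for u v
    using refl_R[OF that] by (metis r_into_trancl' rtrancl_eq_or_trancl)
  have outer': "(j a, j b) \<in> R\<^sup>* \<longleftrightarrow> b = a \<or> b = h a" if "a \<in> W" for a b
    unfolding R_def by (rule outer[OF that])
  have class_of: "j -` (R\<^sup>+ `` {j a}) = {a, h a}" if a: "a \<in> W" for a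
  proof -
    have "j a \<in> \<Union> S" using a field by blast
    then show ?thesis using trancl[of "j a"] outer'[OF a] by auto
  qed
  have "{j -` C | C. C \<in> \<Union> S // R\<^sup>+} - {{}} = (\<lambda>a. {a, h a}) ` W"
  proof (intro subset_antisym subsetI)
    fix B assume B: "B \<in> {j -` C | C. C \<in> \<Union> S // R\<^sup>+} - {{}}"
    then obtain C where C: "C \<in> \<Union> S // R\<^sup>+" "B = j -` C" "B \<noteq> {}" by blast
    then obtain u where u: "u \<in> \<Union> S" "C = R\<^sup>+ `` {u}" by (meson quotientE)
    from C(3) obtain a where "a \<in> B" by blast
    then have a: "(u, j a) \<in> R\<^sup>+" using C(2) u(2) by simp
    then have "j a \<in> \<Union> S" using R_field by (meson tranclE)
    then have aW: "a \<in> W" using field by blast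
    have "(u, v) \<in> R\<^sup>+ \<longleftrightarrow> (j a, v) \<in> R\<^sup>+" for v
      using a trancl[OF u(1)] trancl[OF \<open>j a \<in> \<Union> S\<close>] sym[of u "j a"] by (meson rtrancl_trans)
    then have "C = R\<^sup>+ `` {j a}" unfolding u(2) by blast
    then have "B = {a, h a}" using class_of[OF aW] C(2) by simp
    then show "B \<in> (\<lambda>a. {a, h a}) ` W" using aW by blast
  next
    fix B assume "B \<in> (\<lambda>a. {a, h a}) ` W"
    then obtain a where a: "a \<in> W" "B = {a, h a}" by blast
    have "j a \<in> \<Union> S" using a(1) field by blast
    then have "R\<^sup>+ `` {j a} \<in> \<Union> S // R\<^sup>+" by (rule quotientI)
    moreover have "B = j -` (R\<^sup>+ `` {j a})" using class_of[OF a(1)] a(2) by simp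
    ultimately show "B \<in> {j -` C | C. C \<in> \<Union> S // R\<^sup>+} - {{}}" using a(2) by blast
  qed
  then show ?thesis unfolding R_def .
qed

text \<open>On the vertices of the points, sharing a block is the relation of the stack of the two
  matchings, and outside them both matchings are vertical, so paths between points never leave the
  points. Components therefore agree with the classes of the product in
  \<open>partn\<close>.\<close>
lemma diagram_mult_diagram_of:
  assumes f: "signed_matching n f" and g: "signed_matching n g" and h: "signed_matching n h"
    and fgh: "matching_diagram f * matching_diagram g = matching_diagram h"
  shows "diagram_mult (diagram_of n f) (diagram_of n g) = diagram_of n h"
proof -
  let ?d = "diagram_of n f" and ?e = "diagram_of n g"
  let ?S = "stacked_blocks ?d ?e"
  let ?R = "{(u, v). \<exists>B\<in>?S. u \<in> B \<and> v \<in> B}"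
  define V :: "(nat \<times> int) set" where "V = {a. snd a \<in> signed_points n}"
  let ?F = "place 0 1 (matching_rel f) \<union> place 1 2 (matching_rel g)"
  let ?j = "map_sum id Inr :: int + int \<Rightarrow> int + int + int"
  note fD = signed_matchingD[OF f] and gD = signed_matchingD[OF g] and hD = signed_matchingD[OF h]
  have inj: "inj (row_node :: int + int + int \<Rightarrow> _)"
  proof (rule injI)
    fix u v :: "int + int + int" assume "row_node u = row_node v"
    then show "u = v"
      by (cases u; cases v; (cases "projr u"; cases "projr v")?) (auto simp: row_node_def split: sum.splits)
  qed
  have node: "row_node (map_sum id Inl u) = emb 0 1 u" "row_node (Inr u) = emb 1 2 u" "row_node (?j u) = emb 0 2 u" for u
    by (cases u; simp add: row_node_def)+
  have emb_V: "emb k l u \<in> V \<longleftrightarrow> u \<in> vertices n" for k l u by (cases u) (simp_all add: V_def)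
  have blocks: "map_sum id Inl ` {w, f w} \<in> ?S" "Inr ` {w, g w} \<in> ?S" if "w \<in> vertices n" for w
    using that unfolding stacked_blocks_def diagram_of_def by blast+
  have R_eq: "map_prod row_node row_node ` ?R = ?F \<inter> V \<times> V"
  proof -
    have "(a, b) \<in> map_prod row_node row_node ` ?R \<longleftrightarrow> (a, b) \<in> ?F \<inter> V \<times> V" for a b
    proof
      assume "(a, b) \<in> map_prod row_node row_node ` ?R"
      then obtain u v B where uv: "a = row_node u" "b = row_node v" "B \<in> ?S" "u \<in> B" "v \<in> B" by auto
      then consider w where "w \<in> vertices n" "B = map_sum id Inl ` {w, f w}" | w where "w \<in> vertices n" "B = Inr ` {w, g w}"
        by (auto simp: stacked_blocks_def diagram_of_def)
      then show "(a, b) \<in> ?F \<inter> V \<times> V"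
      proof cases
        case 1
        obtain s where s: "s \<in> {w, f w}" "u = map_sum id Inl s" using uv(4) unfolding 1(2) by (elim imageE) simp
        obtain t where t: "t \<in> {w, f w}" "v = map_sum id Inl t" using uv(5) unfolding 1(2) by (elim imageE) simp
        have st: "(s, t) \<in> matching_rel f" by (rule matching_rel_block[OF signed_matchingD(1)[OF f] s(1) t(1)])
        have V_st: "s \<in> vertices n" "t \<in> vertices n"
          using s(1) t(1) 1(1) signed_matching_vertices[OF f, of w] by (auto simp only: insert_iff empty_iff)
        have "a = emb 0 1 s" "b = emb 0 1 t" by (simp_all only: uv(1,2) s(2) t(2) node)
        then show ?thesis by (simp only:) (intro IntI SigmaI UnI1 place_edge[OF st] emb_V[THEN iffD2] V_st)
      next
        case 2
        obtain s where s: "s \<in> {w, g w}" "u = Inr s" using uv(4) unfolding 2(2) by (elim imageE) simp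
        obtain t where t: "t \<in> {w, g w}" "v = Inr t" using uv(5) unfolding 2(2) by (elim imageE) simp
        have st: "(s, t) \<in> matching_rel g" by (rule matching_rel_block[OF signed_matchingD(1)[OF g] s(1) t(1)])
        have V_st: "s \<in> vertices n" "t \<in> vertices n"
          using s(1) t(1) 2(1) signed_matching_vertices[OF g, of w] by (auto simp only: insert_iff empty_iff)
        have "a = emb 1 2 s" "b = emb 1 2 t" by (simp_all only: uv(1,2) s(2) t(2) node)
        then show ?thesis by (simp only:) (intro IntI SigmaI UnI2 place_edge[OF st] emb_V[THEN iffD2] V_st)
      qed
    next
      assume ab: "(a, b) \<in> ?F \<inter> V \<times> V"
      have aV: "a \<in> V" by (rule SigmaD1[OF IntD2[OF ab]])
      have F: "(a, b) \<in> place 0 1 (matching_rel f) \<or> (a, b) \<in> place 1 2 (matching_rel g)"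
        using IntD1[OF ab] by (simp only: Un_iff)
      have placed: "\<exists>s t. (s, t) \<in> r \<and> a = emb k l s \<and> b = emb k l t \<and> s \<in> vertices n"
        if "(a, b) \<in> place k l r" for k l r
        by (rule place_vertices[OF that emb_V aV])
      consider s t where "(s, t) \<in> matching_rel f" "a = emb 0 1 s" "b = emb 0 1 t" "s \<in> vertices n"
        | s t where "(s, t) \<in> matching_rel g" "a = emb 1 2 s" "b = emb 1 2 t" "s \<in> vertices n"
      proof (rule disjE[OF F])
        assume "(a, b) \<in> place 0 1 (matching_rel f)"
        from placed[OF this] show ?thesis using that(1) by blast
      next
        assume "(a, b) \<in> place 1 2 (matching_rel g)"
        from placed[OF this] show ?thesis using that(2) by blast
      qed
      then show "(a, b) \<in> map_prod row_node row_node ` ?R"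
      proof cases
        case 1
        have "t \<in> {s, f s}" using matching_relD[OF 1(1)] by simp
        then have "(map_sum id Inl s, map_sum id Inl t) \<in> ?R"
          by (intro CollectI case_prodI bexI[OF _ blocks(1)[OF 1(4)]] conjI imageI) simp_all
        from imageI[OF this, of "map_prod row_node row_node"] show ?thesis by (simp only: map_prod_simp node 1)
      next
        case 2
        have "t \<in> {s, g s}" using matching_relD[OF 2(1)] by simp
        then have "(Inr s, Inr t) \<in> ?R"
          by (intro CollectI case_prodI bexI[OF _ blocks(2)[OF 2(4)]] conjI imageI) simp_all
        from imageI[OF this, of "map_prod row_node row_node"] show ?thesis by (simp only: map_prod_simp node 2)
      qed
    qed
    then show ?thesis by (intro Set.set_eqI) (simp only: split_paired_all)
  qed
  have F_V: "a \<in> V \<longleftrightarrow> b \<in> V" if "(a, b) \<in> ?F" for a b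
    using that by (auto simp: place_def emb_V matching_rel_def signed_matching_vertices[OF f] signed_matching_vertices[OF g] simp del: emb_simps)
  have restrict: "(a, b) \<in> (?F \<inter> V \<times> V)\<^sup>* \<longleftrightarrow> (a, b) \<in> ?F\<^sup>*" if "a \<in> V" for a b
  proof
    show "(a, b) \<in> (?F \<inter> V \<times> V)\<^sup>* \<Longrightarrow> (a, b) \<in> ?F\<^sup>*" by (rule rtrancl_mono[THEN subsetD]) auto
    assume "(a, b) \<in> ?F\<^sup>*"
    then have "(a, b) \<in> (?F \<inter> V \<times> V)\<^sup>* \<and> b \<in> V"
    proof (induction rule: rtrancl_induct)
      case (step v w)
      then have "(v, w) \<in> ?F \<inter> V \<times> V" using F_V by blast
      then show ?case using step by (meson IntD2 SigmaD2 rtrancl_into_rtrancl)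
    qed (use that in simp)
    then show "(a, b) \<in> (?F \<inter> V \<times> V)\<^sup>*" ..
  qed
  have outer: "(?j a, ?j b) \<in> ?R\<^sup>* \<longleftrightarrow> b = a \<or> b = h a" if a: "a \<in> vertices n" for a b
  proof -
    have "(?j a, ?j b) \<in> ?R\<^sup>* \<longleftrightarrow> (emb 0 2 a, emb 0 2 b) \<in> ?F\<^sup>*"
      using rtrancl_map_inj[OF inj, of "?j a" "?j b" ?R] restrict[of "emb 0 2 a" "emb 0 2 b"] a
      unfolding R_eq node emb_V by simp
    also have "\<dots> \<longleftrightarrow> (a, b) \<in> matching_rel h"
      using arg_cong[OF fgh, of related] by (auto simp: related_mult related_matching fD(1) gD(1) hD(1) stack_comp_def)
    finally show ?thesis by (simp add: matching_rel_def)
  qed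
  have field: "?j a \<in> \<Union> ?S \<longleftrightarrow> a \<in> vertices n" for a
  proof
    assume "?j a \<in> \<Union> ?S"
    then have "(?j a, ?j a) \<in> ?R" by blast
    then have "(emb 0 2 a, emb 0 2 a) \<in> ?F \<inter> V \<times> V" unfolding R_eq[symmetric] node(3)[symmetric] by force
    then show "a \<in> vertices n" by (auto simp: emb_V simp del: emb_simps)
  next
    assume a: "a \<in> vertices n"
    show "?j a \<in> \<Union> ?S"
    proof (cases a)
      case (Inl x)
      then have "map_sum id Inl ` {a, f a} \<in> ?S" "?j a \<in> map_sum id Inl ` {a, f a}"
        using blocks(1)[OF a] by auto
      then show ?thesis by blast
    next
      case (Inr x)
      then have "Inr ` {a, g a} \<in> ?S" "?j a \<in> Inr ` {a, g a}"
        using blocks(2)[OF a] by auto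
      then show ?thesis by blast
    qed
  qed
  show ?thesis
    unfolding diagram_mult_def stacked_components_def diagram_of_def[of n h]
    by (rule preimages_of_components[OF field outer])
qed

lemma diagram_of_relabel:
  assumes p: "signed_perm n p"
  shows "diagram_of n (relabel p strand) = perm_diagram (signed_points n) p"
proof (intro subset_antisym subsetI)
  have top: "relabel p strand (Inl x) = Inr (p x)" for x by (simp add: relabel_def)
  have bot: "relabel p strand (Inr (p x)) = Inl x" for x using p by (simp add: relabel_def)
  fix B
  {
    assume "B \<in> diagram_of n (relabel p strand)"
    then obtain u where u: "u \<in> vertices n" "B = {u, relabel p strand u}" by (auto simp: diagram_of_def)
    show "B \<in> perm_diagram (signed_points n) p"
    proof (cases u)
      case (Inl x)
      then show ?thesis using u top by (auto simp: perm_diagram_def)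
    next
      case (Inr y)
      obtain x where y: "y = p x" using signed_perm_inverse_simps(1)[OF p] by metis
      have "B = {Inl x, Inr (p x)}" using u Inr bot y by (simp add: insert_commute)
      moreover have "x \<in> signed_points n" using u Inr y p by simp
      ultimately show ?thesis by (auto simp: perm_diagram_def)
    qed
  next
    assume "B \<in> perm_diagram (signed_points n) p"
    then obtain x where "x \<in> signed_points n" "B = {Inl x, Inr (p x)}" by (auto simp: perm_diagram_def)
    then have "Inl x \<in> vertices n" "B = {Inl x, relabel p strand (Inl x)}" by (simp_all add: top)
    then show "B \<in> diagram_of n (relabel p strand)" unfolding diagram_of_def by blast
  }
qed

lemma relabel_id_strand: "relabel id strand = (strand :: int + int \<Rightarrow> int + int)"
  by (rule matching_fun_eqI) (simp_all add: relabel_def)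

lemma diagram_of_strand: "diagram_of n strand = perm_diagram (signed_points n) id"
  using diagram_of_relabel[of n id] by (simp add: relabel_id_strand)

lemma signed_matching_strand: "signed_matching n strand"
proof -
  have "strand (flip u) = flip (strand u)" for u by (cases u) simp_all
  then show ?thesis by (simp add: signed_matching_def matching_strand)
qed

lemma hook_act_strand:
  assumes "x \<noteq> 0" "y \<noteq> 0" "x \<noteq> y"
  shows "hook_act x y strand (Inl z) = (if z = x then Inl y else if z = y then Inl x else if z = - x then Inl (- y)
      else if z = - y then Inl (- x) else Inr z)"
    "hook_act x y strand (Inr z) = (if z = x then Inr y else if z = y then Inr x else if z = - x then Inr (- y)
      else if z = - y then Inr (- x) else Inl z)"
  using assms by (auto simp: hook_act_def rejoin_def)

lemma diagram_of_hook:
  assumes xy: "x \<in> signed_points n" "y \<in> signed_points n" "x \<noteq> y" and parts: "hook_parts i = {{x, y}, {- x, - y}}"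
  shows "diagram_of n (hook_act x y strand) = hook_diagram n i"
proof -
  let ?f = "hook_act x y strand"
  have nz: "x \<noteq> 0" "y \<noteq> 0" using xy by (auto simp: signed_points_iff)
  note f = hook_act_strand[OF nz xy(3)]
  have U: "\<Union> (hook_parts i) = {x, y, - x, - y}" by (auto simp: parts)
  have hooks: "B \<in> hook_diagram n i \<longleftrightarrow> B = {Inl x, Inl y} \<or> B = {Inl (- x), Inl (- y)} \<or> B = {Inr x, Inr y}
    \<or> B = {Inr (- x), Inr (- y)} \<or> (\<exists>z\<in>signed_points n - {x, y, - x, - y}. B = {Inl z, Inr z})" for B
    unfolding hook_diagram_def U unfolding parts
    by (simp only: Un_iff image_insert image_empty insert_iff empty_iff mem_Collect_eq) blast
  have pts: "- x \<in> signed_points n" "- y \<in> signed_points n" using xy by simp_all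
  have into: "{u, ?f u} \<in> hook_diagram n i" if "u \<in> vertices n" for u
  proof (cases u)
    case (Inl z)
    then have z: "z \<in> signed_points n" using that by simp
    consider "z = x" | "z = y" | "z = - x" | "z = - y" | "z \<notin> {x, y, - x, - y}" by blast
    then show ?thesis
    proof cases
      case 5
      then have "?f (Inl z) = Inr z" by (simp add: f)
      then show ?thesis
        unfolding hooks Inl using 5 z by (intro disjI2 bexI[of _ z]) (simp_all add: insert_commute)
    qed (use nz xy in \<open>simp_all add: hooks Inl f insert_commute\<close>)
  next
    case (Inr z)
    then have z: "z \<in> signed_points n" using that by simp
    consider "z = x" | "z = y" | "z = - x" | "z = - y" | "z \<notin> {x, y, - x, - y}" by blast
    then show ?thesis
    proof cases
      case 5
      then have "?f (Inr z) = Inl z" by (simp add: f)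
      then show ?thesis
        unfolding hooks Inr using 5 z by (intro disjI2 bexI[of _ z]) (simp_all add: insert_commute)
    qed (use nz xy in \<open>simp_all add: hooks Inr f insert_commute\<close>)
  qed
  have forth: "B \<in> diagram_of n ?f" if "u \<in> vertices n" "B = {u, ?f u}" for u B
    using that by (auto simp: diagram_of_def)
  show ?thesis
  proof (intro subset_antisym subsetI)
    fix B assume "B \<in> diagram_of n ?f"
    then show "B \<in> hook_diagram n i" using into by (auto simp: diagram_of_def)
  next
    fix B assume "B \<in> hook_diagram n i"
    then consider "B = {Inl x, Inl y}" | "B = {Inl (- x), Inl (- y)}" | "B = {Inr x, Inr y}" | "B = {Inr (- x), Inr (- y)}"
      | z where "z \<in> signed_points n" "z \<notin> {x, y, - x, - y}" "B = {Inl z, Inr z}" unfolding hooks by blast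
    then show "B \<in> diagram_of n ?f"
    proof cases
      case 1
      then show ?thesis using xy by (intro forth[of "Inl x"]) (simp_all add: f)
    next
      case 2
      then show ?thesis using xy nz by (intro forth[of "Inl (- x)"]) (auto simp: f)
    next
      case 3
      then show ?thesis using xy by (intro forth[of "Inr x"]) (simp_all add: f)
    next
      case 4
      then show ?thesis using xy nz by (intro forth[of "Inr (- x)"]) (auto simp: f)
    next
      case 5
      then show ?thesis by (intro forth[of "Inl z"]) (simp_all add: f)
    qed
  qed
qed

section \<open>Words and diagrams\<close>

fun letter_act :: "letter \<Rightarrow> (int + int \<Rightarrow> int + int) \<Rightarrow> int + int \<Rightarrow> int + int" where
  "letter_act (S i) f = relabel (s_perm i) f"
| "letter_act (H i) f = (if i = 0 then hook_act 1 (- 1) f else hook_act (int i) (int i + 1) f)"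

lemma letters_cases:
  assumes "a \<in> letters n"
  obtains i where "a = S i" "i < n" | "a = H 0" "0 < n" | i where "a = H i" "0 < i" "i < n"
  using assms by (auto simp: letters_def)

lemma points_letters:
  "i < n \<Longrightarrow> 0 < i \<Longrightarrow> int i \<in> signed_points n" "i < n \<Longrightarrow> int i + 1 \<in> signed_points n"
  "0 < n \<Longrightarrow> 1 \<in> signed_points n" "0 < n \<Longrightarrow> - 1 \<in> signed_points n"
  by (auto simp: signed_points_iff)

lemma letter_act_signed:
  assumes "a \<in> letters n" "signed_matching n f" shows "signed_matching n (letter_act a f)"
  using assms(1)
  by (cases rule: letters_cases)
    (auto intro!: signed_matching_relabel signed_matching_hook_act assms(2) s_perm_signed points_letters)

lemma letter_act_part:
  assumes "a \<in> letters n" "signed_matching n f"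
  shows "matching_diagram f * letter_part a = matching_diagram (letter_act a f)"
  using assms(1)
proof (cases rule: letters_cases)
  case (1 i)
  then show ?thesis
    using matching_relabel_mult[OF signed_matchingD(1)[OF assms(2)] s_perm_bij] by (simp add: perm_part_def)
qed (use hook_act_mult[OF signed_matchingD(1)[OF assms(2)]] in auto)

lemma diagram_of_letter:
  assumes "a \<in> letters n" shows "diagram_of n (letter_act a strand) = letter_diagram n a"
  using assms
proof (cases rule: letters_cases)
  case (1 i)
  then show ?thesis using diagram_of_relabel[OF s_perm_signed[of i n]] by (simp add: s_diagram_def)
next
  case 2
  then show ?thesis
    using diagram_of_hook[of 1 n "- 1" 0] points_letters(3,4)[of n] by (simp add: hook_parts_def insert_commute)
next
  case (3 i)
  then show ?thesis
    using diagram_of_hook[of "int i" n "int i + 1" i] points_letters(1,2)[of i n] by (simp add: hook_parts_def)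
qed

fun word_matching :: "letter list \<Rightarrow> (int + int \<Rightarrow> int + int) \<Rightarrow> int + int \<Rightarrow> int + int" where
  "word_matching [] f = f"
| "word_matching (a # w) f = word_matching w (letter_act a f)"

lemma word_matching_signed:
  "w \<in> lists (letters n) \<Longrightarrow> signed_matching n f \<Longrightarrow> signed_matching n (word_matching w f)"
  by (induction w arbitrary: f) (auto intro: letter_act_signed)

lemma word_matching_part:
  "w \<in> lists (letters n) \<Longrightarrow> signed_matching n f \<Longrightarrow>
    matching_diagram f * prod_list (map letter_part w) = matching_diagram (word_matching w f)"
proof (induction w arbitrary: f)
  case (Cons a w)
  then show ?case
    using letter_act_part[of a n f] letter_act_signed[of a n f] by (simp flip: mult.assoc)
qed simp

context brauer_B_relations
begin

lemma normal_form_letter: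
  assumes "a \<in> letters n" "signed_matching n f" "normal_form f m"
  shows "normal_form (letter_act a f) (m * val a)"
  using assms(1)
proof (cases rule: letters_cases)
  case (1 i)
  then show ?thesis using normal_form_rep[OF assms(2) s_perm_signed assms(3)] by (simp add: rep_s_perm)
next
  case 2
  then show ?thesis
    using normal_form_hook[OF assms(2,3), of 1 "- 1"] points_letters(3,4)[of n] hook_one by simp
next
  case (3 i)
  then show ?thesis
    using normal_form_hook[OF assms(2,3), of "int i" "int i + 1"] points_letters(1,2)[of i n] hook_eta by simp
qed

text \<open>The induction runs from the left, because a letter is multiplied on the right.\<close>
theorem normal_form_word:
  "w \<in> lists (letters n) \<Longrightarrow> signed_matching n f \<Longrightarrow> normal_form f m \<Longrightarrow>
    normal_form (word_matching w f) (m * prod_list (map val w))"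
proof (induction w arbitrary: f m)
  case (Cons a w)
  then have "normal_form (word_matching w (letter_act a f)) ((m * val a) * prod_list (map val w))"
    by (intro Cons.IH normal_form_letter letter_act_signed) auto
  then show ?case by (simp add: mult.assoc)
qed simp

text \<open>Both words are normal forms of the same matching, by \<open>normal_form_word\<close>
  applied to the vertical strands.\<close>
theorem equal_words:
  assumes "u \<in> lists (letters n)" "v \<in> lists (letters n)" "word_matching u strand = word_matching v strand"
  shows "prod_list (map val u) = prod_list (map val v)"
  using normal_form_unique[OF word_matching_signed[OF assms(1) signed_matching_strand]]
    normal_form_word[OF assms(1) signed_matching_strand normal_form_one]
    normal_form_word[OF assms(2) signed_matching_strand normal_form_one] assms(3) by simp

end

section \<open>Every symmetric matching is a product of letters\<close>

text \<open>The through strands are prescribed orbit by orbit with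
  \<open>extend_to_signed_perm_step\<close>; an earlier prescription is not destroyed because
  \<open>f\<close> is injective.\<close>
lemma extend_partial_signed_perm:
  assumes f: "signed_matching n f"
  obtains g where "signed_perm n g" "\<forall>x y. f (Inl x) = Inr y \<longrightarrow> g x = y"
proof -
  note R = signed_matching_rows[OF f] and D = signed_matchingD[OF f]
  let ?T = "{x \<in> signed_points n. \<exists>y. f (Inl x) = Inr y}"
  have fin: "finite ?T"
    by (rule finite_subset[of _ "{- int n..int n}"]) (auto simp: signed_points_def)
  have ex: "\<exists>g. signed_perm n g \<and> (\<forall>x\<in>S. \<forall>y. f (Inl x) = Inr y \<longrightarrow> g x = y)" if "S \<subseteq> ?T" for S
    using finite_subset[OF that fin] that
  proof (induction S rule: finite_induct)
    case empty
    show ?case by (intro exI[of _ id]) simp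
  next
    case (insert a S)
    then obtain g where g: "signed_perm n g" "\<And>x y. x \<in> S \<Longrightarrow> f (Inl x) = Inr y \<Longrightarrow> g x = y" by auto
    obtain z where a: "a \<in> signed_points n" and z: "f (Inl a) = Inr z" using insert.prems by auto
    have zp: "z \<in> signed_points n" using signed_matching_points(3)[OF f z] a by simp
    obtain g' where g': "signed_perm n g'" "g' a = z"
      "\<And>b. b \<noteq> 0 \<Longrightarrow> \<bar>b\<bar> \<noteq> \<bar>a\<bar> \<Longrightarrow> \<bar>g b\<bar> \<noteq> \<bar>z\<bar> \<Longrightarrow> g' b = g b"
      using extend_to_signed_perm_step[OF g(1) a zp] by metis
    have "g' x = y" if x: "x \<in> insert a S" and y: "f (Inl x) = Inr y" for x y
    proof (cases "\<bar>x\<bar> = \<bar>a\<bar>")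
      case True
      then consider "x = a" | "x = - a" by (auto simp: abs_eq_iff)
      then show ?thesis
      proof cases
        case 1
        then show ?thesis using g'(2) z y by simp
      next
        case 2
        then have "y = - z" using R(8)[OF z] y by simp
        then show ?thesis using g'(2) signed_perm_uminus[OF g'(1), of a] 2 by simp
      qed
    next
      case False
      then have xS: "x \<in> S" using x by auto
      then have gx: "g x = y" using g(2) y by blast
      have "x \<noteq> 0" using xS insert.prems by (auto simp: signed_points_iff)
      moreover have "\<bar>g x\<bar> \<noteq> \<bar>z\<bar>"
      proof
        assume "\<bar>g x\<bar> = \<bar>z\<bar>"
        then have "y = z \<or> y = - z" using gx by (auto simp: abs_eq_iff)
        then have "f (Inl x) = f (Inl a) \<or> f (Inl x) = f (Inl (- a))" using y z R(8)[OF z] by auto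
        then show False using False D(6) by auto
      qed
      ultimately show ?thesis using g'(3) False gx by blast
    qed
    then show ?case using g'(1) by blast
  qed
  from ex[OF order.refl] obtain g
    where g: "signed_perm n g" and gT: "\<forall>x\<in>?T. \<forall>y. f (Inl x) = Inr y \<longrightarrow> g x = y"
    by (elim exE conjE)
  have "g x = y" if y: "f (Inl x) = Inr y" for x y
  proof (cases "x \<in> signed_points n")
    case True
    then have "x \<in> ?T" using y by simp
    then show ?thesis using gT y by simp
  next
    case False
    then have "y = x" using D(3)[OF False] y by simp
    then show ?thesis
      using False signed_perm_outside[OF g, of x] signed_perm_zero[OF g]
      by (cases "x = 0") (auto simp: signed_points_iff)
  qed
  then have "\<forall>x y. f (Inl x) = Inr y \<longrightarrow> g x = y" by simp
  with g show ?thesis by (rule that)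
qed

lemma related_mult_intro:
  assumes "(emb 0 2 a, emb 0 2 b) \<in> (place 0 1 (related d) \<union> place 1 2 (related e))\<^sup>*"
  shows "(a, b) \<in> related (d * e)"
  using assms by (simp add: related_mult stack_comp_def)

lemma related_top: "(Inl x, Inl y) \<in> related d \<Longrightarrow> (Inl x, Inl y) \<in> related (d * e)"
  using place_edge[of "Inl x" "Inl y" "related d" 0 1] by (intro related_mult_intro) auto

lemma related_bottom: "(Inr x, Inr y) \<in> related e \<Longrightarrow> (Inr x, Inr y) \<in> related (d * e)"
  using place_edge[of "Inr x" "Inr y" "related e" 1 2] by (intro related_mult_intro) auto

lemma related_through:
  assumes "(Inl x, Inr y) \<in> related d" "(Inl y, Inr z) \<in> related e"
  shows "(Inl x, Inr z) \<in> related (d * e)"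
  using place_edge[OF assms(1), of 0 1] place_edge[OF assms(2), of 1 2]
  by (intro related_mult_intro) (auto intro: converse_rtrancl_into_rtrancl)

lemma related_one_through: "(Inl x, Inr x) \<in> related 1"
  by (simp add: related_one strand_rel_def)

lemma idem_prod_induct:
  assumes "commuting_idempotents A" "P 1" "\<And>a b. P a \<Longrightarrow> P b \<Longrightarrow> P (a * b)" "\<And>a. a \<in> A \<Longrightarrow> P a"
  shows "P (idem_prod A)"
proof -
  obtain xs where xs: "A = set xs" by (rule commuting_idempotents_list[OF assms(1)])
  have "P (prod_list xs)" using assms(2-4) unfolding xs by (induction xs) auto
  then show ?thesis using idem_prod_set[of xs] assms(1) xs by simp
qed

lemma hook_part_related:
  assumes "x \<noteq> 0" "y \<noteq> 0" "x \<noteq> y"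
  shows "(Inl x, Inl y) \<in> related (hook_part x y)" "(Inr x, Inr y) \<in> related (hook_part x y)"
    "u \<notin> {x, - x, y, - y} \<Longrightarrow> (Inl u, Inr u) \<in> related (hook_part x y)"
proof -
  have "related (hook_part x y) = matching_rel (hook_act x y strand)"
    using hook_act_mult[OF matching_strand assms(3)] related_matching[OF matching_hook_act[OF matching_strand assms(3)]]
    by (simp add: matching_diagram_strand)
  then show "(Inl x, Inl y) \<in> related (hook_part x y)" "(Inr x, Inr y) \<in> related (hook_part x y)"
    "u \<notin> {x, - x, y, - y} \<Longrightarrow> (Inl u, Inr u) \<in> related (hook_part x y)"
    by (simp_all add: matching_rel_def hook_act_strand[OF assms])
qed

text \<open>In \<open>partn\<close> the normal form of \<open>f\<close> is a product of letters,
  hence the element of some matching. Its factors are followed one by one: a product of hooks joins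
  its pairs in both rows and is vertical elsewhere, so the outer factors produce the pairs of
  \<open>f\<close> in the top and bottom rows, and \<open>rep g\<close> produces its through
  strands. This determines the matching.\<close>
theorem matching_is_word:
  assumes f: "signed_matching n f"
  obtains w where "w \<in> lists (letters n)" "word_matching w strand = f"
proof -
  interpret brauer_B_relations n letter_part
    by standard (rule letter_part_relations)
  let ?W = "(\<lambda>w. prod_list (map letter_part w)) ` lists (letters n)"
  have W_mult: "a * b \<in> ?W" if ab: "a \<in> ?W" "b \<in> ?W" for a b
  proof -
    obtain u v where "u \<in> lists (letters n)" "a = prod_list (map letter_part u)" "v \<in> lists (letters n)" "b = prod_list (map letter_part v)"
      using ab by blast
    then show ?thesis by (intro image_eqI[of _ _ "u @ v"]) auto
  qed
  have W_one: "1 \<in> ?W" by (intro image_eqI[of _ _ "[]"]) auto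
  have W_letter: "letter_part a \<in> ?W" if "a \<in> letters n" for a
    using that by (intro image_eqI[of _ _ "[a]"]) auto
  have W_rep: "rep g \<in> ?W" if g: "signed_perm n g" for g
  proof -
    have "S i \<in> letters n" if "i \<in> set (perm_word n g)" for i
      using subsetD[OF perm_word_letters[OF g] that] by (simp add: letters_def)
    then have l: "map S (perm_word n g) \<in> lists (letters n)" by (intro in_listsI) auto
    show ?thesis unfolding rep_def by (rule image_eqI[OF _ l]) (simp add: comp_def)
  qed
  have rep_part: "rep g = perm_part g" if "signed_perm n g" for g
  proof -
    have word: "prod_list (map (\<lambda>i. perm_part (s_perm i)) w) = perm_part (word_perm w)" for w
    proof (induction w)
      case Nil
      then show ?case using perm_part_id by (simp add: id_def)
    next
      case (Cons i w)
      have "bij (word_perm w)"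
        by (induction w) (simp_all add: bij_comp[unfolded comp_def] s_perm_bij bij_id[unfolded id_def])
      then show ?case using Cons by (simp add: perm_part_mult s_perm_bij comp_def)
    qed
    have "rep g = perm_part (word_perm (perm_word n g))"
      unfolding rep_def by (simp only: letter_part.simps word)
    then show ?thesis by (simp only: word_perm_perm_word[OF that])
  qed
  have conj_part: "conj_by g (hook_part x y) = hook_part (g x) (g y)" if "signed_perm n g" "x \<noteq> y" for g x y
    unfolding conj_by_def mult.assoc
    by (simp only: rep_part[OF that(1)] hook_part_move[OF that] rep_inverse_left(2)[OF that(1), unfolded rep_part[OF that(1)]])
  have hook_facts: "hook x y = hook_part x y \<and> hook x y \<in> ?W"
    if xy: "x \<in> signed_points n" "y \<in> signed_points n" "x \<noteq> y" for x y
  proof (cases "y = - x")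
    case True
    have n: "0 < n" using xy by (auto simp: signed_points_iff)
    obtain g where g: "signed_perm n g" "g 1 = x" using extend_to_signed_perm1[OF xy(1)] .
    have hook: "hook x y = conj_by g (letter_part (H 0))" using hook_single[OF n g(1)] g(2) True by simp
    moreover have "\<dots> \<in> ?W"
      unfolding conj_by_def using n g(1)
      by (intro W_mult W_rep W_letter signed_perm_inverse) (auto simp: letters_def)
    ultimately show ?thesis using conj_part[OF g(1), of 1 "- 1"] g True signed_perm_uminus[OF g(1), of 1] by simp
  next
    case False
    then have abs: "\<bar>x\<bar> \<noteq> \<bar>y\<bar>" using xy(3) by (auto simp: abs_eq_iff)
    then have n: "1 < n" using xy by (auto simp: signed_points_iff)
    obtain g where g: "signed_perm n g" "g 1 = x" "g 2 = y" using extend_to_signed_perm2[OF xy(1,2) abs] .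
    have hook: "hook x y = conj_by g (letter_part (H 1))" using hook_pair[OF n g(1)] g by simp
    moreover have "\<dots> \<in> ?W"
      unfolding conj_by_def using n g(1)
      by (intro W_mult W_rep W_letter signed_perm_inverse) (auto simp: letters_def)
    ultimately show ?thesis using conj_part[OF g(1), of 1 2] g by simp
  qed
  have W_prod: "hook_prod A \<beta> \<in> ?W" if A: "signed_pairing n A \<beta>" for A \<beta>
    unfolding hook_prod_def
  proof (rule idem_prod_induct[OF commuting_hooks[OF A]])
    fix a assume "a \<in> (\<lambda>x. hook x (\<beta> x)) ` A"
    then obtain x where x: "x \<in> A" "a = hook x (\<beta> x)" by blast
    have "x \<noteq> \<beta> x" using signed_pairingD(6)[OF A x(1)] by simp
    with hook_facts[OF signed_pairingD(1,8)[OF A x(1)]] show "a \<in> ?W" unfolding x(2) by blast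
  qed (use W_one W_mult in blast)+
  have inside: "(Inl x, Inl y) \<in> related (hook_prod A \<beta>)" "(Inr x, Inr y) \<in> related (hook_prod A \<beta>)"
    if A: "signed_pairing n A \<beta>" and x: "x \<in> A" "\<beta> x = y" for A \<beta> x y
  proof -
    note D = signed_pairingD[OF A x(1), unfolded x(2)]
    have xy: "x \<noteq> 0" "y \<noteq> 0" "x \<noteq> y" using D by (auto simp: signed_points_iff)
    have h: "hook x y = hook_part x y" using hook_facts[OF D(1,8) xy(3)] by blast
    show "(Inr x, Inr y) \<in> related (hook_prod A \<beta>)"
      unfolding hook_prod_remove(1)[OF A x] h by (rule related_bottom[OF hook_part_related(2)[OF xy]])
    show "(Inl x, Inl y) \<in> related (hook_prod A \<beta>)"
      unfolding hook_prod_remove(1)[OF A x] hook_prod_remove(2)[OF A x] unfolding h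
      by (rule related_top[OF hook_part_related(1)[OF xy]])
  qed
  have outside: "(Inl u, Inr u) \<in> related (hook_prod A \<beta>)"
    if A: "signed_pairing n A \<beta>" and u: "u \<notin> A" for A \<beta> u
    unfolding hook_prod_def
  proof (rule idem_prod_induct[OF commuting_hooks[OF A], where P = "\<lambda>a. (Inl u, Inr u) \<in> related a"])
    fix a assume "a \<in> (\<lambda>x. hook x (\<beta> x)) ` A"
    then obtain x where x: "x \<in> A" "a = hook x (\<beta> x)" by blast
    note D = signed_pairingD[OF A x(1)]
    have xy: "x \<noteq> 0" "\<beta> x \<noteq> 0" "x \<noteq> \<beta> x" using D(1,6,8) by (auto simp: signed_points_iff)
    have "- \<beta> x \<in> A" by (rule signed_pairingD(2)[OF A D(3)])
    then have "u \<notin> {x, - x, \<beta> x, - \<beta> x}" using u x(1) D(2,3) by blast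
    moreover have "hook x (\<beta> x) = hook_part x (\<beta> x)" using hook_facts[OF D(1,8) xy(3)] by blast
    ultimately show "(Inl u, Inr u) \<in> related a" unfolding x(2) using hook_part_related(3)[OF xy] by simp
  next
    fix a b assume "(Inl u, Inr u) \<in> related a" "(Inl u, Inr u) \<in> related b"
    then show "(Inl u, Inr u) \<in> related (a * b)" by (rule related_through)
  qed (rule related_one_through)
  have rep_related: "(Inl x, Inr (g x)) \<in> related (rep g)" if g: "signed_perm n g" for g x
    using related_matching[OF matching_relabel[OF matching_strand signed_perm_bij[OF g]]]
    unfolding rep_part[OF g] by (simp add: perm_part_def matching_rel_def relabel_def)
  note T = signed_pairing_top[OF f] and B = signed_pairing_bottom[OF f] and iff = row_points_iff[OF f]
  let ?E = "hook_prod (row_points n Inl f) (row_partner Inl f)"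
  let ?F = "bottom_half (row_points n Inr f) (row_partner Inr f)"
  obtain g where g0: "signed_perm n g" "\<forall>x y. f (Inl x) = Inr y \<longrightarrow> g x = y"
    using extend_partial_signed_perm[OF f] .
  have g: "signed_perm n g" "\<And>x y. f (Inl x) = Inr y \<Longrightarrow> g x = y"
    by (rule g0(1)) (simp add: g0(2))
  have "?E * rep g * ?F \<in> ?W"
    unfolding bottom_half_def
    by (intro W_mult W_prod W_rep T B signed_pairing_singles[OF B] g)
  then obtain w where w: "w \<in> lists (letters n)" "?E * rep g * ?F = prod_list (map letter_part w)" by blast
  let ?f' = "word_matching w strand"
  have f': "signed_matching n ?f'" by (rule word_matching_signed[OF w(1) signed_matching_strand])
  have "matching_diagram ?f' = ?E * rep g * ?F"
    using word_matching_part[OF w(1) signed_matching_strand] w(2) by (simp add: matching_diagram_strand)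
  then have rel: "matching_rel ?f' = related (?E * rep g * ?F)"
    using related_matching[OF signed_matchingD(1)[OF f']] by simp
  have read: "?f' u = v" if "(u, v) \<in> related (?E * rep g * ?F)" "u \<noteq> v" for u v
    using that matching_relD[of u v ?f'] unfolding rel[symmetric] by auto
  have top: "?f' (Inl x) = f (Inl x)" for x
  proof (cases "f (Inl x)")
    case (Inl y)
    then have x: "x \<in> row_points n Inl f" "row_partner Inl f x = y" by (auto simp: iff)
    have "(Inl x, Inl y) \<in> related (?E * rep g * ?F)"
      by (intro related_top inside(1)[OF T x])
    moreover have "x \<noteq> y" using signed_matchingD(5)[OF f, of "Inl x"] Inl by auto
    ultimately show ?thesis using read Inl by simp
  next
    case (Inr y)
    have "f (Inr y) = Inl x" by (rule signed_matching_rows(7)[OF f Inr])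
    then have out: "x \<notin> row_points n Inl f" "y \<notin> row_points n Inr f" using Inr by (auto simp: iff)
    have mid: "(Inl x, Inr y) \<in> related (rep g)" using rep_related[OF g(1), of x] g(2)[OF Inr] by simp
    have low: "(Inl y, Inr y) \<in> related ?F"
      unfolding bottom_half_def
      by (rule related_through) (rule outside[OF signed_pairing_singles[OF B] out(2)], rule outside[OF B out(2)])
    have "(Inl x, Inr y) \<in> related (?E * rep g * ?F)"
      by (rule related_through[OF related_through[OF outside[OF T out(1)] mid] low])
    then show ?thesis using read Inr by simp
  qed
  moreover have "?f' (Inr y) = f (Inr y)" for y
  proof (cases "f (Inr y)")
    case (Inl x)
    then have "?f' (Inl x) = Inr y" using top[of x] signed_matching_rows(5)[OF f Inl] by simp
    then show ?thesis using signed_matching_rows(7)[OF f'] Inl by simp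
  next
    case (Inr z)
    then have y: "y \<in> row_points n Inr f" "row_partner Inr f y = z" by (auto simp: iff)
    have "(Inr y, Inr z) \<in> related (?E * rep g * ?F)"
      unfolding bottom_half_def by (intro related_bottom inside(2)[OF B y])
    moreover have "y \<noteq> z" using signed_matchingD(5)[OF f, of "Inr y"] Inr by auto
    ultimately show ?thesis using read Inr by simp
  qed
  ultimately have "?f' = f" by (rule matching_fun_eqI)
  then show ?thesis using that w(1) by blast
qed

section \<open>The presentation\<close>

lemma brauer_relations_lists: "brauer_relations_B n \<subseteq> lists (letters n) \<times> lists (letters n)"
proof clarify
  fix u v assume "(u, v) \<in> brauer_relations_B n"
  then show "u \<in> lists (letters n) \<and> v \<in> lists (letters n)"
    by cases (auto simp: letters_def)
qed

definition word_diagram :: "nat \<Rightarrow> letter list \<Rightarrow> int diagram" where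
  "word_diagram n w = diagram_of n (word_matching w strand)"

lemma word_diagram_mult:
  assumes u: "u \<in> lists (letters n)" and v: "v \<in> lists (letters n)"
  shows "diagram_mult (word_diagram n u) (word_diagram n v) = word_diagram n (u @ v)"
proof -
  have part: "matching_diagram (word_matching w strand) = prod_list (map letter_part w)"
    if "w \<in> lists (letters n)" for w
    using word_matching_part[OF that signed_matching_strand] by (simp add: matching_diagram_strand)
  have uv: "u @ v \<in> lists (letters n)" using u v by simp
  show ?thesis
    unfolding word_diagram_def
    by (rule diagram_mult_diagram_of; (intro word_matching_signed signed_matching_strand u v uv)?)
      (simp only: part[OF u] part[OF v] part[OF uv] map_append prod_list.append)
qed

text \<open>Diagrams are exactly the values of words, so the monoid laws for diagrams follow from
  those for words.\<close>
lemma word_diagram_carrier: "carrier (brauer_monoid_B n) = word_diagram n ` lists (letters n)"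
proof (intro subset_antisym subsetI)
  fix d assume "d \<in> carrier (brauer_monoid_B n)"
  then obtain f where f: "signed_matching n f" "d = diagram_of n f" by (rule carrier_diagram_of)
  obtain w where "w \<in> lists (letters n)" "word_matching w strand = f" using matching_is_word[OF f(1)] .
  then show "d \<in> word_diagram n ` lists (letters n)" unfolding f(2) word_diagram_def by blast
next
  fix d assume "d \<in> word_diagram n ` lists (letters n)"
  then obtain w where "w \<in> lists (letters n)" "d = word_diagram n w" by blast
  then show "d \<in> carrier (brauer_monoid_B n)"
    unfolding word_diagram_def using diagram_of_carrier word_matching_signed signed_matching_strand by blast
qed

lemma word_diagram_eq_iff:
  assumes "u \<in> lists (letters n)" "v \<in> lists (letters n)"
  shows "word_diagram n u = word_diagram n v \<longleftrightarrow> word_matching u strand = word_matching v strand"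
  unfolding word_diagram_def
  using diagram_of_inj[OF word_matching_signed[OF assms(1) signed_matching_strand] word_matching_signed[OF assms(2) signed_matching_strand]]
  by auto

theorem theorem26:
  fixes n :: nat
  shows "is_presentation (letters n) (brauer_relations_B n) (brauer_monoid_B n) (letter_diagram n)"
proof (rule is_presentationI[OF _ brauer_relations_lists])
  let ?M = "brauer_monoid_B n" and ?L = "lists (letters n)" and ?D = "word_diagram n"
  have mult: "?D u \<otimes>\<^bsub>?M\<^esub> ?D v = ?D (u @ v)" if "u \<in> ?L" "v \<in> ?L" for u v
    using word_diagram_mult[OF that] by (simp add: brauer_monoid_B_def brauer_monoid_def)
  have one: "\<one>\<^bsub>?M\<^esub> = ?D []"
    by (simp add: brauer_monoid_B_def brauer_monoid_def word_diagram_def diagram_of_strand)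
  have nil: "[] \<in> ?L" by simp
  have app: "u @ v \<in> ?L" if "u \<in> ?L" "v \<in> ?L" for u v using that by simp
  have words: "\<exists>w\<in>?L. d = ?D w" if "d \<in> carrier ?M" for d
    using that unfolding word_diagram_carrier by blast
  have closed: "?D w \<in> carrier ?M" if "w \<in> ?L" for w
    using that unfolding word_diagram_carrier by blast
  show "Group.monoid ?M"
  proof (rule Group.monoidI)
    fix d e assume "d \<in> carrier ?M" "e \<in> carrier ?M"
    from this[THEN words] obtain u v where uv: "u \<in> ?L" "d = ?D u" "v \<in> ?L" "e = ?D v" by blast
    show "d \<otimes>\<^bsub>?M\<^esub> e \<in> carrier ?M"
      unfolding uv(2,4) mult[OF uv(1,3)] by (rule closed[OF app[OF uv(1,3)]])
  next
    show "\<one>\<^bsub>?M\<^esub> \<in> carrier ?M" unfolding one by (rule closed[OF nil])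
  next
    fix d e c assume "d \<in> carrier ?M" "e \<in> carrier ?M" "c \<in> carrier ?M"
    from this[THEN words] obtain u v w where l: "u \<in> ?L" "v \<in> ?L" "w \<in> ?L" and d: "d = ?D u" "e = ?D v" "c = ?D w"
      by blast
    show "d \<otimes>\<^bsub>?M\<^esub> e \<otimes>\<^bsub>?M\<^esub> c = d \<otimes>\<^bsub>?M\<^esub> (e \<otimes>\<^bsub>?M\<^esub> c)"
      unfolding d mult[OF l(1,2)] mult[OF l(2,3)] mult[OF app[OF l(1,2)] l(3)] mult[OF l(1) app[OF l(2,3)]]
      by (simp only: append_assoc)
  next
    fix d assume "d \<in> carrier ?M"
    from words[OF this] obtain u where u: "u \<in> ?L" and d: "d = ?D u" by blast
    show "\<one>\<^bsub>?M\<^esub> \<otimes>\<^bsub>?M\<^esub> d = d" "d \<otimes>\<^bsub>?M\<^esub> \<one>\<^bsub>?M\<^esub> = d"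
      unfolding d one mult[OF nil u] mult[OF u nil] by simp_all
  qed
  have letter: "?D [a] = letter_diagram n a" if "a \<in> letters n" for a
    using diagram_of_letter[OF that] by (simp add: word_diagram_def)
  show "letter_diagram n a \<in> carrier ?M" if "a \<in> letters n" for a
    using closed[of "[a]"] letter[OF that] that by simp
  define ev where "ev = (\<lambda>w. foldr (\<lambda>a m. letter_diagram n a \<otimes>\<^bsub>?M\<^esub> m) w \<one>\<^bsub>?M\<^esub>)"
  then show "ev = (\<lambda>w. foldr (\<lambda>a m. letter_diagram n a \<otimes>\<^bsub>?M\<^esub> m) w \<one>\<^bsub>?M\<^esub>)" .
  have ev: "ev w = ?D w" if "w \<in> ?L" for w
    using that
  proof (induction w)
    case Nil
    show ?case by (simp add: ev_def one)
  next
    case (Cons a w)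
    then have a: "a \<in> letters n" "w \<in> ?L" by simp_all
    have "[a] \<in> ?L" using a by simp
    have "ev (a # w) = letter_diagram n a \<otimes>\<^bsub>?M\<^esub> ev w" by (simp add: ev_def)
    also have "\<dots> = ?D [a] \<otimes>\<^bsub>?M\<^esub> ?D w" using Cons.IH a letter by simp
    also have "\<dots> = ?D (a # w)" using mult[OF \<open>[a] \<in> ?L\<close> a(2)] by simp
    finally show ?case .
  qed
  show "ev u = ev v" if uv: "(u, v) \<in> brauer_relations_B n" for u v
  proof -
    have l: "u \<in> ?L" "v \<in> ?L" using brauer_relations_lists uv by blast+
    have "matching_diagram (word_matching u strand) = matching_diagram (word_matching v strand)"
      using letter_part_relations[OF uv] word_matching_part[OF l(1) signed_matching_strand]
        word_matching_part[OF l(2) signed_matching_strand] by (simp add: matching_diagram_strand)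
    then have "word_matching u strand = word_matching v strand"
      by (rule matching_diagram_inj[OF signed_matchingD(1)[OF word_matching_signed[OF l(1) signed_matching_strand]]
            signed_matchingD(1)[OF word_matching_signed[OF l(2) signed_matching_strand]]])
    then show ?thesis using ev l word_diagram_eq_iff[OF l] by simp
  qed
  show "\<exists>w\<in>?L. ev w = d" if d: "d \<in> carrier ?M" for d
  proof -
    obtain w where w: "w \<in> ?L" "d = ?D w" using words[OF d] by blast
    show ?thesis using ev[OF w(1)] w by blast
  qed
  show "(u, v) \<in> gen_congruence (letters n) (brauer_relations_B n)"
    if l: "u \<in> ?L" "v \<in> ?L" and eq: "ev u = ev v" for u v
  proof -
    interpret brauer_B_relations n "append_letter (letters n) (brauer_relations_B n)"
      by standard (rule append_letter_relations[OF brauer_relations_lists])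
    have "word_matching u strand = word_matching v strand"
      using eq ev l word_diagram_eq_iff[OF l] by simp
    then show ?thesis
      by (intro append_letter_faithful[OF brauer_relations_lists l] equal_words l)
  qed
qed

end
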